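(* Let $\varepsilon>0$ and $\nu>0$. Let $\pi$ be the uniform distribution over a convex body $\mathcal{C}\subset\mathbb{R}^d$ and let $\widetilde V$ be a twice continuously differentiable barrier function for $\mathcal{C}$ that is $\nu^{-1}$-exp-concave, i.e. $\exp(-\nu^{-1}\widetilde V)$ is concave. Let $0<\beta\le\varepsilon^2/(2\nu)$ and let $\pi_\beta$ be the probability measure with density proportional to $e^{-\beta\widetilde V}$. Then the law $(\mu_t)_{t\ge0}$ of the Newton-Langevin diffusion with target density $\pi_\beta$ satisfies $\|\mu_t-\pi\|_{\rm TV}\le\varepsilon$ by time $$t=\tfrac12\ln\bigl[2\chi^2(\mu_0\,\|\,\pi_\beta)\bigr]+\ln(1/\varepsilon),$$ i.e. for all $t\ge0$ at least as large as this value.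
   Context: A barrier function for $\mathcal{C}$ is a strictly convex function $\widetilde V:\mathbb{R}^d\to\mathbb{R}\cup\{\infty\}$ with $\operatorname{dom}\widetilde V=\mathcal{C}$ and $\widetilde V(x)\to\infty$ as $x\to\partial\mathcal{C}$ (so $\mathcal{C}$ is understood up to its boundary, $\widetilde V$ being finite and twice continuously differentiable on the interior of $\mathcal{C}$). For a probability density $e^{-U}$ with $U$ strictly convex and twice continuously differentiable on the interior of its domain, the Newton-Langevin diffusion $(X_t)_{t\ge0}$ with target $e^{-U}$ is the solution of $$X_t=\nabla U^\star(Y_t),\qquad dY_t=-\nabla U(X_t)\,dt+\sqrt2\,[\nabla^2U(X_t)]^{1/2}\,dB_t,$$ where $U^\star$ is the convex conjugate of $U$ and $(B_t)$ is a standard Brownian motion in $\mathbb{R}^d$; $\mu_t$ is the law of $X_t$. Here $U=\beta\widetilde V+\text{const}$. Standing assumption: $\nabla^2U$ is invertible wherever its inverse is used, and $\mu_t$ (identified with its Lebesgue density) is the unique solution of the Fokker–Planck equation $\partial_t\mu_t=\operatorname{div}\bigl(\mu_t(\nabla^2U)^{-1}\nabla\ln\frac{\mu_t}{\pi_\beta}\bigr)$, with enough regularity that (when $\chi^2(\mu_0\|\pi_\beta)<\infty$) $\int\mu_t^2/\pi_\beta$ may be differentiated in $t$ under the integral sign and the resulting integral integrated by parts without boundary terms. Notation: $\chi^2(\mu\|\pi)=\int(\frac{d\mu}{d\pi})^2d\pi-1$ if $\mu\ll\pi$ and $+\infty$ otherwise; $\|\mu-\pi\|_{\rm TV}=\sup_A|\mu(A)-\pi(A)|$.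 *)

theory Defs
  imports "HOL-Probability.Probability"
begin

section \<open>Extended-valued functions and differential operators\<close>

definition edom :: "('a \<Rightarrow> ereal) \<Rightarrow> 'a set" where
  "edom V = {x. V x < \<infinity>}"

text \<open>\<open>exp_neg v\<close> is \<open>exp (- v)\<close> on \<open>(-\<infinity>, \<infinity>]\<close>, with \<open>exp (- \<infinity>) = 0\<close>.\<close>

definition exp_neg :: "ereal \<Rightarrow> real" where
  "exp_neg v = (if v = \<infinity> then 0 else exp (- real_of_ereal v))"

text \<open>Logarithm with \<open>ln 0 = -\<infinity>\<close> and \<open>ln \<infinity> = \<infinity>\<close>; only applied to nonnegative arguments.\<close>

definition eln :: "ereal \<Rightarrow> ereal" where
  "eln v = (if v = \<infinity> then \<infinity> else if v \<le> 0 then -\<infinity> else ereal (ln (real_of_ereal v)))"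

definition grad :: "(real^'n \<Rightarrow> real) \<Rightarrow> real^'n \<Rightarrow> real^'n" where
  "grad f x = (\<chi> i. frechet_derivative f (at x) (axis i 1))"

definition hess :: "(real^'n \<Rightarrow> real) \<Rightarrow> real^'n \<Rightarrow> real^'n^'n" where
  "hess f x = jacobian (grad f) (at x)"

definition divergence :: "(real^'n \<Rightarrow> real^'n) \<Rightarrow> real^'n \<Rightarrow> real" where
  "divergence F x = trace (jacobian F (at x))"

definition C2_on :: "(real^'n) set \<Rightarrow> (real^'n \<Rightarrow> real) \<Rightarrow> bool" where
  "C2_on S f \<longleftrightarrow> (\<forall>x\<in>S. f differentiable (at x)) \<and> (\<forall>x\<in>S. grad f differentiable (at x))
     \<and> continuous_on S (hess f)"

definition strictly_convex :: "('a::real_vector \<Rightarrow> ereal) \<Rightarrow> bool" where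
  "strictly_convex V \<longleftrightarrow> (\<forall>x\<in>edom V. \<forall>y\<in>edom V. \<forall>t. x \<noteq> y \<longrightarrow> 0 < t \<longrightarrow> t < 1 \<longrightarrow>
     V ((1 - t) *\<^sub>R x + t *\<^sub>R y) < ereal (1 - t) * V x + ereal t * V y)"

definition convex_conjugate :: "('a::real_inner \<Rightarrow> ereal) \<Rightarrow> 'a \<Rightarrow> ereal" where
  "convex_conjugate U y = (SUP x. ereal (x \<bullet> y) - U x)"

definition convex_body :: "('a::euclidean_space) set \<Rightarrow> bool" where
  "convex_body C \<longleftrightarrow> convex C \<and> compact C \<and> interior C \<noteq> {}"

text \<open>The domain is prescribed only up to the boundary of \<open>C\<close>. (Convexity together with the blow-up
  condition then forces the value \<open>\<infinity>\<close> on \<open>frontier C\<close>.)\<close>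

definition barrier :: "(real^'n) set \<Rightarrow> (real^'n \<Rightarrow> ereal) \<Rightarrow> bool" where
  "barrier C V \<longleftrightarrow> (\<forall>x. V x \<noteq> -\<infinity>) \<and> strictly_convex V
     \<and> interior C \<subseteq> edom V \<and> edom V \<subseteq> C
     \<and> (\<forall>z\<in>frontier C. (V \<longlongrightarrow> \<infinity>) (at z within interior C))"

definition exp_concave_on :: "'a::real_vector set \<Rightarrow> real \<Rightarrow> ('a \<Rightarrow> ereal) \<Rightarrow> bool" where
  "exp_concave_on C \<alpha> V \<longleftrightarrow> concave_on C (\<lambda>x. exp_neg (ereal \<alpha> * V x))"


section \<open>Measures and divergences between them\<close>

definition gibbs_potential :: "real \<Rightarrow> (real^'n \<Rightarrow> ereal) \<Rightarrow> real^'n \<Rightarrow> ereal" where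
  "gibbs_potential \<beta> V x =
     ereal \<beta> * V x + ereal (ln (LINT y|lborel. exp_neg (ereal \<beta> * V y)))"

definition gibbs :: "real \<Rightarrow> (real^'n \<Rightarrow> ereal) \<Rightarrow> (real^'n) measure" where
  "gibbs \<beta> V = density lborel (\<lambda>x. ennreal (exp_neg (gibbs_potential \<beta> V x)))"

definition chi2 :: "'a measure \<Rightarrow> 'a measure \<Rightarrow> ereal" where
  "chi2 \<mu> \<pi> = (if absolutely_continuous \<pi> \<mu>
     then enn2ereal (\<integral>\<^sup>+ x. (RN_deriv \<pi> \<mu> x)\<^sup>2 \<partial>\<pi>) - 1 else \<infinity>)"

definition tv_dist :: "'a measure \<Rightarrow> 'a measure \<Rightarrow> real" where
  "tv_dist \<mu> \<pi> = (SUP A\<in>sets \<pi>. \<bar>measure \<mu> A - measure \<pi> A\<bar>)"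


section \<open>The Newton-Langevin diffusion\<close>

text \<open>Time is \<open>[0, \<infinity>)\<close>; members of the filtration and of the processes with negative index play
  no role.\<close>

definition brownian_motion ::
    "'w measure \<Rightarrow> (real \<Rightarrow> 'w measure) \<Rightarrow> (real \<Rightarrow> 'w \<Rightarrow> real^'n) \<Rightarrow> bool" where
  "brownian_motion M F B \<longleftrightarrow> prob_space M \<and> filtration (space M) F
     \<and> (\<forall>t\<ge>0. subalgebra M (F t) \<and> B t \<in> borel_measurable (F t))
     \<and> (AE \<omega> in M. B 0 \<omega> = 0 \<and> continuous_on {0..} (\<lambda>t. B t \<omega>))
     \<and> (\<forall>s\<ge>0. \<forall>t>s.
          distributed M lborel (\<lambda>\<omega>. B t \<omega> - B s \<omega>)
            (\<lambda>x. ennreal (\<Prod>i\<in>UNIV. normal_density 0 (sqrt (t - s)) (x $ i)))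
        \<and> prob_space.indep_set M (sets (F s))
            {(\<lambda>\<omega>. B t \<omega> - B s \<omega>) -` A \<inter> space M | A. A \<in> sets borel})"

definition tendsto_in_prob ::
    "'w measure \<Rightarrow> (nat \<Rightarrow> 'w \<Rightarrow> real^'n) \<Rightarrow> ('w \<Rightarrow> real^'n) \<Rightarrow> bool" where
  "tendsto_in_prob M S Z \<longleftrightarrow> (\<forall>n. S n \<in> borel_measurable M) \<and> Z \<in> borel_measurable M
     \<and> (\<forall>e>0. (\<lambda>n. measure M {\<omega>\<in>space M. dist (S n \<omega>) (Z \<omega>) > e}) \<longlonglongrightarrow> 0)"

text \<open>For an adapted integrand \<open>\<Phi>\<close> with continuous paths, the Ito integral of \<open>\<Phi>\<close> against \<open>B\<close> over
  \<open>[0, t]\<close> is the limit in probability of the left-endpoint Riemann sums; it is used only for such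
  integrands.\<close>

definition has_ito_integral ::
    "'w measure \<Rightarrow> (real \<Rightarrow> 'w \<Rightarrow> real^'n) \<Rightarrow> (real \<Rightarrow> 'w \<Rightarrow> real^'n^'n) \<Rightarrow> real
      \<Rightarrow> ('w \<Rightarrow> real^'n) \<Rightarrow> bool" where
  "has_ito_integral M B \<Phi> t I \<longleftrightarrow> tendsto_in_prob M
     (\<lambda>n \<omega>. \<Sum>k<n. \<Phi> (t * real k / real n) \<omega> *v
        (B (t * real (Suc k) / real n) \<omega> - B (t * real k / real n) \<omega>)) I"

definition psd_sqrt :: "real^'n^'n \<Rightarrow> real^'n^'n" where
  "psd_sqrt A = (THE S. transpose S = S \<and> (\<forall>v. 0 \<le> v \<bullet> (S *v v)) \<and> S ** S = A)"

definition newton_langevin ::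
    "'w measure \<Rightarrow> (real \<Rightarrow> 'w measure) \<Rightarrow> (real \<Rightarrow> 'w \<Rightarrow> real^'n) \<Rightarrow> (real^'n \<Rightarrow> ereal)
      \<Rightarrow> (real \<Rightarrow> 'w \<Rightarrow> real^'n) \<Rightarrow> (real \<Rightarrow> 'w \<Rightarrow> real^'n) \<Rightarrow> bool" where
  "newton_langevin M F B U X Y \<longleftrightarrow> brownian_motion M F B
     \<and> (\<forall>t\<ge>0. X t \<in> borel_measurable (F t) \<and> Y t \<in> borel_measurable (F t))
     \<and> (\<forall>\<omega>\<in>space M. continuous_on {0..} (\<lambda>t. Y t \<omega>))
     \<and> (\<forall>\<omega>\<in>space M. \<forall>t\<ge>0. X t \<omega> \<in> interior (edom U)
          \<and> X t \<omega> = grad (\<lambda>y. real_of_ereal (convex_conjugate U y)) (Y t \<omega>))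
     \<and> (\<forall>t\<ge>0. \<exists>I.
          has_ito_integral M B (\<lambda>s \<omega>. psd_sqrt (hess (\<lambda>x. real_of_ereal (U x)) (X s \<omega>))) t I
        \<and> (AE \<omega> in M. Y t \<omega> = Y 0 \<omega>
             - integral {0..t} (\<lambda>s. grad (\<lambda>x. real_of_ereal (U x)) (X s \<omega>)) + sqrt 2 *\<^sub>R I \<omega>))"


section \<open>The Fokker--Planck equation\<close>

text \<open>Below \<open>p t\<close> is the density of the law at time \<open>t\<close> and the target has density \<open>exp (- U)\<close>.
  With \<open>fp_flux\<close> the equation reads \<open>\<partial>p/\<partial>t = div (fp_flux U p)\<close>; positivity and differentiability
  are what the equation needs to make sense pointwise.\<close>

definition rel_density :: "(real^'n \<Rightarrow> ereal) \<Rightarrow> (real^'n \<Rightarrow> real) \<Rightarrow> real^'n \<Rightarrow> real" where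
  "rel_density U f x = f x / exp_neg (U x)"

definition fp_flux :: "(real^'n \<Rightarrow> ereal) \<Rightarrow> (real^'n \<Rightarrow> real) \<Rightarrow> real^'n \<Rightarrow> real^'n" where
  "fp_flux U f x = f x *\<^sub>R (matrix_inv (hess (\<lambda>z. real_of_ereal (U z)) x)
     *v grad (\<lambda>z. ln (rel_density U f z)) x)"

definition fokker_planck :: "(real^'n \<Rightarrow> ereal) \<Rightarrow> (real \<Rightarrow> real^'n \<Rightarrow> real) \<Rightarrow> bool" where
  "fokker_planck U p \<longleftrightarrow> (\<forall>t>0. \<forall>x\<in>interior (edom U).
       p t x > 0
     \<and> (\<lambda>z. ln (rel_density U (p t) z)) differentiable (at x)
     \<and> fp_flux U (p t) differentiable (at x)
     \<and> ((\<lambda>s. p s x) has_real_derivative divergence (fp_flux U (p t)) x) (at t))"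

text \<open>\<open>\<integral> p\<^sup>2 exp U\<close> is finite and can be differentiated in \<open>t > 0\<close> under the integral sign (and is
  continuous up to \<open>t = 0\<close>), and the integral of \<open>2 p exp U div (fp_flux)\<close> obtained from the
  equation can be integrated by parts without boundary terms.\<close>

definition chi2_regular :: "(real^'n \<Rightarrow> ereal) \<Rightarrow> (real \<Rightarrow> real^'n \<Rightarrow> real) \<Rightarrow> bool" where
  "chi2_regular U p \<longleftrightarrow> (let D = interior (edom U); q = (\<lambda>x. exp_neg (U x)) in
       (\<forall>t\<ge>0. set_integrable lborel D (\<lambda>x. (p t x)\<^sup>2 / q x))
     \<and> continuous_on {0..} (\<lambda>t. LINT x:D|lborel. (p t x)\<^sup>2 / q x)
     \<and> (\<forall>t>0. set_integrable lborel D (\<lambda>x. deriv (\<lambda>s. (p s x)\<^sup>2 / q x) t)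
          \<and> ((\<lambda>s. LINT x:D|lborel. (p s x)\<^sup>2 / q x) has_real_derivative
               (LINT x:D|lborel. deriv (\<lambda>s. (p s x)\<^sup>2 / q x) t)) (at t))
     \<and> (\<forall>t>0. set_integrable lborel D
              (\<lambda>x. grad (\<lambda>z. 2 * rel_density U (p t) z) x \<bullet> fp_flux U (p t) x)
          \<and> (LINT x:D|lborel. 2 * rel_density U (p t) x * divergence (fp_flux U (p t)) x)
            = - (LINT x:D|lborel.
                   grad (\<lambda>z. 2 * rel_density U (p t) z) x \<bullet> fp_flux U (p t) x)))"

end

(* The target mu = Z^-1 exp (-beta V) is log-concave with potential U, and along the Fokker-Planck flow
   the density r = p/mu satisfies d/dt E r^2 = -2 E <grad r, (Hess U)^-1 grad r>.  The Brascamp-Lieb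
   inequality bounds the right-hand side by -2 Var r, so chi^2 decays like exp (-2t); Cauchy-Schwarz gives
   TV (mu_t, mu) <= sqrt (chi^2) / 2.

   Both Brascamp-Lieb and the comparison of mu with the uniform law come from the midpoint
   Prekopa-Leindler inequality.  Applied to exp (s g - U), exp (-s g - U) and exp (s^2 Phi - U) with
   Phi slightly above <grad g, (Hess U)^-1 grad g> / 2, its expansion to second order in s is Brascamp-Lieb
   for compactly supported g; since r is only differentiable, g and the gradient term are mollified.
   General g are cut off by functions of V, at no cost because exp-concavity gives
   <grad V, (Hess V)^-1 grad V> <= nu.  Applied to 1_C, exp (-U) and a multiple of exp (-U/2), with
   f = exp (-V/nu) concave and hence f ((x+y)/2) >= f y / 2, it bounds the Hellinger affinity of mu and
   the uniform law below by 2^(-beta nu/2).  This gives TV <= sqrt (beta nu ln 2) < 0.6 eps, which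
   together with 0.36 eps for the first part stays below eps. *)

theory Submission
  imports Defs
begin

section \<open>From Brunn-Minkowski on the line to the midpoint Prekopa-Leindler inequality\<close>

section \<open>The Prekopa--Leindler inequality\<close>

text \<open>Arguments for the dissipation inequality that differentiate further, by a Bochner
  formula or an elliptic equation, are avoided: \<open>U\<close> has two derivatives, and only first
  derivatives of the density ratio are at hand. Prekopa-Leindler sees \<open>U\<close> through the
  second differences \<open>U (z + h) + U (z - h) - 2 * U z\<close> alone. The obstacle is that its
  third function depends on the midpoint \<open>z\<close>, whereas the gradient of \<open>g\<close>
  enters along the whole segment from \<open>z - h\<close> to \<open>z + h\<close> and may be
  discontinuous; averaging over a Lipschitz kernel turns the values on the segment into one value at
  \<open>z\<close> plus a small error.

  The limits are therefore nested. For a fixed kernel radius \<open>s\<close> tends to 0, over a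
  range that depends on the radius; next the radius and the relative errors tend to 0; last the
  cut-off level tends to infinity.

  The Poincare constant is 1 because gradients are measured in the inverse Hessian of the potential
  itself. Hence the rate depends neither on \<beta> nor on \<nu>: the latter enters the decay
  estimate through the cut-off error only, and disappears in the last limit.\<close>

lemma emeasure_lborel_translate:
  fixes A :: "real set"
  assumes "A \<in> sets borel"
  shows "emeasure lborel ((\<lambda>x. x + b) ` A) = emeasure lborel A"
proof -
  have eq: "(\<lambda>x. x + b) ` A = (\<lambda>x. -b + x) -` A \<inter> space lborel"
    by (auto simp: image_iff intro!: bexI[of _ "_ - b"])
  have "emeasure lborel A = emeasure (distr lborel borel (\<lambda>x. -b + x)) A"
    by (subst lborel_distr_plus) simp
  also have "\<dots> = emeasure lborel ((\<lambda>x. x + b) ` A)"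
    using assms unfolding eq by (subst emeasure_distr) auto
  finally show ?thesis ..
qed

lemma sets_translate:
  fixes A :: "real set"
  assumes "A \<in> sets borel"
  shows "(\<lambda>x. x + b) ` A \<in> sets borel"
proof -
  have eq: "(\<lambda>x. x + b) ` A = (\<lambda>x. -b + x) -` A \<inter> space borel"
    by (auto simp: image_iff intro!: bexI[of _ "_ - b"])
  show ?thesis unfolding eq using assms by measurable
qed

text \<open>Continuity from below needs an increasing sequence, whereas \<open>a\<close> ranges over
  an arbitrary Borel set. A sequence that is cofinal in \<open>A\<close> provides one; its members
  must lie in \<open>A\<close> because Brunn-Minkowski uses the cut points as summands.\<close>

lemma emeasure_Int_atMost_SUP:
  fixes A :: "real set"
  assumes A: "A \<in> sets borel" and ne: "A \<noteq> {}"
  shows "emeasure lborel A = (SUP a\<in>A. emeasure lborel (A \<inter> {..a}))"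
proof (rule antisym)
  show "(SUP a\<in>A. emeasure lborel (A \<inter> {..a})) \<le> emeasure lborel A"
    by (intro SUP_least emeasure_mono) (use A in auto)
next
  obtain s :: "nat \<Rightarrow> real" where s: "incseq s" "\<And>n. s n \<in> A" "\<And>x. x \<in> A \<Longrightarrow> \<exists>n. x \<le> s n"
  proof (cases "\<exists>m\<in>A. \<forall>x\<in>A. x \<le> m")
    case True
    then obtain m where "m \<in> A" "\<forall>x\<in>A. x \<le> m" by auto
    then show ?thesis by (intro that[of "\<lambda>_. m"]) (auto simp: incseq_def)
  next
    case False
    then have gt: "\<And>m. m \<in> A \<Longrightarrow> \<exists>x\<in>A. m < x" by (meson not_le)
    have "\<exists>t::nat\<Rightarrow>real. (\<forall>n. t n \<in> A) \<and> (\<forall>x\<in>A. \<exists>n. x \<le> t n)"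
    proof (cases "bdd_above A")
      case True
      have "\<exists>x\<in>A. Sup A - 1 / real (Suc n) < x" for n
        using ne True by (subst less_cSup_iff[symmetric]) auto
      then obtain t where t: "\<And>n. t n \<in> A" "\<And>n. Sup A - 1 / real (Suc n) < t n" by metis
      have "\<exists>n. x \<le> t n" if xA: "x \<in> A" for x
      proof -
        obtain y where y: "y \<in> A" "x < y" using gt[OF xA] by auto
        with True have "x < Sup A" by (meson cSup_upper less_le_trans)
        then obtain n where "1 / real (Suc n) < Sup A - x"
          by (metis diff_gt_0_iff_gt inverse_eq_divide reals_Archimedean)
        with t(2)[of n] show ?thesis by (intro exI[of _ n]) linarith
      qed
      with t show ?thesis by blast
    next
      case False
      then have "\<exists>x\<in>A. real n \<le> x" for n unfolding bdd_above_def by (meson linear)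
      then obtain t where t: "\<And>n. t n \<in> A" "\<And>n. real n \<le> t n" by metis
      have "\<exists>n. x \<le> t n" for x using t(2) real_arch_simple[of x] order_trans by blast
      with t show ?thesis by blast
    qed
    then obtain t :: "nat \<Rightarrow> real" where t: "\<And>n. t n \<in> A" "\<And>x. x \<in> A \<Longrightarrow> \<exists>n. x \<le> t n" by blast
    \<comment> \<open>Running maxima make the cofinal sequence increasing without leaving
      \<open>A\<close>.\<close>
    define s where "s n = Max (t ` {..n})" for n
    have "s n \<in> A" for n
    proof -
      have "s n \<in> t ` {..n}" unfolding s_def by (intro Max_in) auto
      with t show ?thesis by auto
    qed
    moreover have "incseq s" unfolding s_def incseq_def by (auto intro!: Max_mono)
    moreover have "t n \<le> s n" for n unfolding s_def by (intro Max_ge) auto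
    ultimately show ?thesis using that[of s] t order_trans by metis
  qed
  have "emeasure lborel A = emeasure lborel (\<Union>n. A \<inter> {..s n})"
    using s(3) by (intro arg_cong[where f = "emeasure lborel"]) auto
  also have "\<dots> = (SUP n. emeasure lborel (A \<inter> {..s n}))"
    using s(1) A by (intro SUP_emeasure_incseq[symmetric]) (auto simp: incseq_def intro: order_trans)
  also have "\<dots> \<le> (SUP a\<in>A. emeasure lborel (A \<inter> {..a}))"
    by (intro SUP_least SUP_upper s)
  finally show "emeasure lborel A \<le> \<dots>" .
qed

text \<open>Reflection at 0 preserves Lebesgue measure and exchanges the two kinds of
  half-lines.\<close>

lemma emeasure_Int_atLeast_SUP:
  fixes A :: "real set"
  assumes A: "A \<in> sets borel" and ne: "A \<noteq> {}"
  shows "emeasure lborel A = (SUP a\<in>A. emeasure lborel (A \<inter> {a..}))"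
proof -
  have inv: "emeasure lborel (uminus ` S) = emeasure lborel S" if "S \<in> sets borel" for S :: "real set"
  proof -
    have eq: "uminus ` S = uminus -` S \<inter> space lborel" by (auto simp: image_iff intro!: bexI[of _ "- _"])
    have "emeasure lborel S = emeasure (distr lborel borel uminus) S" by (simp add: lborel_distr_uminus)
    also have "\<dots> = emeasure lborel (uminus ` S)" using that by (subst emeasure_distr) (auto simp: eq)
    finally show ?thesis ..
  qed
  have m: "uminus ` A \<in> sets borel"
  proof -
    have eq: "uminus ` A = uminus -` A \<inter> space borel" by (auto simp: image_iff intro!: bexI[of _ "- _"])
    show ?thesis unfolding eq using A by measurable
  qed
  have "emeasure lborel A = emeasure lborel (uminus ` A)" using inv[OF A] by simp
  also have "\<dots> = (SUP a\<in>uminus ` A. emeasure lborel (uminus ` A \<inter> {..a}))"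
    using m ne by (intro emeasure_Int_atMost_SUP) auto
  also have "\<dots> = (SUP a\<in>A. emeasure lborel (uminus ` (A \<inter> {a..})))"
    unfolding image_image by (intro SUP_cong refl arg_cong[where f = "emeasure lborel"]) auto
  also have "\<dots> = (SUP a\<in>A. emeasure lborel (A \<inter> {a..}))"
    using A by (intro SUP_cong refl inv) auto
  finally show ?thesis .
qed

(* For a in A and b in B, the translates of A below a by b and of B above b by a lie in S and
   overlap only at a + b; then let a and b exhaust A and B. *)
lemma brunn_minkowski_real:
  fixes A B S :: "real set"
  assumes [measurable]: "A \<in> sets borel" "B \<in> sets borel" "S \<in> sets borel"
    and ne: "A \<noteq> {}" "B \<noteq> {}"
    and sub: "\<And>x y. x \<in> A \<Longrightarrow> y \<in> B \<Longrightarrow> x + y \<in> S"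
  shows "emeasure lborel A + emeasure lborel B \<le> emeasure lborel S"
proof -
  have le: "emeasure lborel (A \<inter> {..a}) + emeasure lborel (B \<inter> {b..}) \<le> emeasure lborel S"
    if ab: "a \<in> A" "b \<in> B" for a b
  proof -
    let ?A = "(\<lambda>x. x + b) ` (A \<inter> {..a})" and ?B = "(\<lambda>x. x + a) ` (B \<inter> {b..})"
    have [measurable]: "?A \<in> sets borel" "?B \<in> sets borel" by (auto intro!: sets_translate)
    have "?A \<inter> ?B \<subseteq> {a + b}" by auto
    then have "emeasure lborel (?A \<inter> ?B) \<le> emeasure lborel {a + b}" by (intro emeasure_mono) auto
    then have null: "emeasure lborel (?A \<inter> ?B) = 0" by simp
    have "emeasure lborel (A \<inter> {..a}) + emeasure lborel (B \<inter> {b..})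
        = emeasure lborel ?A + emeasure lborel ?B"
      by (simp add: emeasure_lborel_translate)
    also have "\<dots> = emeasure lborel (?A \<union> ?B)"
      using emeasure_Un_Int[of ?A lborel ?B] null by simp
    also have "\<dots> \<le> emeasure lborel S"
      using sub ab by (intro emeasure_mono) (auto simp: add.commute[of _ a])
    finally show ?thesis .
  qed
  have le2: "emeasure lborel A + emeasure lborel (B \<inter> {b..}) \<le> emeasure lborel S" if "b \<in> B" for b
    unfolding emeasure_Int_atMost_SUP[OF assms(1) ne(1)]
    by (subst ennreal_SUP_add_left[symmetric]) (use ne le that in \<open>auto intro!: SUP_least\<close>)
  show ?thesis
    unfolding emeasure_Int_atLeast_SUP[OF assms(2) ne(2)]
    by (subst ennreal_SUP_add_right) (use ne le2 in \<open>auto intro!: SUP_least\<close>)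
qed


text \<open>Heights are restricted to \<open>{0<..<a}\<close> since superlevel sets above
  \<open>a\<close> are empty. When \<open>a\<close> is the supremum of \<open>f\<close>, exactly the
  heights with nonempty superlevel sets remain, as Brunn-Minkowski requires.\<close>

lemma nn_integral_layer_cake:
  fixes f :: "'a \<Rightarrow> real"
  assumes "sigma_finite_measure M" and [measurable]: "f \<in> borel_measurable M"
    and f: "\<And>x. 0 \<le> f x" "\<And>x. f x \<le> a"
  shows "(\<integral>\<^sup>+ x. ennreal (f x) \<partial>M) = (\<integral>\<^sup>+ t. emeasure M {x\<in>space M. t < f x} * indicator {0<..<a} t \<partial>lborel)"
proof -
  interpret sigma_finite_measure M by fact
  interpret P: pair_sigma_finite M lborel ..
  have "(\<integral>\<^sup>+ x. ennreal (f x) \<partial>M) = (\<integral>\<^sup>+ x. (\<integral>\<^sup>+ t. indicator {0<..<f x} t \<partial>lborel) \<partial>M)"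
    using f by (intro nn_integral_cong) simp
  also have "\<dots> = (\<integral>\<^sup>+ x. (\<integral>\<^sup>+ t. (if 0 < t \<and> t < f x then 1 else 0) \<partial>lborel) \<partial>M)"
    by (intro nn_integral_cong) (auto simp: indicator_def)
  also have "\<dots> = (\<integral>\<^sup>+ t. (\<integral>\<^sup>+ x. (if 0 < t \<and> t < f x then 1 else 0) \<partial>M) \<partial>lborel)"
    by (rule P.Fubini'[symmetric]) measurable
  also have "\<dots> = (\<integral>\<^sup>+ t. emeasure M {x\<in>space M. t < f x} * indicator {0<..<a} t \<partial>lborel)"
  proof (intro nn_integral_cong)
    fix t :: real
    show "(\<integral>\<^sup>+ x. (if 0 < t \<and> t < f x then 1 else 0) \<partial>M) = emeasure M {x\<in>space M. t < f x} * indicator {0<..<a} t"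
    proof (cases "0 < t \<and> t < a")
      case True
      have "(\<integral>\<^sup>+ x. (if 0 < t \<and> t < f x then 1 else 0) \<partial>M) = (\<integral>\<^sup>+ x. indicator {x\<in>space M. t < f x} x \<partial>M)"
        using True by (intro nn_integral_cong) (auto simp: indicator_def)
      then show ?thesis using True by simp
    next
      case False
      have "\<not> (0 < t \<and> t < f x)" for x using f(2)[of x] False by auto
      then have "(\<lambda>x. if 0 < t \<and> t < f x then 1 else 0) = (\<lambda>_. 0::ennreal)" by (auto simp: fun_eq_iff)
      then show ?thesis using False by simp
    qed
  qed
  finally show ?thesis .
qed

(* Scaling u and v by their suprema makes all superlevel sets below height 1 nonempty, so that
   Brunn-Minkowski applies to them; the arithmetic-geometric mean inequality removes the scaling. *)
lemma prekopa_leindler_real_bounded: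
  fixes u v w :: "real \<Rightarrow> real"
  assumes [measurable]: "u \<in> borel_measurable borel" "v \<in> borel_measurable borel" "w \<in> borel_measurable borel"
    and nn: "\<And>x. 0 \<le> u x" "\<And>x. 0 \<le> v x" "\<And>x. 0 \<le> w x"
    and bd: "bdd_above (range u)" "bdd_above (range v)"
    and uvw: "\<And>x y. u x * v y \<le> (w (x + y))\<^sup>2"
  shows "4 * ((\<integral>\<^sup>+ x. ennreal (u x) \<partial>lborel) * (\<integral>\<^sup>+ x. ennreal (v x) \<partial>lborel))
      \<le> (\<integral>\<^sup>+ x. ennreal (w x) \<partial>lborel)\<^sup>2"
proof (cases "(SUP x. u x) > 0 \<and> (SUP x. v x) > 0")
  case False
  have "(\<forall>x. u x = 0) \<or> (\<forall>x. v x = 0)"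
    using False bd nn by (meson UNIV_I cSUP_upper less_le_trans not_le order_antisym_conv)
  then show ?thesis by auto
next
  case True
  define a b where "a = (SUP x. u x)" and "b = (SUP x. v x)"
  have ab: "0 < a" "0 < b" using True by (auto simp: a_def b_def)
  have ua: "u x \<le> a" and vb: "v x \<le> b" for x
    unfolding a_def b_def using bd by (auto intro!: cSUP_upper)
  \<comment> \<open>The geometric mean matches the scaled levels: if \<open>u\<close> exceeds
    \<open>a * t\<close> at \<open>x\<close> and \<open>v\<close> exceeds \<open>b * t\<close> at
    \<open>y\<close>, then \<open>w\<close> exceeds \<open>c * t\<close> at
    \<open>x + y\<close>.\<close>
  define c where "c = sqrt (a * b)"
  have c: "0 < c" "c\<^sup>2 = a * b" using ab by (auto simp: c_def)
  let ?I = "\<lambda>f. \<integral>\<^sup>+ x. ennreal (f x) \<partial>lborel"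
  have lay: "?I f = ennreal k * (\<integral>\<^sup>+ t. emeasure lborel {x. k * t < f x} * indicator {0<..<1} t \<partial>lborel)"
    if [measurable]: "f \<in> borel_measurable borel" and f: "\<And>x. 0 \<le> f x" "\<And>x. f x \<le> k" "0 < k" for f :: "real \<Rightarrow> real" and k
  proof -
    have "?I f = ennreal k * ?I (\<lambda>x. f x / k)"
      using f by (subst nn_integral_cmult[symmetric]) (auto simp: ennreal_mult[symmetric] intro!: nn_integral_cong)
    also have "?I (\<lambda>x. f x / k) = (\<integral>\<^sup>+ t. emeasure lborel {x\<in>space lborel. t < f x / k} * indicator {0<..<1} t \<partial>lborel)"
      using f by (intro nn_integral_layer_cake) (auto simp: sigma_finite_lborel)
    finally show ?thesis using f by (simp add: field_simps)
  qed
  define \<alpha> \<beta> where "\<alpha> = (\<integral>\<^sup>+ t. emeasure lborel {x. a * t < u x} * indicator {0<..<1} t \<partial>lborel)"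
    and "\<beta> = (\<integral>\<^sup>+ t. emeasure lborel {x. b * t < v x} * indicator {0<..<1} t \<partial>lborel)"
  have meas: "(\<lambda>t. emeasure lborel {x. k * t < f x}) \<in> borel_measurable borel"
    if [measurable]: "f \<in> borel_measurable borel" for f :: "real \<Rightarrow> real" and k
  proof -
    have "(\<lambda>t. emeasure lborel (Pair t -` {z \<in> space (borel \<Otimes>\<^sub>M lborel). k * fst z < f (snd z)})) \<in> borel_measurable borel"
      by (rule sigma_finite_measure.measurable_emeasure_Pair[OF sigma_finite_lborel])
         measurable
    then show ?thesis by (simp add: vimage_def space_pair_measure)
  qed
  have "ennreal c * (\<alpha> + \<beta>) \<le> ?I w"
  proof -
    \<comment> \<open>Capping \<open>w\<close> at \<open>c\<close> leaves its superlevel sets below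
      height \<open>c\<close> unchanged and supplies the bound under which the layer-cake formula
      applies.\<close>
    define w' where "w' x = min c (w x)" for x
    have [measurable]: "w' \<in> borel_measurable borel" unfolding w'_def by measurable
    have "\<alpha> + \<beta> = (\<integral>\<^sup>+ t. (emeasure lborel {x. a * t < u x} + emeasure lborel {x. b * t < v x}) * indicator {0<..<1} t \<partial>lborel)"
      unfolding \<alpha>_def \<beta>_def by (subst nn_integral_add[symmetric]) (auto simp: distrib_right meas)
    also have "\<dots> \<le> (\<integral>\<^sup>+ t. emeasure lborel {x. c * t < w' x} * indicator {0<..<1} t \<partial>lborel)"
    proof (intro nn_integral_mono)
      fix t :: real
      show "(emeasure lborel {x. a * t < u x} + emeasure lborel {x. b * t < v x}) * indicator {0<..<1} t
          \<le> emeasure lborel {x. c * t < w' x} * indicator {0<..<1} t"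
      proof (cases "0 < t \<and> t < 1")
        case True
        have "a * t < (SUP x. u x)" using True ab by (simp add: a_def)
        then have 1: "{x. a * t < u x} \<noteq> {}" using bd(1) by (subst (asm) less_cSUP_iff) auto
        have "b * t < (SUP x. v x)" using True ab by (simp add: b_def)
        then have 2: "{x. b * t < v x} \<noteq> {}" using bd(2) by (subst (asm) less_cSUP_iff) auto
        have "emeasure lborel {x. a * t < u x} + emeasure lborel {x. b * t < v x} \<le> emeasure lborel {x. c * t < w' x}"
        proof (rule brunn_minkowski_real[OF _ _ _ 1 2])
          fix x y assume "x \<in> {x. a * t < u x}" "y \<in> {x. b * t < v x}"
          then have "(a * t) * (b * t) < u x * v y"
            using ab True nn by (intro mult_strict_mono') auto
          also have "\<dots> \<le> (w (x + y))\<^sup>2" by (rule uvw)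
          finally have "(c * t)\<^sup>2 < (w (x + y))\<^sup>2" using c(2) by (simp add: power_mult_distrib power2_eq_square[of t] mult_ac)
          then have "c * t < w (x + y)" using nn(3) by (rule power2_less_imp_less)
          then show "x + y \<in> {x. c * t < w' x}" using True c by (simp add: w'_def)
        qed measurable
        then show ?thesis using True by simp
      qed auto
    qed
    finally have "\<alpha> + \<beta> \<le> \<dots>" .
    then have "ennreal c * (\<alpha> + \<beta>) \<le> ennreal c * (\<integral>\<^sup>+ t. emeasure lborel {x. c * t < w' x} * indicator {0<..<1} t \<partial>lborel)"
      by (rule mult_left_mono) simp
    also have "\<dots> = ?I w'"
      using c nn by (intro lay[symmetric]) (auto simp: w'_def)
    also have "\<dots> \<le> ?I w" by (intro nn_integral_mono ennreal_leI) (simp add: w'_def)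
    finally show ?thesis .
  qed
  then have "(ennreal c * (\<alpha> + \<beta>))\<^sup>2 \<le> (?I w)\<^sup>2" by (rule power_mono) simp
  moreover have "4 * (?I u * ?I v) \<le> (ennreal c * (\<alpha> + \<beta>))\<^sup>2"
  proof -
    have "4 * (\<alpha> * \<beta>) \<le> (\<alpha> + \<beta>)\<^sup>2"
    proof (cases "\<alpha> = \<infinity> \<or> \<beta> = \<infinity>")
      case True then show ?thesis by (auto simp: power2_eq_square ennreal_top_mult)
    next
      case False
      then obtain r s where "\<alpha> = ennreal r" "\<beta> = ennreal s" "0 \<le> r" "0 \<le> s"
        by (metis ennreal_cases infinity_ennreal_def)
      moreover have "ennreal (4 * (r * s)) \<le> ennreal ((r + s)\<^sup>2)"
        using sum_squares_bound[of r s] by (intro ennreal_leI) (simp add: power2_eq_square algebra_simps)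
      ultimately show ?thesis by (simp add: ennreal_mult ennreal_power[symmetric])
    qed
    then have "ennreal (c\<^sup>2) * (4 * (\<alpha> * \<beta>)) \<le> ennreal (c\<^sup>2) * (\<alpha> + \<beta>)\<^sup>2" by (rule mult_left_mono) simp
    moreover have "ennreal (c\<^sup>2) = ennreal a * ennreal b" using ab c by (simp add: ennreal_mult)
    moreover have "?I u = ennreal a * \<alpha>" "?I v = ennreal b * \<beta>"
      unfolding \<alpha>_def \<beta>_def using ab ua vb nn by (auto intro!: lay)
    moreover have "(ennreal c)\<^sup>2 = ennreal (c\<^sup>2)" using c by (simp add: ennreal_power)
    ultimately show ?thesis unfolding power_mult_distrib by (simp only: mult_ac)
  qed
  ultimately show ?thesis by (rule order_trans[rotated])
qed

text \<open>Truncating all three functions at the same level \<open>n\<close> keeps the hypothesis: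
  where \<open>w\<close> exceeds \<open>n\<close>, the left side is at most \<open>n\<close>
  squared. The bounded version speaks of sums, so it is applied to \<open>w' (x / 2)\<close>; the
  substitution doubles that integral, and the square of 2 cancels the factor 4.\<close>

lemma prekopa_leindler_real:
  fixes u v w :: "real \<Rightarrow> ennreal"
  assumes [measurable]: "u \<in> borel_measurable borel" "v \<in> borel_measurable borel" "w \<in> borel_measurable borel"
    and uvw: "\<And>x y. u x * v y \<le> (w ((x + y) / 2))\<^sup>2"
  shows "(\<integral>\<^sup>+ x. u x \<partial>lborel) * (\<integral>\<^sup>+ x. v x \<partial>lborel) \<le> (\<integral>\<^sup>+ x. w x \<partial>lborel)\<^sup>2"
proof -
  define tr where "tr f n x = min (of_nat n) (f x)" for f :: "real \<Rightarrow> ennreal" and n :: nat and x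
  have [measurable]: "tr f n \<in> borel_measurable borel" if [measurable]: "f \<in> borel_measurable borel" for f n
    unfolding tr_def by measurable
  have fin: "tr f n x = ennreal (enn2real (tr f n x))" for f n x
    by (rule ennreal_enn2real[symmetric]) (auto simp: tr_def min_less_iff_disj of_nat_less_top)
  have bdd: "enn2real (tr f n x) \<le> real n" for f n x
    by (rule enn2real_leI) (auto simp: tr_def ennreal_of_nat_eq_real_of_nat)
  have SUP: "(\<integral>\<^sup>+ x. f x \<partial>lborel) = (SUP n. \<integral>\<^sup>+ x. tr f n x \<partial>lborel)"
    if [measurable]: "f \<in> borel_measurable borel" for f
  proof (subst nn_integral_monotone_convergence_SUP[symmetric])
    show "incseq (tr f)" by (auto simp: incseq_def tr_def le_fun_def min.coboundedI1 intro!: min.mono)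
    have "(SUP n. tr f n x) = f x" for x
    proof -
      have "(SUP n. min (of_nat n) (f x)) = min (SUP n. of_nat n) (f x)"
        by (simp add: inf_min[symmetric] SUP_inf)
      then show ?thesis by (simp add: tr_def ennreal_SUP_of_nat_eq_top)
    qed
    then show "(\<integral>\<^sup>+ x. f x \<partial>lborel) = (\<integral>\<^sup>+ x. (SUP n. tr f n x) \<partial>lborel)" by simp
  qed measurable
  have le: "(\<integral>\<^sup>+ x. tr u n x \<partial>lborel) * (\<integral>\<^sup>+ x. tr v n x \<partial>lborel) \<le> (\<integral>\<^sup>+ x. w x \<partial>lborel)\<^sup>2" for n
  proof -
    define w' where "w' = tr w n"
    have [measurable]: "w' \<in> borel_measurable borel" by (simp add: w'_def)
    let ?r = "\<lambda>f x. enn2real (tr f n x)"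
    have le1: "tr u n x * tr v n y \<le> (w' ((x + y) / 2))\<^sup>2" for x y
    proof (cases "w ((x + y) / 2) \<le> of_nat n")
      case True
      have "tr u n x * tr v n y \<le> u x * v y" by (intro mult_mono) (auto simp: tr_def)
      also have "\<dots> \<le> (w ((x + y) / 2))\<^sup>2" by (rule uvw)
      finally show ?thesis using True by (simp add: w'_def tr_def min_absorb2)
    next
      case False
      have "tr u n x * tr v n y \<le> of_nat n * of_nat n" by (intro mult_mono) (auto simp: tr_def)
      then show ?thesis using False by (simp add: w'_def tr_def power2_eq_square min_absorb1)
    qed
    have "4 * ((\<integral>\<^sup>+ x. ennreal (?r u x) \<partial>lborel) * (\<integral>\<^sup>+ x. ennreal (?r v x) \<partial>lborel))
        \<le> (\<integral>\<^sup>+ x. ennreal (enn2real (w' (x / 2))) \<partial>lborel)\<^sup>2"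
    proof (rule prekopa_leindler_real_bounded)
      fix x y
      have "ennreal (?r u x * ?r v y) \<le> ennreal ((enn2real (w' ((x + y) / 2)))\<^sup>2)"
        using le1[of x y] by (simp add: ennreal_mult ennreal_power[symmetric] fin[symmetric] w'_def)
      then show "?r u x * ?r v y \<le> (enn2real (w' ((x + y) / 2)))\<^sup>2" by (simp add: ennreal_le_iff)
    qed (auto simp: bdd_above_def intro: bdd)
    also have "(\<lambda>x. ennreal (enn2real (w' (x / 2)))) = (\<lambda>x. w' (x / 2))" by (simp add: w'_def fin[symmetric])
    also have "(\<integral>\<^sup>+ x. w' (x / 2) \<partial>lborel) = 2 * (\<integral>\<^sup>+ x. w' x \<partial>lborel)"
      using nn_integral_real_affine[of "\<lambda>x. w' (x / 2)" 2 0] by simp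
    also have "(2 * (\<integral>\<^sup>+ x. w' x \<partial>lborel))\<^sup>2 = 4 * (\<integral>\<^sup>+ x. w' x \<partial>lborel)\<^sup>2" by (simp add: power_mult_distrib)
    finally have "(\<integral>\<^sup>+ x. tr u n x \<partial>lborel) * (\<integral>\<^sup>+ x. tr v n x \<partial>lborel) \<le> (\<integral>\<^sup>+ x. w' x \<partial>lborel)\<^sup>2"
      by (subst (asm) ennreal_mult_le_mult_iff) (simp_all add: fin[symmetric])
    also have "\<dots> \<le> (\<integral>\<^sup>+ x. w x \<partial>lborel)\<^sup>2"
      by (intro power_mono nn_integral_mono) (auto simp: w'_def tr_def)
    finally show ?thesis .
  qed
  have mono: "m \<le> n \<Longrightarrow> (\<integral>\<^sup>+ x. tr f m x \<partial>lborel) \<le> (\<integral>\<^sup>+ x. tr f n x \<partial>lborel)" for f and m n :: nat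
    by (intro nn_integral_mono) (auto simp: tr_def min.coboundedI1 intro!: min.mono)
  show ?thesis
    unfolding SUP[OF assms(1)] SUP[OF assms(2)] SUP_mult_right_ennreal SUP_mult_left_ennreal
  proof (intro SUP_least)
    fix m n :: nat
    have "(\<integral>\<^sup>+ x. tr u m x \<partial>lborel) * (\<integral>\<^sup>+ x. tr v n x \<partial>lborel)
      \<le> (\<integral>\<^sup>+ x. tr u (max m n) x \<partial>lborel) * (\<integral>\<^sup>+ x. tr v (max m n) x \<partial>lborel)"
      by (intro mult_mono mono) auto
    also note le
    finally show "(\<integral>\<^sup>+ x. tr u m x \<partial>lborel) * (\<integral>\<^sup>+ x. tr v n x \<partial>lborel) \<le> (\<integral>\<^sup>+ x. w x \<partial>lborel)\<^sup>2" .
  qed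
qed

text \<open>Induction on the coordinates: by the inequality on the line, integrating out one
  coordinate yields functions of the others that satisfy the hypothesis again. It is asked of
  extensional functions only, because these are the points of the product space, on which slices are
  measurable.\<close>

lemma prekopa_leindler_PiM:
  fixes u v w :: "('i \<Rightarrow> real) \<Rightarrow> ennreal"
  assumes "finite I"
    and "u \<in> borel_measurable (\<Pi>\<^sub>M i\<in>I. lborel)" "v \<in> borel_measurable (\<Pi>\<^sub>M i\<in>I. lborel)"
      "w \<in> borel_measurable (\<Pi>\<^sub>M i\<in>I. lborel)"
    and "\<And>x y. x \<in> extensional I \<Longrightarrow> y \<in> extensional I \<Longrightarrow> u x * v y \<le> (w (\<lambda>i\<in>I. (x i + y i) / 2))\<^sup>2"
  shows "(\<integral>\<^sup>+ x. u x \<partial>(\<Pi>\<^sub>M i\<in>I. lborel)) * (\<integral>\<^sup>+ x. v x \<partial>(\<Pi>\<^sub>M i\<in>I. lborel))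
      \<le> (\<integral>\<^sup>+ x. w x \<partial>(\<Pi>\<^sub>M i\<in>I. lborel))\<^sup>2"
  using assms
proof (induction I arbitrary: u v w rule: finite_induct)
  case empty
  interpret product_sigma_finite "\<lambda>_::'i. lborel :: real measure" ..
  have "u (\<lambda>_. undefined) * v (\<lambda>_. undefined) \<le> (w (\<lambda>i\<in>{}. undefined))\<^sup>2"
    using empty(4)[of "\<lambda>_. undefined" "\<lambda>_. undefined"] by (simp add: restrict_def)
  then show ?case by (simp add: nn_integral_empty restrict_def)
next
  case (insert i I)
  interpret product_sigma_finite "\<lambda>_::'i. lborel :: real measure" ..
  note [measurable] = insert.prems(1,2,3)
  have slice: "(\<lambda>s. f (x(i := s))) \<in> borel_measurable borel"
    if [measurable]: "f \<in> borel_measurable (\<Pi>\<^sub>M i\<in>insert i I. lborel)" and x: "x \<in> extensional I"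
    for f :: "('i \<Rightarrow> real) \<Rightarrow> ennreal" and x :: "'i \<Rightarrow> real"
  proof -
    have [measurable]: "x \<in> space (\<Pi>\<^sub>M i\<in>I. lborel)" using x by (simp add: space_PiM PiE_def)
    have "(\<lambda>s. f (x(i := s))) \<in> borel_measurable lborel" by measurable
    then show ?thesis by simp
  qed
  have int: "(\<lambda>x. \<integral>\<^sup>+ s. f (x(i := s)) \<partial>lborel) \<in> borel_measurable (\<Pi>\<^sub>M i\<in>I. lborel)"
    if [measurable]: "f \<in> borel_measurable (\<Pi>\<^sub>M i\<in>insert i I. lborel)" for f :: "('i \<Rightarrow> real) \<Rightarrow> ennreal"
    by measurable
  show ?case
    unfolding product_nn_integral_insert[OF insert.hyps(1,2) insert.prems(1)]
      product_nn_integral_insert[OF insert.hyps(1,2) insert.prems(2)]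
      product_nn_integral_insert[OF insert.hyps(1,2) insert.prems(3)]
  proof (rule insert.IH)
    fix x y :: "'i \<Rightarrow> real" assume xy: "x \<in> extensional I" "y \<in> extensional I"
    let ?z = "\<lambda>i\<in>I. (x i + y i) / 2"
    show "(\<integral>\<^sup>+ s. u (x(i := s)) \<partial>lborel) * (\<integral>\<^sup>+ s. v (y(i := s)) \<partial>lborel)
        \<le> (\<integral>\<^sup>+ s. w (?z(i := s)) \<partial>lborel)\<^sup>2"
    proof (rule prekopa_leindler_real)
      fix s t :: real
      have "u (x(i := s)) * v (y(i := t)) \<le> (w (\<lambda>j\<in>insert i I. ((x(i := s)) j + (y(i := t)) j) / 2))\<^sup>2"
        using xy by (intro insert.prems(4)) (auto simp: extensional_def)
      also have "(\<lambda>j\<in>insert i I. ((x(i := s)) j + (y(i := t)) j) / 2) = ?z(i := (s + t) / 2)"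
        using insert.hyps(2) by (auto simp: fun_eq_iff)
      finally show "u (x(i := s)) * v (y(i := t)) \<le> (w (?z(i := (s + t) / 2)))\<^sup>2" .
    qed (use xy in \<open>auto intro!: slice insert.prems\<close>)
  qed (intro int insert.prems)+
qed

theorem prekopa_leindler:
  fixes u v w :: "'a::euclidean_space \<Rightarrow> ennreal"
  assumes [measurable]: "u \<in> borel_measurable borel" "v \<in> borel_measurable borel" "w \<in> borel_measurable borel"
    and uvw: "\<And>x y. u x * v y \<le> (w ((1/2) *\<^sub>R (x + y)))\<^sup>2"
  shows "(\<integral>\<^sup>+ x. u x \<partial>lborel) * (\<integral>\<^sup>+ x. v x \<partial>lborel) \<le> (\<integral>\<^sup>+ x. w x \<partial>lborel)\<^sup>2"
proof -
  let ?T = "\<lambda>f::'a \<Rightarrow> real. \<Sum>b\<in>Basis. f b *\<^sub>R b"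
  have tr: "(\<integral>\<^sup>+ x. f x \<partial>lborel) = (\<integral>\<^sup>+ x. f (?T x) \<partial>(\<Pi>\<^sub>M b\<in>Basis. lborel))"
    if [measurable]: "f \<in> borel_measurable borel" for f :: "'a \<Rightarrow> ennreal"
    by (subst lborel_eq, subst nn_integral_distr) measurable
  show ?thesis
    unfolding tr[OF assms(1)] tr[OF assms(2)] tr[OF assms(3)]
  proof (rule prekopa_leindler_PiM)
    fix x y :: "'a \<Rightarrow> real"
    have "(1/2) *\<^sub>R (?T x + ?T y) = ?T (\<lambda>b\<in>Basis. (x b + y b) / 2)"
      by (simp add: sum.distrib[symmetric] scaleR_sum_right scaleR_add_left[symmetric] del: scaleR_add_left
        cong: sum.cong)
    then show "u (?T x) * v (?T y) \<le> (w (?T (\<lambda>b\<in>Basis. (x b + y b) / 2)))\<^sup>2"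
      using uvw[of "?T x" "?T y"] by simp
  qed measurable
qed

section \<open>A variance inequality as the second-order term of an inequality between exponential
  moments\<close>

section \<open>Second-order expansion of exponential moments\<close>

lemma exp_ge_quadratic:
  fixes y :: real
  assumes "\<bar>y\<bar> \<le> 1"
  shows "1 + y + y\<^sup>2 / 2 - \<bar>y\<bar> ^ 3 \<le> exp y"
proof -
  obtain t where t: "\<bar>t\<bar> \<le> \<bar>y\<bar>" "exp y = (\<Sum>m<4. y ^ m / fact m) + exp t / fact 4 * y ^ 4"
    using Maclaurin_exp_le[of y 4] by auto
  have "(\<Sum>m<4. y ^ m / fact m) = 1 + y + y\<^sup>2 / 2 + y ^ 3 / 6"
    by (simp add: numeral_eq_Suc fact_numeral)
  moreover have "0 \<le> exp t / fact 4 * y ^ 4" by simp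
  moreover have "\<bar>y ^ 3\<bar> = \<bar>y\<bar> ^ 3" by (simp add: power_abs)
  then have "- (\<bar>y\<bar> ^ 3) \<le> y ^ 3 / 6" by linarith
  ultimately show ?thesis using t(2) by linarith
qed

lemma exp_le_quadratic:
  fixes y :: real
  assumes "y \<le> 1"
  shows "exp y \<le> 1 + y + y\<^sup>2"
proof (cases "0 \<le> y")
  case True
  then show ?thesis using exp_bound assms by blast
next
  case False
  obtain t where t: "\<bar>t\<bar> \<le> \<bar>y\<bar>" "exp y = (\<Sum>m<3. y ^ m / fact m) + exp t / fact 3 * y ^ 3"
    using Maclaurin_exp_le[of y 3] by auto
  have "(\<Sum>m<3. y ^ m / fact m) = 1 + y + y\<^sup>2 / 2"
    by (simp add: numeral_eq_Suc fact_numeral)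
  moreover have "exp t / fact 3 * y ^ 3 \<le> 0"
    using False by (intro mult_nonneg_nonpos) (auto simp: zero_le_power_eq_numeral power_le_zero_eq)
  ultimately show ?thesis using t(2) by (smt (verit) zero_le_power2 field_sum_of_halves)
qed

text \<open>After centring, both moments on the left are at least
  \<open>1 + s\<^sup>2 * A / 2\<close> up to an error of order three, with \<open>A\<close> the
  variance, and the moment on the right is at most \<open>1 + s\<^sup>2 * expectation \<Phi>\<close>
  up to order four. Boundedness makes the errors uniform, so the coefficients of
  \<open>s\<^sup>2\<close> can be compared.\<close>

lemma (in prob_space) variance_le_of_exp_moments:
  fixes \<psi> \<Phi> :: "'a \<Rightarrow> real"
  assumes [measurable]: "\<psi> \<in> borel_measurable M" "\<Phi> \<in> borel_measurable M"
    and bd: "\<And>x. \<bar>\<psi> x\<bar> \<le> b" "\<And>x. \<bar>\<Phi> x\<bar> \<le> b" and "0 < s0"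
    and le: "\<And>s. 0 < s \<Longrightarrow> s \<le> s0 \<Longrightarrow>
      expectation (\<lambda>x. exp (s * \<psi> x)) * expectation (\<lambda>x. exp (- s * \<psi> x)) \<le> (expectation (\<lambda>x. exp (s\<^sup>2 * \<Phi> x)))\<^sup>2"
  shows "expectation (\<lambda>x. (\<psi> x)\<^sup>2) - (expectation \<psi>)\<^sup>2 \<le> 2 * expectation \<Phi>"
proof -
  have b0: "0 \<le> b" using bd(1) abs_ge_zero order_trans by blast
  define m where "m = expectation \<psi>"
  define f where "f x = \<psi> x - m" for x
  have [measurable]: "f \<in> borel_measurable M" unfolding f_def by measurable
  have int\<psi>: "integrable M \<psi>" by (rule integrable_const_bound[of _ b]) (use bd in auto)
  have int\<psi>2: "integrable M (\<lambda>x. (\<psi> x)\<^sup>2)"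
    by (rule integrable_const_bound[of _ "b\<^sup>2"]) (use bd b0 in \<open>auto simp: abs_le_square_iff[symmetric]\<close>)
  have int\<Phi>: "integrable M \<Phi>" by (rule integrable_const_bound[of _ b]) (use bd in auto)
  have "\<bar>m\<bar> \<le> b"
  proof -
    have "\<bar>m\<bar> \<le> expectation (\<lambda>x. \<bar>\<psi> x\<bar>)" unfolding m_def by (rule integral_abs_bound)
    also have "\<dots> \<le> b" using int\<psi> bd(1) by (intro integral_le_const integrable_abs) auto
    finally show ?thesis .
  qed
  \<comment> \<open>\<open>2 * b\<close> bounds the centred variable; the added 1 gives
    \<open>1 \<le> B\<close>, so that \<open>s * B \<le> 1\<close> also yields
    \<open>s\<^sup>2 * B \<le> 1\<close>.\<close>
  define B where "B = 2 * b + 1"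
  have B: "0 < B" "1 \<le> B" using b0 by (auto simp: B_def)
  have fB: "\<bar>f x\<bar> \<le> B" for x using bd(1)[of x] \<open>\<bar>m\<bar> \<le> b\<close> by (auto simp: f_def B_def)
  have intf: "integrable M f" by (rule integrable_const_bound[of _ B]) (use fB in auto)
  have intf2: "integrable M (\<lambda>x. (f x)\<^sup>2)"
    by (rule integrable_const_bound[of _ "B\<^sup>2"]) (use fB B in \<open>auto simp: abs_le_square_iff[symmetric]\<close>)
  have Ef: "expectation f = 0" unfolding f_def using int\<psi> by (simp add: m_def prob_space)
  define A where "A = expectation (\<lambda>x. (f x)\<^sup>2)"
  have A: "A = expectation (\<lambda>x. (\<psi> x)\<^sup>2) - m\<^sup>2"
  proof -
    have "A = expectation (\<lambda>x. (\<psi> x)\<^sup>2 - 2 * m * \<psi> x + m\<^sup>2)"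
      unfolding A_def f_def by (simp add: power2_diff mult_ac diff_diff_eq2 add_diff_eq diff_add_eq)
    also have "\<dots> = expectation (\<lambda>x. (\<psi> x)\<^sup>2) - 2 * m * m + m\<^sup>2"
      using int\<psi> int\<psi>2 by (simp add: m_def prob_space)
    finally show ?thesis by (simp add: power2_eq_square)
  qed
  have key: "A / 2 - s * B ^ 3 \<le> expectation \<Phi> + s\<^sup>2 * B\<^sup>2" if s: "0 < s" "s \<le> s0" "s * B \<le> 1" for s
  proof -
    have lower: "1 + s\<^sup>2 * A / 2 - s ^ 3 * B ^ 3 \<le> expectation (\<lambda>x. exp (\<sigma> * f x))" if \<sigma>: "\<bar>\<sigma>\<bar> = s" for \<sigma>
    proof -
      have "\<sigma>\<^sup>2 = s\<^sup>2" using \<sigma> by (metis power2_abs)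
      have abs: "\<bar>\<sigma> * f x\<bar> \<le> s * B" for x using fB[of x] \<sigma> s by (simp add: abs_mult mult_left_mono)
      have bnd: "1 + \<sigma> * f x + s\<^sup>2 / 2 * (f x)\<^sup>2 - s ^ 3 * B ^ 3 \<le> exp (\<sigma> * f x)" for x
      proof -
        have "\<bar>\<sigma> * f x\<bar> ^ 3 \<le> (s * B) ^ 3" using abs by (intro power_mono) auto
        moreover have "1 + \<sigma> * f x + (\<sigma> * f x)\<^sup>2 / 2 - \<bar>\<sigma> * f x\<bar> ^ 3 \<le> exp (\<sigma> * f x)"
          using abs[of x] s by (intro exp_ge_quadratic) auto
        ultimately show ?thesis using \<open>\<sigma>\<^sup>2 = s\<^sup>2\<close> by (simp add: power_mult_distrib)
      qed
      have "expectation (\<lambda>x. 1 + \<sigma> * f x + s\<^sup>2 / 2 * (f x)\<^sup>2 - s ^ 3 * B ^ 3) \<le> expectation (\<lambda>x. exp (\<sigma> * f x))"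
      proof (rule integral_mono)
        show "integrable M (\<lambda>x. exp (\<sigma> * f x))"
          using abs s by (intro integrable_const_bound[of _ "exp 1"]) (auto intro!: AE_I2 order_trans[OF abs_ge_self] order_trans[OF abs])
      qed (use intf intf2 bnd in auto)
      also have "expectation (\<lambda>x. 1 + \<sigma> * f x + s\<^sup>2 / 2 * (f x)\<^sup>2 - s ^ 3 * B ^ 3) = 1 + s\<^sup>2 * A / 2 - s ^ 3 * B ^ 3"
        using intf intf2 by (simp add: prob_space Ef A_def)
      finally show ?thesis .
    qed
    have upper: "expectation (\<lambda>x. exp (s\<^sup>2 * \<Phi> x)) \<le> 1 + s\<^sup>2 * expectation \<Phi> + s ^ 4 * B\<^sup>2"
    proof -
      have abs: "\<bar>s\<^sup>2 * \<Phi> x\<bar> \<le> s\<^sup>2 * B" for x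
        using bd(2)[of x] b0 by (simp add: abs_mult mult_left_mono B_def)
      have sB: "s\<^sup>2 * B \<le> 1"
      proof -
        have "s\<^sup>2 * B \<le> (s * B) * (s * B)" using B s by (simp add: power2_eq_square mult_ac)
        also have "\<dots> \<le> 1 * 1" using B s by (intro mult_mono) auto
        finally show ?thesis by simp
      qed
      have bnd: "exp (s\<^sup>2 * \<Phi> x) \<le> 1 + s\<^sup>2 * \<Phi> x + s ^ 4 * B\<^sup>2" for x
      proof -
        have "exp (s\<^sup>2 * \<Phi> x) \<le> 1 + s\<^sup>2 * \<Phi> x + (s\<^sup>2 * \<Phi> x)\<^sup>2"
          using abs[of x] sB exp_le_quadratic[of "s\<^sup>2 * \<Phi> x"] by simp
        also have "(s\<^sup>2 * \<Phi> x)\<^sup>2 \<le> (s\<^sup>2 * B)\<^sup>2"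
          using abs[of x] B by (simp add: abs_le_square_iff[symmetric])
        finally show ?thesis by (simp add: power_mult_distrib power_mult[symmetric])
      qed
      have "expectation (\<lambda>x. exp (s\<^sup>2 * \<Phi> x)) \<le> expectation (\<lambda>x. 1 + s\<^sup>2 * \<Phi> x + s ^ 4 * B\<^sup>2)"
      proof (rule integral_mono)
        show "integrable M (\<lambda>x. exp (s\<^sup>2 * \<Phi> x))"
          using abs sB by (intro integrable_const_bound[of _ "exp 1"]) (auto intro!: AE_I2 order_trans[OF abs_ge_self] order_trans[OF abs])
      qed (use int\<Phi> bnd in auto)
      also have "\<dots> = 1 + s\<^sup>2 * expectation \<Phi> + s ^ 4 * B\<^sup>2" using int\<Phi> by (simp add: prob_space)
      finally show ?thesis .
    qed
    \<comment> \<open>Centring multiplies the two moments by \<open>exp (- s * m)\<close> and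
      \<open>exp (s * m)\<close>, which cancel in the product.\<close>
    have prod: "expectation (\<lambda>x. exp (s * f x)) * expectation (\<lambda>x. exp (- s * f x)) \<le> (expectation (\<lambda>x. exp (s\<^sup>2 * \<Phi> x)))\<^sup>2"
    proof -
      have "expectation (\<lambda>x. exp (s * f x)) = exp (- s * m) * expectation (\<lambda>x. exp (s * \<psi> x))"
        by (subst integral_mult_right_zero[symmetric]) (simp add: f_def exp_add[symmetric] algebra_simps)
      moreover have "expectation (\<lambda>x. exp (- s * f x)) = exp (s * m) * expectation (\<lambda>x. exp (- s * \<psi> x))"
        by (subst integral_mult_right_zero[symmetric]) (simp add: f_def exp_add[symmetric] algebra_simps)
      ultimately have "expectation (\<lambda>x. exp (s * f x)) * expectation (\<lambda>x. exp (- s * f x))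
          = (exp (- s * m) * exp (s * m)) * (expectation (\<lambda>x. exp (s * \<psi> x)) * expectation (\<lambda>x. exp (- s * \<psi> x)))"
        by (simp add: mult_ac)
      also have "exp (- s * m) * exp (s * m) = 1" by (simp add: exp_minus)
      finally show ?thesis using le[of s] s by simp
    qed
    \<comment> \<open>Both factors of the product have the same lower bound, so an inequality
      between a product and a square descends to the bases.\<close>
    have "1 + s\<^sup>2 * A / 2 - s ^ 3 * B ^ 3 \<le> 1 + s\<^sup>2 * expectation \<Phi> + s ^ 4 * B\<^sup>2"
    proof (rule ccontr)
      assume neg: "\<not> ?thesis"
      let ?l = "1 + s\<^sup>2 * A / 2 - s ^ 3 * B ^ 3" and ?E = "expectation (\<lambda>x. exp (s\<^sup>2 * \<Phi> x))"
      have "0 \<le> ?E" by (intro Bochner_Integration.integral_nonneg) auto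
      have "0 \<le> ?l" using \<open>0 \<le> ?E\<close> neg upper by linarith
      have "?E * ?E < ?l * ?l" using \<open>0 \<le> ?E\<close> neg upper by (intro mult_strict_mono') auto
      also have "\<dots> \<le> expectation (\<lambda>x. exp (s * f x)) * expectation (\<lambda>x. exp (- s * f x))"
        using lower[of s] lower[of "-s"] \<open>0 \<le> ?l\<close> s
        by (intro mult_mono) (auto intro: order_trans)
      also note prod
      finally show False by (simp add: power2_eq_square)
    qed
    then have "s\<^sup>2 * (A / 2 - s * B ^ 3) \<le> s\<^sup>2 * (expectation \<Phi> + s\<^sup>2 * B\<^sup>2)"
      by (simp add: algebra_simps power_numeral_reduce)
    then show ?thesis using s by simp
  qed
  have "A / 2 - 0 * B ^ 3 \<le> expectation \<Phi> + 0\<^sup>2 * B\<^sup>2"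
  proof (rule tendsto_le[of "at_right 0"])
    show "((\<lambda>s. expectation \<Phi> + s\<^sup>2 * B\<^sup>2) \<longlongrightarrow> expectation \<Phi> + 0\<^sup>2 * B\<^sup>2) (at_right 0)"
      "((\<lambda>s. A / 2 - s * B ^ 3) \<longlongrightarrow> A / 2 - 0 * B ^ 3) (at_right 0)"
      by (intro tendsto_intros)+
    have "\<forall>\<^sub>F s in at_right 0. 0 < s \<and> s < min s0 (1 / B)"
      using \<open>0 < s0\<close> B by (auto simp: eventually_at_right_field intro!: exI[of _ "min s0 (1 / B)"])
    then show "\<forall>\<^sub>F s in at_right 0. A / 2 - s * B ^ 3 \<le> expectation \<Phi> + s\<^sup>2 * B\<^sup>2"
      by eventually_elim (rule key, use B in \<open>auto simp: field_simps\<close>)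
  qed auto
  then show ?thesis by (simp add: A m_def)
qed

section \<open>Compact-support estimates and quantitative convexity of the potential\<close>

section \<open>Smooth log-concave densities\<close>

lemma compact_enlargement:
  fixes K :: "'a::euclidean_space set"
  assumes "compact K" "open D" "K \<subseteq> D"
  obtains e where "0 < e" "compact {x + w | x w. x \<in> K \<and> w \<in> cball 0 e}"
    "{x + w | x w. x \<in> K \<and> w \<in> cball 0 e} \<subseteq> D"
proof -
  obtain e where e: "0 < e" "(\<Union>z\<in>K. cball z e) \<subseteq> D"
    using compact_subset_open_imp_cball_epsilon_subset[OF assms] by blast
  have "{x + w | x w. x \<in> K \<and> w \<in> cball 0 e} \<subseteq> D"
  proof
    fix y assume "y \<in> {x + w | x w. x \<in> K \<and> w \<in> cball 0 e}"
    then obtain z w where "y = z + w" "z \<in> K" "w \<in> cball 0 e" by auto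
    then have "y \<in> cball z e" by (auto simp: dist_norm)
    then show "y \<in> D" using e(2) \<open>z \<in> K\<close> by blast
  qed
  moreover have "compact {x + w | x w. x \<in> K \<and> w \<in> cball 0 e}" using assms by (intro compact_sums) auto
  ultimately show ?thesis using that e(1) by blast
qed

lemma compact_support_integrable:
  fixes f :: "'a::euclidean_space \<Rightarrow> real"
  assumes f: "continuous_on UNIV f" and K: "compact K" and f0: "\<And>x. x \<notin> K \<Longrightarrow> f x = 0"
  shows "integrable lborel f"
proof -
  have "integrable lborel (\<lambda>x. indicator K x *\<^sub>R f x)"
    by (intro borel_integrable_compact K continuous_on_subset[OF f]) auto
  also have "(\<lambda>x. indicator K x *\<^sub>R f x) = f" using f0 by (auto simp: fun_eq_iff indicator_def)
  finally show ?thesis .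
qed

lemma compact_support_equicontinuous:
  fixes f :: "'a::euclidean_space \<Rightarrow> real"
  assumes f: "continuous_on UNIV f" and K: "compact K" and f0: "\<And>x. x \<notin> K \<Longrightarrow> f x = 0" and "0 < e"
  shows "\<exists>d>0. \<forall>x w. norm w < d \<longrightarrow> \<bar>f (x + w) - f x\<bar> \<le> e"
proof -
  \<comment> \<open>Steps shorter than 1 that start or end in \<open>K\<close> stay in the closed
    1-neighbourhood \<open>S\<close>, where uniform continuity is available; all others join two
    zeros of \<open>f\<close>.\<close>
  define S where "S = {x + w | x w. x \<in> K \<and> w \<in> cball 0 1}"
  have "compact S" unfolding S_def using K by (intro compact_sums) auto
  then have "uniformly_continuous_on S f"
    by (intro compact_uniformly_continuous continuous_on_subset[OF f]) auto
  then obtain d where d: "0 < d" "\<And>x y. x \<in> S \<Longrightarrow> y \<in> S \<Longrightarrow> dist y x < d \<Longrightarrow> dist (f y) (f x) < e"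
    using \<open>0 < e\<close> unfolding uniformly_continuous_on_def by metis
  have S: "x + w \<in> S" if "x \<in> K" "norm w \<le> 1" for x w
    unfolding S_def using that by (intro CollectI exI[of _ x] exI[of _ w]) auto
  have "\<bar>f (x + w) - f x\<bar> \<le> e" if w: "norm w < min d 1" for x w
  proof (cases "x \<in> K \<or> x + w \<in> K")
    case True
    then have "x \<in> S \<and> x + w \<in> S"
    proof
      assume "x \<in> K" then show ?thesis using S[of x 0] S[of x w] w by simp
    next
      assume "x + w \<in> K" then show ?thesis using S[of "x + w" 0] S[of "x + w" "- w"] w by simp
    qed
    then show ?thesis using d(2)[of x "x + w"] w by (simp add: dist_norm)
  next
    case False
    then show ?thesis using f0 \<open>0 < e\<close> by simp
  qed
  then show ?thesis using d by (intro exI[of _ "min d 1"]) auto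
qed

lemma compact_support_bounded:
  fixes f :: "'a::euclidean_space \<Rightarrow> real"
  assumes f: "continuous_on UNIV f" and K: "compact K" and f0: "\<And>x. x \<notin> K \<Longrightarrow> f x = 0"
  obtains b where "0 \<le> b" "\<And>x. \<bar>f x\<bar> \<le> b"
proof -
  have "bounded (f ` K)" by (intro compact_imp_bounded compact_continuous_image K continuous_on_subset[OF f]) auto
  then obtain c where c: "\<And>x. x \<in> K \<Longrightarrow> \<bar>f x\<bar> \<le> c" by (auto simp: bounded_iff)
  have "\<bar>f x\<bar> \<le> max 0 c" for x using c[of x] f0[of x] by (cases "x \<in> K") auto
  then show ?thesis using that[of "max 0 c"] by auto
qed

(* U' x h and N x h stand for the directional derivative of U and the quadratic form of its Hessian. *)
locale smooth_log_concave =
  fixes D :: "'a::euclidean_space set" and U :: "'a \<Rightarrow> real" and U' N :: "'a \<Rightarrow> 'a \<Rightarrow> real"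
  assumes open_D: "open D" and convex_D: "convex D" and bounded_D: "bounded D"
    and convex_U: "convex_on D U"
    and deriv1: "\<And>x r h. x + r *\<^sub>R h \<in> D \<Longrightarrow>
      ((\<lambda>r. U (x + r *\<^sub>R h)) has_real_derivative U' (x + r *\<^sub>R h) h) (at r)"
    and deriv2: "\<And>x r h. x + r *\<^sub>R h \<in> D \<Longrightarrow>
      ((\<lambda>r. U' (x + r *\<^sub>R h) h) has_real_derivative N (x + r *\<^sub>R h) h) (at r)"
    and N_continuous: "continuous_on (D \<times> UNIV) (\<lambda>(x, h). N x h)"
    and N_scale: "\<And>x c h. x \<in> D \<Longrightarrow> N x (c *\<^sub>R h) = c\<^sup>2 * N x h"
    and N_pos: "\<And>x h. x \<in> D \<Longrightarrow> h \<noteq> 0 \<Longrightarrow> 0 < N x h"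
begin

lemma N_zero: "x \<in> D \<Longrightarrow> N x 0 = 0"
  using N_scale[of x 0 0] by simp

lemma N_nonneg: "x \<in> D \<Longrightarrow> 0 \<le> N x h"
  using N_pos[of x h] N_zero[of x] by (cases "h = 0") (auto intro: less_imp_le)

text \<open>The minimum over \<open>K\<close> times the unit sphere is attained and positive;
  homogeneity of degree two carries it to all \<open>h\<close>.\<close>

lemma N_lower:
  assumes "compact K" "K \<subseteq> D"
  shows "\<exists>m>0. \<forall>z\<in>K. \<forall>h. m * (norm h)\<^sup>2 \<le> N z h"
proof (cases "K = {}")
  case True then show ?thesis by (auto intro: exI[of _ 1])
next
  case False
  have "compact (K \<times> sphere (0::'a) 1)" using assms by (intro compact_Times) auto
  moreover have "K \<times> sphere (0::'a) 1 \<noteq> {}" using False by auto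
  moreover have "continuous_on (K \<times> sphere 0 1) (\<lambda>(x, h). N x h)"
    by (rule continuous_on_subset[OF N_continuous]) (use assms in auto)
  ultimately obtain p where p: "p \<in> K \<times> sphere 0 1"
    "\<forall>y\<in>K \<times> sphere 0 1. (case p of (x, h) \<Rightarrow> N x h) \<le> (case y of (x, h) \<Rightarrow> N x h)"
    using continuous_attains_inf[of "K \<times> sphere (0::'a) 1" "\<lambda>(x, h). N x h"] by blast
  define m where "m = (case p of (x, h) \<Rightarrow> N x h)"
  have "0 < m" using p(1) assms by (auto simp: m_def split: prod.split intro!: N_pos)
  moreover have "m * (norm h)\<^sup>2 \<le> N z h" if "z \<in> K" for z h
  proof (cases "h = 0")
    case True then show ?thesis using that assms N_zero by auto
  next
    case False
    have "m \<le> N z (h /\<^sub>R norm h)" using p(2) that False by (auto simp: m_def)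
    then have "m * (norm h)\<^sup>2 \<le> N z (h /\<^sub>R norm h) * (norm h)\<^sup>2" by (intro mult_right_mono) auto
    also have "\<dots> = N z (norm h *\<^sub>R (h /\<^sub>R norm h))"
      using that assms by (subst (2) N_scale) auto
    also have "norm h *\<^sub>R (h /\<^sub>R norm h) = h" using False by simp
    finally show ?thesis .
  qed
  ultimately show ?thesis by blast
qed

text \<open>Uniform continuity on a compact neighbourhood of \<open>K\<close> times the unit sphere
  gives the absolute error \<open>\<theta> * m\<close>; the lower bound \<open>m\<close> for
  \<open>N\<close> turns it into a relative one, which is comparable with \<open>N z h\<close> for
  all directions and lengths of \<open>h\<close> at once.\<close>

lemma N_uniform:
  assumes K: "compact K" "K \<subseteq> D" and "0 < \<theta>"
  shows "\<exists>\<delta>>0. \<forall>z\<in>K. cball z \<delta> \<subseteq> D \<and> (\<forall>x\<in>cball z \<delta>. \<forall>h. \<bar>N x h - N z h\<bar> \<le> \<theta> * N z h)"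
proof -
  obtain e where e: "0 < e" "compact {z + w | z w. z \<in> K \<and> w \<in> cball 0 e}"
    "{z + w | z w. z \<in> K \<and> w \<in> cball 0 e} \<subseteq> D"
    using compact_enlargement[OF K(1) open_D K(2)] by blast
  define L where "L = {z + w | z w. z \<in> K \<and> w \<in> cball 0 e}"
  have L: "compact L" "L \<subseteq> D" using e by (auto simp: L_def)
  obtain m where m: "0 < m" "\<And>z h. z \<in> K \<Longrightarrow> m * (norm h)\<^sup>2 \<le> N z h" using N_lower[OF K] by blast
  have "uniformly_continuous_on (L \<times> sphere (0::'a) 1) (\<lambda>(x, h). N x h)"
    by (intro compact_uniformly_continuous continuous_on_subset[OF N_continuous] compact_Times) (use L in auto)
  then obtain d where d: "0 < d" "\<And>x y. x \<in> L \<times> sphere 0 1 \<Longrightarrow> y \<in> L \<times> sphere 0 1 \<Longrightarrow> dist y x < d \<Longrightarrow>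
      dist (case y of (x, h) \<Rightarrow> N x h) (case x of (x, h) \<Rightarrow> N x h) < \<theta> * m"
    using \<open>0 < \<theta>\<close> m(1) unfolding uniformly_continuous_on_def by (metis mult_pos_pos)
  define \<delta> where "\<delta> = min e (d / 2)"
  have "0 < \<delta>" using e d by (auto simp: \<delta>_def)
  moreover have "cball z \<delta> \<subseteq> D" if "z \<in> K" for z
  proof
    fix x assume "x \<in> cball z \<delta>"
    then have "z + (x - z) \<in> L" unfolding L_def using that
      by (intro CollectI exI[of _ z] exI[of _ "x - z"]) (auto simp: \<delta>_def dist_norm norm_minus_commute)
    then show "x \<in> D" using L by auto
  qed
  moreover have "\<bar>N x h - N z h\<bar> \<le> \<theta> * N z h" if "z \<in> K" "x \<in> cball z \<delta>" for x z h
  proof (cases "h = 0")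
    case True
    have "x \<in> D" "z \<in> D" using calculation(2)[OF that(1)] that K by auto
    then show ?thesis using True N_zero by simp
  next
    case False
    define g where "g = h /\<^sub>R norm h"
    have g: "norm g = 1" "h = norm h *\<^sub>R g" using False by (auto simp: g_def)
    have zL: "z \<in> L" unfolding L_def using that e by (intro CollectI exI[of _ z] exI[of _ 0]) auto
    have xL: "x \<in> L" unfolding L_def using that
      by (intro CollectI exI[of _ z] exI[of _ "x - z"]) (auto simp: \<delta>_def dist_norm norm_minus_commute)
    have xz: "x \<in> D" "z \<in> D" using xL zL L by auto
    have "dist (x, g) (z, g) < d" using that d by (auto simp: dist_Pair_Pair \<delta>_def dist_commute)
    then have "\<bar>N x g - N z g\<bar> < \<theta> * m"
      using d(2)[of "(z, g)" "(x, g)"] xL zL g by (auto simp: dist_real_def)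
    then have "(norm h)\<^sup>2 * \<bar>N x g - N z g\<bar> \<le> (norm h)\<^sup>2 * (\<theta> * m)" by (intro mult_left_mono) auto
    moreover have "N x h - N z h = (norm h)\<^sup>2 * (N x g - N z g)"
      using N_scale[OF xz(1), of "norm h" g] N_scale[OF xz(2), of "norm h" g] g(2) by (simp add: algebra_simps)
    moreover have "\<theta> * (m * (norm h)\<^sup>2) \<le> \<theta> * N z h" using \<open>0 < \<theta>\<close> m(2)[OF that(1)] by (intro mult_left_mono) auto
    ultimately show ?thesis by (simp add: abs_mult mult_ac)
  qed
  ultimately show ?thesis by blast
qed

text \<open>Subtracting \<open>c / 2 * r\<^sup>2\<close> from \<open>U\<close> along the line leaves
  a convex function on [-1, 1]; its midpoint inequality at 0 is the claim.\<close>

lemma second_difference_ge: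
  assumes "cball z \<delta> \<subseteq> D" "\<And>x. x \<in> cball z \<delta> \<Longrightarrow> c \<le> N x h" "norm h \<le> \<delta>"
  shows "c \<le> U (z + h) + U (z - h) - 2 * U z"
proof -
  define f where "f r = U (z + r *\<^sub>R h) - c / 2 * r\<^sup>2" for r
  have cb: "z + r *\<^sub>R h \<in> cball z \<delta>" if "r \<in> {-1..1}" for r
  proof -
    have "norm (r *\<^sub>R h) \<le> 1 * norm h" unfolding norm_scaleR using that by (intro mult_right_mono) auto
    then show ?thesis using assms(3) by (simp add: dist_norm)
  qed
  have "convex_on {-1..1} f"
  proof (rule f''_ge0_imp_convex)
    fix r :: real assume r: "r \<in> {-1..1}"
    have D: "z + r *\<^sub>R h \<in> D" using cb[OF r] assms(1) by auto
    show "(f has_real_derivative U' (z + r *\<^sub>R h) h - c * r) (at r)"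
      unfolding f_def by (rule derivative_eq_intros deriv1 D refl | simp)+
    show "((\<lambda>r. U' (z + r *\<^sub>R h) h - c * r) has_real_derivative N (z + r *\<^sub>R h) h - c) (at r)"
      by (rule derivative_eq_intros deriv2 D refl | simp)+
    show "0 \<le> N (z + r *\<^sub>R h) h - c" using assms(2)[OF cb[OF r]] by simp
  qed simp
  then have "f ((1 - 1/2) *\<^sub>R (-1) + (1/2) *\<^sub>R 1) \<le> (1 - 1/2) * f (-1) + 1/2 * f 1"
    by (rule convex_onD) auto
  then show ?thesis by (simp add: f_def field_simps)
qed

lemma second_difference_nonneg:
  assumes "z + h \<in> D" "z - h \<in> D"
  shows "0 \<le> U (z + h) + U (z - h) - 2 * U z"
proof -
  have "U ((1 - 1/2) *\<^sub>R (z + h) + (1/2) *\<^sub>R (z - h)) \<le> (1 - 1/2) * U (z + h) + 1/2 * U (z - h)"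
    using convex_U assms by (intro convex_onD) auto
  also have "(1 - 1/2) *\<^sub>R (z + h) + (1/2) *\<^sub>R (z - h) = z"
    by (simp add: scaleR_add_right scaleR_diff_right flip: scaleR_add_left)
  finally show ?thesis by (simp add: field_simps)
qed

text \<open>By convexity the second difference for \<open>r *\<^sub>R h\<close> is at most
  \<open>r\<close> times the nonnegative one for \<open>h\<close>. This compares long steps with
  steps of a fixed short length.\<close>

lemma second_difference_mono:
  assumes "z \<in> D" "z + h \<in> D" "z - h \<in> D" "0 \<le> r" "r \<le> 1"
  shows "U (z + r *\<^sub>R h) + U (z - r *\<^sub>R h) - 2 * U z \<le> U (z + h) + U (z - h) - 2 * U z"
proof -
  have "U ((1 - r) *\<^sub>R z + r *\<^sub>R (z + h)) \<le> (1 - r) * U z + r * U (z + h)"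
    "U ((1 - r) *\<^sub>R z + r *\<^sub>R (z - h)) \<le> (1 - r) * U z + r * U (z - h)"
    using convex_U assms by (auto intro!: convex_onD)
  moreover have "(1 - r) *\<^sub>R z + r *\<^sub>R (z + h) = z + r *\<^sub>R h" "(1 - r) *\<^sub>R z + r *\<^sub>R (z - h) = z - r *\<^sub>R h"
    by (simp_all add: algebra_simps)
  moreover have "(1 - r) * (U (z + h) + U (z - h) - 2 * U z) \<ge> 0"
    using second_difference_nonneg[of z h] assms by simp
  ultimately show ?thesis by (simp add: algebra_simps)
qed

end

section \<open>Averaging over a Lipschitz kernel and its effect on symmetric differences\<close>

section \<open>Mollification\<close>

lemma integrable_lborel_translate:
  fixes f :: "'a::euclidean_space \<Rightarrow> real"
  assumes "integrable lborel f"
  shows "integrable lborel (\<lambda>w. f (z + w))"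
proof -
  have "integrable (distr lborel borel ((+) z)) f" using assms by (simp add: lborel_distr_plus)
  then show ?thesis by (rule integrable_distr[rotated]) measurable
qed

lemma integral_lborel_translate:
  fixes f :: "'a::euclidean_space \<Rightarrow> real"
  assumes [measurable]: "f \<in> borel_measurable borel"
  shows "(LINT w|lborel. f (z + w)) = (LINT w|lborel. f w)"
proof -
  have "(LINT w|lborel. f w) = (LINT w|distr lborel borel ((+) z). f w)" by (simp add: lborel_distr_plus)
  also have "\<dots> = (LINT w|lborel. f (z + w))" by (rule integral_distr) measurable
  finally show ?thesis ..
qed

lemma nn_integral_lborel_translate:
  fixes f :: "'a::euclidean_space \<Rightarrow> ennreal"
  assumes [measurable]: "f \<in> borel_measurable borel"
  shows "(\<integral>\<^sup>+ w. f (z + w) \<partial>lborel) = (\<integral>\<^sup>+ w. f w \<partial>lborel)"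
proof -
  have "(\<integral>\<^sup>+ w. f w \<partial>lborel) = (\<integral>\<^sup>+ w. f w \<partial>distr lborel borel ((+) z))" by (simp add: lborel_distr_plus)
  also have "\<dots> = (\<integral>\<^sup>+ w. f (z + w) \<partial>lborel)" by (rule nn_integral_distr) measurable
  finally show ?thesis ..
qed

text \<open>A normalised cone kernel. Lipschitz regularity suits the purpose: differences of
  mollified functions enter, never their derivatives.\<close>

definition tent :: "real \<Rightarrow> 'a::euclidean_space \<Rightarrow> real" where
  "tent \<rho> w = max 0 (\<rho> - norm w) / (LINT v|lborel. max 0 (\<rho> - norm (v::'a)))"

lemma tent_raw_integrable: "integrable lborel (\<lambda>v::'a::euclidean_space. max 0 (\<rho> - norm v))"
proof -
  have "integrable lborel (\<lambda>v::'a. indicator (cball 0 \<rho>) v *\<^sub>R (\<rho> - norm v))"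
    by (intro borel_integrable_compact continuous_intros) auto
  also have "(\<lambda>v::'a. indicator (cball 0 \<rho>) v *\<^sub>R (\<rho> - norm v)) = (\<lambda>v. max 0 (\<rho> - norm v))"
    by (auto simp: fun_eq_iff indicator_def max_def)
  finally show ?thesis .
qed

lemma tent_raw_integral_pos:
  assumes "0 < \<rho>"
  shows "0 < (LINT v|lborel. max 0 (\<rho> - norm (v::'a::euclidean_space)))"
proof -
  have "0 < \<rho> / 2 * measure lborel (ball (0::'a) (\<rho> / 2))"
    using assms by (simp add: content_ball_pos)
  also have "\<dots> = (LINT v|lborel. \<rho> / 2 * indicator (ball (0::'a) (\<rho> / 2)) v)"
    using emeasure_bounded_finite[of "ball (0::'a) (\<rho> / 2)"] by simp
  also have "\<dots> \<le> (LINT v|lborel. max 0 (\<rho> - norm (v::'a)))"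
  proof (rule integral_mono)
    show "integrable lborel (\<lambda>v. \<rho> / 2 * indicator (ball (0::'a) (\<rho> / 2)) v)"
      using emeasure_bounded_finite[of "ball (0::'a) (\<rho> / 2)"]
      by (intro integrable_mult_right integrable_real_indicator) auto
    show "\<rho> / 2 * indicator (ball (0::'a) (\<rho> / 2)) v \<le> max 0 (\<rho> - norm v)" for v :: 'a
      using assms by (auto simp: indicator_def)
  qed (rule tent_raw_integrable)
  finally show ?thesis .
qed

lemma tent_nonneg: "0 < \<rho> \<Longrightarrow> 0 \<le> tent \<rho> w"
  using tent_raw_integral_pos[of \<rho>, where 'a = 'a] unfolding tent_def by (auto intro!: divide_nonneg_pos)

lemma tent_eq_0: "\<rho> \<le> norm w \<Longrightarrow> tent \<rho> w = 0"
  by (simp add: tent_def)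

lemma tent_integrable: "integrable lborel (tent \<rho> :: 'a::euclidean_space \<Rightarrow> real)"
  unfolding tent_def[abs_def] by (intro integrable_divide_zero tent_raw_integrable impI)

lemma tent_measurable [measurable]: "(tent \<rho> :: 'a::euclidean_space \<Rightarrow> real) \<in> borel_measurable borel"
  using borel_measurable_integrable[OF tent_integrable] by simp

lemma tent_integral: "0 < \<rho> \<Longrightarrow> (LINT w|lborel. tent \<rho> (w::'a::euclidean_space)) = 1"
  using tent_raw_integral_pos[of \<rho>, where 'a = 'a] unfolding tent_def by simp

lemma tent_nn_integral: "0 < \<rho> \<Longrightarrow> (\<integral>\<^sup>+ w. ennreal (tent \<rho> (w::'a::euclidean_space)) \<partial>lborel) = 1"
  by (subst nn_integral_eq_integral) (auto simp: tent_integral tent_integrable tent_nonneg)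

lemma tent_lipschitz:
  assumes "0 < \<rho>"
  shows "\<exists>L\<ge>0. (\<forall>w::'a::euclidean_space. tent \<rho> w \<le> L) \<and> (\<forall>x y::'a. \<bar>tent \<rho> x - tent \<rho> y\<bar> \<le> L * dist x y)"
proof -
  define c where "c = (LINT v|lborel. max 0 (\<rho> - norm (v::'a)))"
  have c: "0 < c" unfolding c_def by (rule tent_raw_integral_pos[OF assms])
  have t: "tent \<rho> w = max 0 (\<rho> - norm w) / c" for w :: 'a by (simp add: tent_def c_def)
  \<comment> \<open>One constant serves two purposes: the kernel is at most
    \<open>\<rho> / c\<close> high and has Lipschitz constant at most \<open>1 / c\<close>.\<close>
  have "tent \<rho> w \<le> (1 + \<rho>) / c" for w :: 'a
    unfolding t using c assms norm_ge_zero[of w] by (intro divide_right_mono) linarith+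
  moreover have "\<bar>tent \<rho> x - tent \<rho> y\<bar> \<le> (1 + \<rho>) / c * dist x y" for x y :: 'a
  proof -
    have "\<bar>max 0 (\<rho> - norm x) - max 0 (\<rho> - norm y)\<bar> \<le> \<bar>norm x - norm y\<bar>" by (auto simp: max_def)
    also have "\<dots> \<le> 1 * dist x y" by (simp add: dist_norm norm_triangle_ineq3)
    also have "\<dots> \<le> (1 + \<rho>) * dist x y" using assms by (intro mult_right_mono) auto
    finally show ?thesis using c unfolding t
      by (simp add: diff_divide_distrib[symmetric] divide_right_mono)
  qed
  ultimately show ?thesis using c assms by (intro exI[of _ "(1 + \<rho>) / c"]) auto
qed

definition mollify :: "real \<Rightarrow> ('a::euclidean_space \<Rightarrow> real) \<Rightarrow> 'a \<Rightarrow> real" where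
  "mollify \<rho> f z = (LINT w|lborel. tent \<rho> w * f (z + w))"

context
  fixes \<rho> :: real and f :: "'a::euclidean_space \<Rightarrow> real"
  assumes \<rho>: "0 < \<rho>" and f: "integrable lborel f"
begin

lemma borel_measurable_of_integrable [measurable]: "f \<in> borel_measurable borel"
  using f by (auto dest: borel_measurable_integrable)

lemma mollify_integrable: "integrable lborel (\<lambda>w. tent \<rho> w * f (z + w))"
proof -
  obtain L where L: "0 \<le> L" "\<And>w::'a. tent \<rho> w \<le> L" using tent_lipschitz[OF \<rho>] by blast
  have "integrable lborel (\<lambda>w. L * \<bar>f (z + w)\<bar>)"
    using integrable_lborel_translate[OF f] by auto
  then show ?thesis
    by (rule Bochner_Integration.integrable_bound)
      (auto simp: abs_mult tent_nonneg[OF \<rho>] L abs_mult mult_right_mono)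
qed

text \<open>Translation invariance moves the argument \<open>z\<close> from \<open>f\<close>, which
  is merely integrable, to the Lipschitz kernel.\<close>

lemma mollify_alt:
  shows "mollify \<rho> f z = (LINT y|lborel. tent \<rho> (y - z) * f y)"
    and "integrable lborel (\<lambda>y. tent \<rho> (y - z) * f y)"
proof -
  show "mollify \<rho> f z = (LINT y|lborel. tent \<rho> (y - z) * f y)"
    unfolding mollify_def using integral_lborel_translate[of "\<lambda>y. tent \<rho> (y - z) * f y" z] by simp
  show "integrable lborel (\<lambda>y. tent \<rho> (y - z) * f y)"
    using integrable_lborel_translate[OF mollify_integrable[of z], of "-z"] by simp
qed

lemma mollify_lipschitz:
  assumes L: "\<And>x y::'a. \<bar>tent \<rho> x - tent \<rho> y\<bar> \<le> L * dist x y"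
  shows "\<bar>mollify \<rho> f z - mollify \<rho> f z'\<bar> \<le> L * dist z z' * (LINT y|lborel. \<bar>f y\<bar>)"
proof -
  have "mollify \<rho> f z - mollify \<rho> f z' = (LINT y|lborel. tent \<rho> (y - z) * f y - tent \<rho> (y - z') * f y)"
    unfolding mollify_alt(1) by (subst Bochner_Integration.integral_diff) (auto intro: mollify_alt(2))
  also have "\<bar>\<dots>\<bar> \<le> (LINT y|lborel. \<bar>tent \<rho> (y - z) * f y - tent \<rho> (y - z') * f y\<bar>)"
    by (rule integral_abs_bound)
  also have "\<dots> \<le> (LINT y|lborel. L * dist z z' * \<bar>f y\<bar>)"
  proof (intro integral_mono)
    fix y
    have "\<bar>tent \<rho> (y - z) - tent \<rho> (y - z')\<bar> \<le> L * dist z z'"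
      using L[of "y - z" "y - z'"] by (simp add: dist_norm norm_minus_commute)
    then have "\<bar>tent \<rho> (y - z) - tent \<rho> (y - z')\<bar> * \<bar>f y\<bar> \<le> L * dist z z' * \<bar>f y\<bar>"
      by (intro mult_right_mono) auto
    then show "\<bar>tent \<rho> (y - z) * f y - tent \<rho> (y - z') * f y\<bar> \<le> L * dist z z' * \<bar>f y\<bar>"
      by (simp add: abs_mult[symmetric] algebra_simps)
  qed (intro integrable_abs Bochner_Integration.integrable_diff integrable_mult_right mollify_alt(2) f)+
  finally show ?thesis by simp
qed

lemma mollify_continuous: "continuous_on UNIV (mollify \<rho> f)"
proof -
  obtain L where L: "0 \<le> L" "\<And>x y::'a. \<bar>tent \<rho> x - tent \<rho> y\<bar> \<le> L * dist x y" using tent_lipschitz[OF \<rho>] by blast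
  define c where "c = L * (LINT y|lborel. \<bar>f y\<bar>)"
  have "c \<ge> 0" unfolding c_def using L by (intro mult_nonneg_nonneg Bochner_Integration.integral_nonneg) auto
  then have "c-lipschitz_on UNIV (mollify \<rho> f)"
    using mollify_lipschitz[OF L(2)] by (intro lipschitz_onI) (auto simp: c_def dist_real_def mult_ac)
  then show ?thesis by (rule lipschitz_on_continuous_on)
qed

lemma mollify_measurable [measurable]: "mollify \<rho> f \<in> borel_measurable borel"
  by (rule borel_measurable_continuous_onI[OF mollify_continuous])

lemma mollify_nonneg:
  assumes "\<And>x. 0 \<le> f x"
  shows "0 \<le> mollify \<rho> f z"
  unfolding mollify_def by (intro Bochner_Integration.integral_nonneg mult_nonneg_nonneg tent_nonneg \<rho> assms)

text \<open>The kernel is nonnegative, has mass 1 and vanishes outside the ball of radius \<rho>.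
  With \<open>c = 0\<close> this yields bounds and the support of the mollified function, with
  \<open>c = f z\<close> its closeness to \<open>f\<close>.\<close>

lemma mollify_near:
  assumes "\<And>w. norm w < \<rho> \<Longrightarrow> \<bar>f (z + w) - c\<bar> \<le> e"
  shows "\<bar>mollify \<rho> f z - c\<bar> \<le> e"
proof -
  have "mollify \<rho> f z - c = (LINT w|lborel. tent \<rho> w * f (z + w) - tent \<rho> w * c)"
    unfolding mollify_def using mollify_integrable tent_integrable[of \<rho>, where 'a = 'a] by (simp add: tent_integral[OF \<rho>])
  also have "\<bar>\<dots>\<bar> \<le> (LINT w|lborel. \<bar>tent \<rho> w * f (z + w) - tent \<rho> w * c\<bar>)"
    by (rule integral_abs_bound)
  also have "\<dots> \<le> (LINT w|lborel. tent \<rho> (w::'a) * e)"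
  proof (intro integral_mono)
    fix w :: 'a
    show "\<bar>tent \<rho> w * f (z + w) - tent \<rho> w * c\<bar> \<le> tent \<rho> w * e"
    proof (cases "norm w < \<rho>")
      case True
      have "tent \<rho> w * \<bar>f (z + w) - c\<bar> \<le> tent \<rho> w * e"
        using assms[OF True] tent_nonneg[OF \<rho>] by (intro mult_left_mono) auto
      then show ?thesis using tent_nonneg[OF \<rho>, of w] by (simp add: right_diff_distrib[symmetric] abs_mult)
    qed (simp add: tent_eq_0)
  qed (use mollify_integrable tent_integrable[of \<rho>, where 'a = 'a] in auto)
  also have "\<dots> = e" using tent_integrable[of \<rho>, where 'a = 'a] by (simp add: tent_integral[OF \<rho>])
  finally show ?thesis .
qed

lemma nn_integral_mollify:
  assumes "\<And>x. 0 \<le> f x"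
  shows "(\<integral>\<^sup>+ w. ennreal (tent \<rho> w) * ennreal (f (z + w)) \<partial>lborel) = ennreal (mollify \<rho> f z)"
proof -
  have "(\<integral>\<^sup>+ w. ennreal (tent \<rho> w) * ennreal (f (z + w)) \<partial>lborel) = (\<integral>\<^sup>+ w. ennreal (tent \<rho> w * f (z + w)) \<partial>lborel)"
    using assms tent_nonneg[OF \<rho>, where 'a = 'a] by (simp add: ennreal_mult)
  also have "\<dots> = ennreal (mollify \<rho> f z)"
    unfolding mollify_def using assms tent_nonneg[OF \<rho>, where 'a = 'a]
    by (intro nn_integral_eq_integral mollify_integrable) (auto intro!: mult_nonneg_nonneg)
  finally show ?thesis .
qed

text \<open>\<open>f\<close> may be discontinuous, so Fubini transfers the averaging to the weight
  \<open>q\<close>, which grows by at most \<omega> over distances below \<rho>.\<close>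

lemma integral_mult_mollify_le:
  assumes f0: "\<And>x. 0 \<le> f x" and [measurable]: "q \<in> borel_measurable borel"
    and q: "\<And>x. 0 \<le> q x" "\<And>x. q x \<le> B" and q_near: "\<And>x w. norm w < \<rho> \<Longrightarrow> q (x - w) \<le> q x + \<omega>" and "0 \<le> \<omega>"
  shows "(\<integral>\<^sup>+ z. ennreal (q z * mollify \<rho> f z) \<partial>lborel) \<le> ennreal ((LINT x|lborel. q x * f x) + \<omega> * (LINT x|lborel. f x))"
proof -
  have qf: "integrable lborel (\<lambda>x. q x * f x)"
    using f q by (intro Bochner_Integration.integrable_bound[of lborel "\<lambda>x. B * f x" "\<lambda>x. q x * f x"])
      (auto simp: abs_mult f0 intro!: mult_right_mono order_trans[OF q(2)])
  have "(\<integral>\<^sup>+ z. ennreal (q z * mollify \<rho> f z) \<partial>lborel)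
      = (\<integral>\<^sup>+ z. (\<integral>\<^sup>+ w. ennreal (tent \<rho> w) * (ennreal (q z) * ennreal (f (z + w))) \<partial>lborel) \<partial>lborel)"
    using q by (intro nn_integral_cong)
      (simp add: ennreal_mult' nn_integral_mollify[OF f0, symmetric] nn_integral_cmult[symmetric] mult_ac)
  also have "\<dots> = (\<integral>\<^sup>+ w. (\<integral>\<^sup>+ z. ennreal (tent \<rho> w) * (ennreal (q z) * ennreal (f (z + w))) \<partial>lborel) \<partial>lborel)"
    by (rule lborel_pair.Fubini') measurable
  also have "\<dots> = (\<integral>\<^sup>+ w. ennreal (tent \<rho> w) * (\<integral>\<^sup>+ z. ennreal (q z) * ennreal (f (z + w)) \<partial>lborel) \<partial>lborel)"
    by (intro nn_integral_cong nn_integral_cmult) measurable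
  also have "\<dots> \<le> (\<integral>\<^sup>+ w. ennreal (tent \<rho> (w::'a)) * ennreal (LINT x|lborel. (q x + \<omega>) * f x) \<partial>lborel)"
  proof (intro nn_integral_mono)
    fix w :: 'a
    show "ennreal (tent \<rho> w) * (\<integral>\<^sup>+ z. ennreal (q z) * ennreal (f (z + w)) \<partial>lborel)
        \<le> ennreal (tent \<rho> w) * ennreal (LINT x|lborel. (q x + \<omega>) * f x)"
    proof (cases "norm w < \<rho>")
      case True
      have "(\<integral>\<^sup>+ z. ennreal (q z) * ennreal (f (z + w)) \<partial>lborel) = (\<integral>\<^sup>+ x. ennreal (q (x - w)) * ennreal (f x) \<partial>lborel)"
        using nn_integral_lborel_translate[of "\<lambda>x. ennreal (q (x - w)) * ennreal (f x)" w] by (simp add: add.commute)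
      also have "\<dots> \<le> (\<integral>\<^sup>+ x. ennreal ((q x + \<omega>) * f x) \<partial>lborel)"
      proof (intro nn_integral_mono)
        fix x
        have "q (x - w) * f x \<le> (q x + \<omega>) * f x" by (intro mult_right_mono q_near True f0)
        then show "ennreal (q (x - w)) * ennreal (f x) \<le> ennreal ((q x + \<omega>) * f x)"
          using q f0 by (simp add: ennreal_mult[symmetric] ennreal_leI)
      qed
      also have "\<dots> = ennreal (LINT x|lborel. (q x + \<omega>) * f x)"
        using q f0 f qf \<open>0 \<le> \<omega>\<close> by (intro nn_integral_eq_integral) (auto simp: distrib_right)
      finally show ?thesis by (rule mult_left_mono) simp
    qed (simp add: tent_eq_0)
  qed
  also have "\<dots> = ennreal (LINT x|lborel. (q x + \<omega>) * f x)"
    by (subst nn_integral_multc) (auto simp: tent_nn_integral[OF \<rho>])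
  also have "(LINT x|lborel. (q x + \<omega>) * f x) = (LINT x|lborel. q x * f x) + \<omega> * (LINT x|lborel. f x)"
    using f qf by (simp add: distrib_right)
  finally show ?thesis .
qed

end

text \<open>Hypothesis \<open>le\<close> is a weighted arithmetic-geometric bound on the derivative,
  in which \<open>c\<close> balances the quadratic form against \<open>Q\<close>; it is integrated
  over [-1, 1]. The integral of \<open>Q\<close> is taken in the extended nonnegative sense to
  include segments along which \<open>Q\<close> is not integrable.\<close>

lemma difference_le_nn_integral:
  fixes g :: "'a::euclidean_space \<Rightarrow> real"
  assumes g: "\<And>x. (g has_derivative g' x) (at x)"
    and [measurable]: "Q \<in> borel_measurable borel" and Q0: "\<And>x. 0 \<le> Q x"
    and "0 < c" "0 \<le> A"
    and le: "\<And>r. r \<in> {-1..1} \<Longrightarrow> 2 * g' (y + r *\<^sub>R h) h \<le> c * A + Q (y + r *\<^sub>R h) / c"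
  shows "ennreal (g (y + h) - g (y - h)) \<le> ennreal (c * A)
    + ennreal (1 / (2 * c)) * (\<integral>\<^sup>+ r. indicator {-1..1} r * ennreal (Q (y + r *\<^sub>R h)) \<partial>lborel)"
proof (cases "(\<integral>\<^sup>+ r. indicator {-1..1} r * ennreal (Q (y + r *\<^sub>R h)) \<partial>lborel) = \<infinity>")
  case True
  then show ?thesis using \<open>0 < c\<close> by (simp add: ennreal_mult_top)
next
  case False
  let ?f = "\<lambda>r. indicator {-1..1} r *\<^sub>R Q (y + r *\<^sub>R h)"
  have nn: "(\<integral>\<^sup>+ r. ennreal (?f r) \<partial>lborel) = (\<integral>\<^sup>+ r. indicator {-1..1} r * ennreal (Q (y + r *\<^sub>R h)) \<partial>lborel)"
    by (intro nn_integral_cong) (auto simp: indicator_def)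
  have int: "integrable lborel ?f"
    by (rule integrableI_nonneg) (use False Q0 nn in \<open>auto simp: less_top\<close>)
  then have "set_integrable lborel {-1..1} (\<lambda>r. Q (y + r *\<^sub>R h))" by (simp add: set_integrable_def)
  from set_borel_integral_eq_integral[OF this]
  have HK: "((\<lambda>r. Q (y + r *\<^sub>R h)) has_integral (LINT r|lborel. ?f r)) {-1..1}"
    by (simp add: set_lebesgue_integral_def has_integral_integral[symmetric] has_integral_iff)
  \<comment> \<open>The derivative of \<open>g\<close> may be discontinuous, so the fundamental
    theorem is used for the gauge integral, in which every derivative is integrable.\<close>
  have "((\<lambda>r. g' (y + r *\<^sub>R h) h) has_integral (g (y + 1 *\<^sub>R h) - g (y + (-1) *\<^sub>R h))) {-1..1}"
  proof (rule fundamental_theorem_of_calculus)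
    fix r :: real assume "r \<in> {-1..1}"
    have "((\<lambda>r. y + r *\<^sub>R h) has_derivative (\<lambda>t. t *\<^sub>R h)) (at r within {-1..1})"
      by (auto intro!: derivative_eq_intros)
    then have "((\<lambda>r. g (y + r *\<^sub>R h)) has_derivative (\<lambda>t. g' (y + r *\<^sub>R h) (t *\<^sub>R h))) (at r within {-1..1})"
      using has_derivative_compose g by fast
    moreover have "g' (y + r *\<^sub>R h) (t *\<^sub>R h) = t *\<^sub>R g' (y + r *\<^sub>R h) h" for t
      by (rule linear_scale[OF has_derivative_linear[OF g]])
    ultimately show "((\<lambda>r. g (y + r *\<^sub>R h)) has_vector_derivative g' (y + r *\<^sub>R h) h) (at r within {-1..1})"
      by (simp add: has_vector_derivative_def)
  qed simp
  then have "g (y + 1 *\<^sub>R h) - g (y + (-1) *\<^sub>R h) \<le> (1 - (-1)) *\<^sub>R (c * A / 2) + 1 / (2 * c) * (LINT r|lborel. ?f r)"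
  proof (rule has_integral_le)
    show "((\<lambda>r. c * A / 2 + 1 / (2 * c) * Q (y + r *\<^sub>R h)) has_integral
        (1 - (-1)) *\<^sub>R (c * A / 2) + 1 / (2 * c) * (LINT r|lborel. ?f r)) {-1..1}"
      using has_integral_const_real[of "c * A / 2" "-1" 1] by (intro has_integral_add has_integral_mult_right HK) auto
    show "g' (y + r *\<^sub>R h) h \<le> c * A / 2 + 1 / (2 * c) * Q (y + r *\<^sub>R h)" if "r \<in> {-1..1}" for r
      using le[OF that] \<open>0 < c\<close> by (simp add: field_simps)
  qed
  then have "ennreal (g (y + h) - g (y - h)) \<le> ennreal (c * A + 1 / (2 * c) * (LINT r|lborel. ?f r))"
    by (intro ennreal_leI) simp
  also have "\<dots> = ennreal (c * A) + ennreal (1 / (2 * c)) * ennreal (LINT r|lborel. ?f r)"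
  proof -
    have "0 \<le> (LINT r|lborel. ?f r)" using Q0 by (intro Bochner_Integration.integral_nonneg) auto
    then have "ennreal (1 / (2 * c) * (LINT r|lborel. ?f r)) = ennreal (1 / (2 * c)) * ennreal (LINT r|lborel. ?f r)"
      using \<open>0 < c\<close> by (intro ennreal_mult) auto
    then show ?thesis using \<open>0 < c\<close> \<open>0 \<le> A\<close> \<open>0 \<le> (LINT r|lborel. ?f r)\<close> by (subst ennreal_plus) auto
  qed
  also have "ennreal (LINT r|lborel. ?f r) = (\<integral>\<^sup>+ r. ennreal (?f r) \<partial>lborel)"
    using Q0 by (intro nn_integral_eq_integral[symmetric] int) auto
  finally show ?thesis by (simp only: nn)
qed

text \<open>Averaging the bound along single segments over the kernel and exchanging the integrals
  leaves values of \<open>mollify \<rho> Q\<close> on the segment through \<open>z\<close>; its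
  Lipschitz constant replaces them by the value at \<open>z\<close>. In this form only the midpoint
  is seen, as Prekopa-Leindler demands.\<close>

lemma mollify_difference_le:
  fixes g :: "'a::euclidean_space \<Rightarrow> real"
  assumes \<rho>: "0 < \<rho>" and g_int: "integrable lborel g" and g: "\<And>x. (g has_derivative g' x) (at x)"
    and Q: "integrable lborel Q" "\<And>x. 0 \<le> Q x"
    and "0 < c" "0 \<le> A"
    and L: "\<And>x y::'a. \<bar>tent \<rho> x - tent \<rho> y\<bar> \<le> L * dist x y"
    and le: "\<And>w r. norm w < \<rho> \<Longrightarrow> r \<in> {-1..1} \<Longrightarrow>
      2 * g' (z + w + r *\<^sub>R h) h \<le> c * A + Q (z + w + r *\<^sub>R h) / c"
  shows "mollify \<rho> g (z + h) - mollify \<rho> g (z - h)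
    \<le> c * A + (mollify \<rho> Q z + L * norm h * (LINT y|lborel. Q y)) / c"
proof -
  have [measurable]: "Q \<in> borel_measurable borel" "g \<in> borel_measurable borel"
    using Q g_int by (auto dest: borel_measurable_integrable)
  note mQ [measurable] = mollify_measurable[OF \<rho> Q(1)]
  let ?E = "mollify \<rho> Q z + L * norm h * (LINT y|lborel. Q y)"
  have L0: "0 \<le> L"
  proof -
    obtain b :: 'a where "b \<in> Basis" using nonempty_Basis by blast
    then show ?thesis using L[of 0 b] abs_ge_zero[of "tent \<rho> 0 - tent \<rho> b"] by (simp add: dist_norm)
  qed
  have Qint: "0 \<le> (LINT y|lborel. Q y)" using Q by (intro Bochner_Integration.integral_nonneg) auto
  have E0: "0 \<le> ?E" using mollify_nonneg[OF \<rho> Q] L0 Qint by auto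
  have "mollify \<rho> g (z + h) - mollify \<rho> g (z - h) = (LINT w|lborel. tent \<rho> w * (g (z + w + h) - g (z + w - h)))"
    unfolding mollify_def
    by (subst Bochner_Integration.integral_diff[OF mollify_integrable[OF \<rho> g_int] mollify_integrable[OF \<rho> g_int], symmetric])
      (simp add: algebra_simps)
  \<comment> \<open>Only an upper bound is wanted, so the negative part of the integrand is
    discarded on passing to nonnegative integrals.\<close>
  also have "ennreal \<dots> \<le> (\<integral>\<^sup>+ w. ennreal (tent \<rho> w * (g (z + w + h) - g (z + w - h))) \<partial>lborel)"
  proof -
    let ?F = "\<lambda>w. tent \<rho> w * (g (z + w + h) - g (z + w - h))"
    have "integrable lborel (\<lambda>w. tent \<rho> w * g (z + h + w) - tent \<rho> w * g (z - h + w))"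
      using mollify_integrable[OF \<rho> g_int] by auto
    then have i: "integrable lborel ?F" by (simp add: algebra_simps)
    have "ennreal (LINT w|lborel. ?F w) \<le> ennreal (LINT w|lborel. max 0 (?F w))"
      by (intro ennreal_leI integral_mono i integrable_max integrable_zero max.cobounded2)
    also have "\<dots> = (\<integral>\<^sup>+ w. ennreal (max 0 (?F w)) \<partial>lborel)"
      by (intro nn_integral_eq_integral[symmetric] integrable_max integrable_zero i AE_I2 max.cobounded1)
    also have "\<dots> = (\<integral>\<^sup>+ w. ennreal (?F w) \<partial>lborel)" by (intro nn_integral_cong) (auto simp: max_def ennreal_neg)
    finally show ?thesis .
  qed
  also have "\<dots> \<le> (\<integral>\<^sup>+ w. ennreal (tent \<rho> w) * ennreal (c * A) + ennreal (1 / (2 * c)) *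
      (\<integral>\<^sup>+ r. ennreal (tent \<rho> w) * (indicator {-1..1} r * ennreal (Q (z + w + r *\<^sub>R h))) \<partial>lborel) \<partial>lborel)"
  proof (intro nn_integral_mono)
    fix w
    show "ennreal (tent \<rho> w * (g (z + w + h) - g (z + w - h)))
      \<le> ennreal (tent \<rho> w) * ennreal (c * A) + ennreal (1 / (2 * c)) *
      (\<integral>\<^sup>+ r. ennreal (tent \<rho> w) * (indicator {-1..1} r * ennreal (Q (z + w + r *\<^sub>R h))) \<partial>lborel)"
    proof (cases "norm w < \<rho>")
      case True
      have "ennreal (tent \<rho> w * (g (z + w + h) - g (z + w - h))) = ennreal (tent \<rho> w) * ennreal (g (z + w + h) - g (z + w - h))"
        by (rule ennreal_mult') (rule tent_nonneg[OF \<rho>])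
      also have "\<dots> \<le> ennreal (tent \<rho> w) * (ennreal (c * A)
          + ennreal (1 / (2 * c)) * (\<integral>\<^sup>+ r. indicator {-1..1} r * ennreal (Q (z + w + r *\<^sub>R h)) \<partial>lborel))"
        by (intro mult_left_mono difference_le_nn_integral[OF g] Q \<open>0 < c\<close> \<open>0 \<le> A\<close> le True) auto
      finally show ?thesis by (subst nn_integral_cmult) (auto simp: distrib_left mult_ac)
    qed (simp add: tent_eq_0)
  qed
  also have "\<dots> = ennreal (c * A) + ennreal (1 / (2 * c)) * (\<integral>\<^sup>+ w.
      (\<integral>\<^sup>+ r. ennreal (tent \<rho> w) * (indicator {-1..1} r * ennreal (Q (z + w + r *\<^sub>R h))) \<partial>lborel) \<partial>lborel)"
    by (subst nn_integral_add) (auto simp: nn_integral_cmult nn_integral_multc tent_nn_integral[OF \<rho>])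
  also have "(\<integral>\<^sup>+ w. (\<integral>\<^sup>+ r. ennreal (tent \<rho> w) * (indicator {-1..1} r * ennreal (Q (z + w + r *\<^sub>R h))) \<partial>lborel) \<partial>lborel)
     = (\<integral>\<^sup>+ r. (\<integral>\<^sup>+ w. ennreal (tent \<rho> w) * (indicator {-1..1} r * ennreal (Q (z + w + r *\<^sub>R h))) \<partial>lborel) \<partial>lborel)"
    by (rule lborel_pair.Fubini') measurable
  also have "\<dots> = (\<integral>\<^sup>+ r. indicator {-1..1} r * ennreal (mollify \<rho> Q (z + r *\<^sub>R h)) \<partial>lborel)"
  proof (intro nn_integral_cong)
    fix r :: real
    show "(\<integral>\<^sup>+ w. ennreal (tent \<rho> w) * (indicator {-1..1} r * ennreal (Q (z + w + r *\<^sub>R h))) \<partial>lborel)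
      = indicator {-1..1} r * ennreal (mollify \<rho> Q (z + r *\<^sub>R h))"
      using nn_integral_mollify[OF \<rho> Q, of "z + r *\<^sub>R h"]
      by (auto simp: indicator_def add.assoc add.commute[of "r *\<^sub>R h"])
  qed
  also have "\<dots> \<le> (\<integral>\<^sup>+ r. indicator {-1..1} r * ennreal ?E \<partial>(lborel :: real measure))"
  proof (intro nn_integral_mono)
    fix r :: real
    show "indicator {-1..1} r * ennreal (mollify \<rho> Q (z + r *\<^sub>R h)) \<le> indicator {-1..1} r * ennreal ?E"
    proof (cases "r \<in> {-1..1}")
      case True
      have "mollify \<rho> Q (z + r *\<^sub>R h) - mollify \<rho> Q z \<le> L * dist (z + r *\<^sub>R h) z * (LINT y|lborel. \<bar>Q y\<bar>)"
        using mollify_lipschitz[OF \<rho> Q(1) L] abs_ge_self order_trans by blast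
      also have "dist (z + r *\<^sub>R h) z \<le> norm h" using True mult_right_mono[of "\<bar>r\<bar>" 1 "norm h"]
        by (auto simp: dist_norm abs_le_iff)
      finally have "mollify \<rho> Q (z + r *\<^sub>R h) \<le> ?E" using L0 Qint Q(2)
        by (simp add: mult_right_mono mult_left_mono)
      then show ?thesis using True by (simp add: ennreal_leI)
    qed simp
  qed
  also have "\<dots> = 2 * ennreal ?E" by (subst nn_integral_multc) auto
  finally have "ennreal (mollify \<rho> g (z + h) - mollify \<rho> g (z - h)) \<le> ennreal (c * A) + ennreal (1 / (2 * c)) * (2 * ennreal ?E)"
    by (simp add: add_left_mono mult_left_mono)
  also have "ennreal (1 / (2 * c)) * (2 * ennreal ?E) = ennreal (1 / (2 * c) * (2 * ?E))"
  proof -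
    have "ennreal (1 / (2 * c) * (2 * ?E)) = ennreal (1 / (2 * c)) * ennreal (2 * ?E)"
      using \<open>0 < c\<close> E0 by (intro ennreal_mult) auto
    also have "ennreal (2 * ?E) = 2 * ennreal ?E" using E0 by (subst ennreal_mult) auto
    finally show ?thesis ..
  qed
  also have "1 / (2 * c) * (2 * ?E) = ?E / c" using \<open>0 < c\<close> by (simp add: field_simps)
  also have "ennreal (c * A) + ennreal (?E / c) = ennreal (c * A + ?E / c)"
    using \<open>0 < c\<close> \<open>0 \<le> A\<close> E0 by (subst ennreal_plus) auto
  finally show ?thesis using \<open>0 < c\<close> \<open>0 \<le> A\<close> E0 by (subst (asm) ennreal_le_iff) auto
qed

section \<open>Brascamp-Lieb for mollified, compactly supported and general test functions\<close>

section \<open>The Brascamp--Lieb inequality\<close>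

context smooth_log_concave
begin

definition dens :: "'a \<Rightarrow> real" where
  "dens x = (if x \<in> D then exp (- U x) else 0)"

lemma dens_nonneg: "0 \<le> dens x"
  by (simp add: dens_def)

end

locale smooth_log_concave_prob = smooth_log_concave +
  assumes dens_continuous: "continuous_on UNIV dens"
    and dens_integral: "(LINT x|lborel. dens x) = 1"
begin

lemma dens_measurable [measurable]: "dens \<in> borel_measurable borel"
  by (rule borel_measurable_continuous_onI[OF dens_continuous])

lemma dens_integrable: "integrable lborel dens"
  using dens_integral not_integrable_integral_eq by fastforce

abbreviation \<mu> :: "'a measure" where
  "\<mu> \<equiv> density lborel (\<lambda>x. ennreal (dens x))"

sublocale prob_space \<mu>
proof
  have "emeasure \<mu> (space \<mu>) = (\<integral>\<^sup>+ x. ennreal (dens x) \<partial>lborel)"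
    by (subst emeasure_density) auto
  also have "\<dots> = 1"
    using dens_integral dens_nonneg by (subst nn_integral_eq_integral) (auto simp: dens_integrable)
  finally show "emeasure \<mu> (space \<mu>) = 1" .
qed

lemma expectation_dens: "f \<in> borel_measurable borel \<Longrightarrow> expectation f = (LINT x|lborel. dens x * f x)" for f :: "'a \<Rightarrow> real"
  using dens_nonneg by (subst integral_density) auto

lemma ennreal_expectation:
  fixes f :: "'a \<Rightarrow> real"
  assumes [measurable]: "f \<in> borel_measurable borel" and f: "\<And>x. 0 \<le> f x" "\<And>x. f x \<le> b"
  shows "ennreal (expectation f) = (\<integral>\<^sup>+ x. ennreal (dens x * f x) \<partial>lborel)"
proof -
  have "integrable \<mu> f" by (rule integrable_const_bound[of _ b]) (use f in auto)
  then have "ennreal (expectation f) = (\<integral>\<^sup>+ x. ennreal (f x) \<partial>\<mu>)"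
    using f by (intro nn_integral_eq_integral[symmetric]) auto
  also have "\<dots> = (\<integral>\<^sup>+ x. ennreal (dens x * f x) \<partial>lborel)"
    by (subst nn_integral_density) (auto simp: ennreal_mult' dens_nonneg)
  finally show ?thesis .
qed

text \<open>For \<open>x = z + h\<close> and \<open>y = z - h\<close>, hypothesis \<open>le\<close>
  is the logarithm of the Prekopa-Leindler condition; if one of the points lies outside
  \<open>D\<close>, a density factor on the left vanishes.\<close>

lemma exp_moments_le:
  assumes [measurable]: "\<psi> \<in> borel_measurable borel" "\<Phi> \<in> borel_measurable borel"
    and bd: "\<And>x. \<bar>\<psi> x\<bar> \<le> b" "\<And>x. \<bar>\<Phi> x\<bar> \<le> b" and "0 < s"
    and le: "\<And>z h. z + h \<in> D \<Longrightarrow> z - h \<in> D \<Longrightarrow>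
      s * (\<psi> (z + h) - \<psi> (z - h)) \<le> U (z + h) + U (z - h) - 2 * U z + 2 * s\<^sup>2 * \<Phi> z"
  shows "expectation (\<lambda>x. exp (s * \<psi> x)) * expectation (\<lambda>x. exp (- s * \<psi> x))
    \<le> (expectation (\<lambda>x. exp (s\<^sup>2 * \<Phi> x)))\<^sup>2"
proof -
  have b: "exp (s * \<psi> x) \<le> exp (s * b)" "exp (- s * \<psi> x) \<le> exp (s * b)" "exp (s\<^sup>2 * \<Phi> x) \<le> exp (s\<^sup>2 * b)" for x
  proof -
    have "s * \<bar>\<psi> x\<bar> \<le> s * b" "s\<^sup>2 * \<Phi> x \<le> s\<^sup>2 * b"
      using bd(1)[of x] bd(2)[of x] \<open>0 < s\<close> by (auto intro!: mult_left_mono)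
    moreover have "s * \<psi> x \<le> s * \<bar>\<psi> x\<bar>" "- s * \<psi> x \<le> s * \<bar>\<psi> x\<bar>"
      using mult_left_mono[of "\<psi> x" "\<bar>\<psi> x\<bar>" s] mult_left_mono[of "- \<psi> x" "\<bar>\<psi> x\<bar>" s] \<open>0 < s\<close> by auto
    ultimately show "exp (s * \<psi> x) \<le> exp (s * b)" "exp (- s * \<psi> x) \<le> exp (s * b)" "exp (s\<^sup>2 * \<Phi> x) \<le> exp (s\<^sup>2 * b)"
      unfolding exp_le_cancel_iff by linarith+
  qed
  have e1: "ennreal (expectation (\<lambda>x. exp (s * \<psi> x))) = (\<integral>\<^sup>+ x. ennreal (dens x * exp (s * \<psi> x)) \<partial>lborel)"
    by (rule ennreal_expectation[OF _ _ b(1)]) auto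
  have e2: "ennreal (expectation (\<lambda>x. exp (- s * \<psi> x))) = (\<integral>\<^sup>+ x. ennreal (dens x * exp (- s * \<psi> x)) \<partial>lborel)"
    by (rule ennreal_expectation[OF _ _ b(2)]) auto
  have e3: "ennreal (expectation (\<lambda>x. exp (s\<^sup>2 * \<Phi> x))) = (\<integral>\<^sup>+ x. ennreal (dens x * exp (s\<^sup>2 * \<Phi> x)) \<partial>lborel)"
    by (rule ennreal_expectation[OF _ _ b(3)]) auto
  have "ennreal (expectation (\<lambda>x. exp (s * \<psi> x))) * ennreal (expectation (\<lambda>x. exp (- s * \<psi> x)))
    \<le> (ennreal (expectation (\<lambda>x. exp (s\<^sup>2 * \<Phi> x))))\<^sup>2"
    unfolding e1 e2 e3
  proof (rule prekopa_leindler)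
    fix x y :: 'a
    define z h where "z = (1/2) *\<^sub>R (x + y)" and "h = (1/2) *\<^sub>R (x - y)"
    have xy: "x = z + h" "y = z - h" unfolding z_def h_def
      by (simp_all add: scaleR_add_right scaleR_diff_right flip: scaleR_add_left)
    have "(dens x * exp (s * \<psi> x)) * (dens y * exp (- s * \<psi> y)) \<le> (dens z * exp (s\<^sup>2 * \<Phi> z))\<^sup>2"
    proof (cases "x \<in> D \<and> y \<in> D")
      case True
      then have z: "z \<in> D" using convexD[OF convex_D, of x y "1/2" "1/2"] by (simp add: z_def scaleR_add_right)
      have "s * (\<psi> x - \<psi> y) \<le> U x + U y - 2 * U z + 2 * s\<^sup>2 * \<Phi> z" unfolding xy using True xy by (intro le) auto
      then have "exp ((s * \<psi> x - U x) + (- s * \<psi> y - U y)) \<le> exp (2 * (s\<^sup>2 * \<Phi> z - U z))"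
        by (simp add: algebra_simps)
      moreover have e: "dens y * exp t = exp (t - U y)" if "y \<in> D" for y t
        using that by (simp add: dens_def exp_diff exp_minus divide_inverse)
      ultimately show ?thesis using True z by (simp only: e exp_add exp_double) 
    qed (auto simp: dens_def)
    then show "ennreal (dens x * exp (s * \<psi> x)) * ennreal (dens y * exp (- s * \<psi> y))
        \<le> (ennreal (dens ((1/2) *\<^sub>R (x + y)) * exp (s\<^sup>2 * \<Phi> ((1/2) *\<^sub>R (x + y)))))\<^sup>2"
      unfolding z_def[symmetric] by (simp add: dens_nonneg ennreal_mult[symmetric] ennreal_power ennreal_leI)
  qed measurable
  then have "ennreal (expectation (\<lambda>x. exp (s * \<psi> x)) * expectation (\<lambda>x. exp (- s * \<psi> x)))
    \<le> ennreal ((expectation (\<lambda>x. exp (s\<^sup>2 * \<Phi> x)))\<^sup>2)"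
    by (simp add: ennreal_mult' ennreal_power)
  then show ?thesis by (subst (asm) ennreal_le_iff) auto
qed

(* Since N x is quadratic, the condition on Q says that Q dominates the square of the gradient of g in
   the norm dual to N.  In the Prekopa-Leindler hypothesis at z + h and z - h: for z outside K1 both values
   of the mollified g vanish, for |h| <= delta the second difference of U is almost N z h and Q enters through
   the fundamental theorem of calculus, and for larger h that difference is at least of order delta^2,
   which exceeds s times the oscillation of g once s is small. *)
lemma brascamp_lieb_mollified:
  assumes K: "compact K" "K \<subseteq> D" and g: "\<And>x. (g has_derivative g' x) (at x)" and g0: "\<And>x. x \<notin> K \<Longrightarrow> g x = 0"
    and Q: "integrable lborel Q" "\<And>x. 0 \<le> Q x"
    and gQ: "\<And>x h. x \<in> D \<Longrightarrow> 2 * g' x h \<le> N x h + Q x"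
    and \<theta>: "0 < \<theta>" "\<theta> < 1" and \<eta>: "0 < \<eta>"
  shows "\<exists>\<rho>0>0. \<forall>\<rho>. 0 < \<rho> \<longrightarrow> \<rho> \<le> \<rho>0 \<longrightarrow>
    expectation (\<lambda>x. (mollify \<rho> g x)\<^sup>2) - (expectation (mollify \<rho> g))\<^sup>2
      \<le> (1 + \<theta>) / (1 - \<theta>) * (expectation (mollify \<rho> Q) + \<eta>)"
proof -
  have g_cont: "continuous_on UNIV g"
    by (intro continuous_at_imp_continuous_on ballI has_derivative_continuous[OF g])
  have g_int: "integrable lborel g" by (rule compact_support_integrable[OF g_cont K(1) g0])
  obtain b where b: "0 \<le> b" "\<And>x. \<bar>g x\<bar> \<le> b" using compact_support_bounded[OF g_cont K(1) g0] by blast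
  obtain \<rho>1 where \<rho>1: "0 < \<rho>1" "compact {x + w | x w. x \<in> K \<and> w \<in> cball 0 \<rho>1}"
    "{x + w | x w. x \<in> K \<and> w \<in> cball 0 \<rho>1} \<subseteq> D"
    using compact_enlargement[OF K(1) open_D K(2)] by blast
  define K' where "K' = {x + w | x w. x \<in> K \<and> w \<in> cball 0 \<rho>1}"
  have K': "compact K'" "K' \<subseteq> D" using \<rho>1 by (auto simp: K'_def)
  \<comment> \<open>All midpoints of a point of \<open>K'\<close> with a point of \<open>D\<close>,
    closed up to be compact. Since \<open>D\<close> is open and convex, midpoints of its points with
    points of its closure remain in \<open>D\<close>.\<close>
  define K1 where "K1 = (\<lambda>(x, y). (1/2) *\<^sub>R x + (1/2) *\<^sub>R y) ` (K' \<times> closure D)"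
  have K1: "compact K1" "K1 \<subseteq> D"
  proof -
    have "compact (closure D)" using bounded_D by (simp add: compact_closure)
    then show "compact K1" unfolding K1_def
      by (intro compact_continuous_image compact_Times K') (auto intro!: continuous_intros simp: split_beta)
    show "K1 \<subseteq> D"
    proof
      fix z assume "z \<in> K1"
      then obtain x y where xy: "x \<in> K'" "y \<in> closure D" "z = (1/2) *\<^sub>R x + (1/2) *\<^sub>R y" by (auto simp: K1_def)
      have "y - (1/2) *\<^sub>R (y - x) \<in> interior D"
        using xy K' open_D by (intro mem_interior_closure_convex_shrink convex_D) (auto simp: interior_open)
      moreover have "y - (1/2) *\<^sub>R (y - x) = z" unfolding xy(3)
        by (simp add: scaleR_diff_right algebra_simps) (metis scaleR_half_double add.commute scaleR_add_right)
      ultimately show "z \<in> D" using interior_subset by auto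
    qed
  qed
  obtain \<delta>0 where \<delta>0: "0 < \<delta>0" "\<And>z. z \<in> K1 \<Longrightarrow> cball z \<delta>0 \<subseteq> D"
    "\<And>z x h. z \<in> K1 \<Longrightarrow> x \<in> cball z \<delta>0 \<Longrightarrow> \<bar>N x h - N z h\<bar> \<le> \<theta> * N z h"
    using N_uniform[OF K1 \<theta>(1)] by blast
  obtain m where m: "0 < m" "\<And>z h. z \<in> K1 \<Longrightarrow> m * (norm h)\<^sup>2 \<le> N z h" using N_lower[OF K1] by blast
  have T: "(1 - \<theta>) * N z h \<le> U (z + h) + U (z - h) - 2 * U z" if "z \<in> K1" "norm h \<le> \<delta>0" for z h
  proof (rule second_difference_ge[OF \<delta>0(2)])
    fix x assume "x \<in> cball z \<delta>0"
    then show "(1 - \<theta>) * N z h \<le> N x h" using \<delta>0(3)[OF that(1), of x h] by (simp add: abs_le_iff algebra_simps)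
  qed (use that in auto)
  show ?thesis
  proof (intro exI[of _ "min \<rho>1 (\<delta>0 / 2)"] conjI allI impI)
    show "0 < min \<rho>1 (\<delta>0 / 2)" using \<rho>1 \<delta>0 by auto
    fix \<rho> :: real assume \<rho>: "0 < \<rho>" and "\<rho> \<le> min \<rho>1 (\<delta>0 / 2)"
    then have \<rho>le: "\<rho> \<le> \<rho>1" "\<rho> \<le> \<delta>0 / 2" by auto
    note [measurable] = mollify_measurable[OF \<rho> g_int] mollify_measurable[OF \<rho> Q(1)]
    obtain L where L: "0 \<le> L" "\<And>w::'a. tent \<rho> w \<le> L" "\<And>x y::'a. \<bar>tent \<rho> x - tent \<rho> y\<bar> \<le> L * dist x y"
      using tent_lipschitz[OF \<rho>] by blast
    define IQ where "IQ = (LINT y|lborel. Q y)"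
    have IQ: "0 \<le> IQ" unfolding IQ_def using Q by (intro Bochner_Integration.integral_nonneg) auto
    \<comment> \<open>\<open>\<delta>0 / 2\<close> leaves room for the kernel shift, itself at most
      \<open>\<delta>0 / 2\<close>; the other bound keeps the Lipschitz error
      \<open>L * \<delta> * IQ\<close> below \<eta>, with 1 added because \<open>L * IQ\<close> may
      be 0.\<close>
    define \<delta> where "\<delta> = min (\<delta>0 / 2) (\<eta> / (L * IQ + 1))"
    have LIQ: "0 < L * IQ + 1" using L IQ by (smt (verit) mult_nonneg_nonneg)
    have \<delta>: "0 < \<delta>" "\<delta> \<le> \<delta>0 / 2" "L * \<delta> * IQ \<le> \<eta>"
    proof -
      show "0 < \<delta>" using \<delta>0 \<eta> LIQ by (auto simp: \<delta>_def)
      show "\<delta> \<le> \<delta>0 / 2" unfolding \<delta>_def by (rule min.cobounded1)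
      have "\<delta> * (L * IQ) \<le> \<delta> * (L * IQ + 1)" using \<open>0 < \<delta>\<close> by simp
      also have "\<dots> \<le> \<eta> / (L * IQ + 1) * (L * IQ + 1)" using LIQ by (intro mult_right_mono) (auto simp: \<delta>_def)
      also have "\<dots> = \<eta>" using LIQ by simp
      finally show "L * \<delta> * IQ \<le> \<eta>" by (simp add: mult_ac)
    qed
    define \<psi> where "\<psi> = mollify \<rho> g"
    define \<kappa> where "\<kappa> = (1 + \<theta>) / (1 - \<theta>)"
    define \<Phi> where "\<Phi> z = \<kappa> * (mollify \<rho> Q z + \<eta>) / 2" for z
    have \<kappa>: "0 < \<kappa>" using \<theta> by (simp add: \<kappa>_def)
    have [measurable]: "\<psi> \<in> borel_measurable borel" "\<Phi> \<in> borel_measurable borel"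
      unfolding \<psi>_def \<Phi>_def by measurable
    have Q0: "0 \<le> mollify \<rho> Q z" for z by (rule mollify_nonneg[OF \<rho> Q])
    have \<Phi>0: "0 \<le> \<Phi> z" for z unfolding \<Phi>_def using \<kappa> Q0[of z] \<eta> by simp
    have QL: "mollify \<rho> Q z \<le> L * IQ" for z
    proof -
      have "mollify \<rho> Q z \<le> (LINT w|lborel. L * Q (z + w))"
        unfolding mollify_def using L Q
        by (intro integral_mono mollify_integrable[OF \<rho> Q(1)] integrable_mult_right integrable_lborel_translate mult_right_mono) auto
      also have "\<dots> = L * IQ" using integral_lborel_translate[of Q z] Q(1)
        by (auto simp: IQ_def dest: borel_measurable_integrable)
      finally show ?thesis .
    qed
    have \<psi>b: "\<bar>\<psi> x\<bar> \<le> b" for x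
      using mollify_near[OF \<rho> g_int, of x 0 b] b by (simp add: \<psi>_def)
    have \<psi>0: "\<psi> x = 0" if x: "x \<notin> K'" for x
    proof -
      have "g (x + w) = 0" if w: "norm w < \<rho>" for w
      proof (rule g0)
        show "x + w \<notin> K"
        proof
          assume "x + w \<in> K"
          then have "(x + w) + (- w) \<in> K'" unfolding K'_def using w \<rho>le
            by (intro CollectI exI[of _ "x + w"] exI[of _ "- w"]) auto
          with x show False by simp
        qed
      qed
      then show ?thesis using mollify_near[OF \<rho> g_int, of x 0 0] by (simp add: \<psi>_def)
    qed
    \<comment> \<open>For \<open>s \<le> s0\<close> the oscillation term, at most
      \<open>s * (2 * b + 1)\<close>, stays below
      \<open>(1 - \<theta>) * m * \<delta>\<^sup>2\<close>, a lower bound for second differences at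
      distance \<delta>.\<close>
    define s0 where "s0 = (1 - \<theta>) * m * \<delta>\<^sup>2 / (2 * b + 1)"
    have s0: "0 < s0" using \<theta> m \<delta> b by (simp add: s0_def)
    have main: "s * (\<psi> (z + h) - \<psi> (z - h)) \<le> U (z + h) + U (z - h) - 2 * U z + 2 * s\<^sup>2 * \<Phi> z"
      if s: "0 < s" "s \<le> s0" and zh: "z + h \<in> D" "z - h \<in> D" for s z h
    proof -
      have zD: "z \<in> D"
      proof -
        have "(1/2) *\<^sub>R (z + h) + (1/2) *\<^sub>R (z - h) \<in> D" using zh by (intro convexD[OF convex_D]) auto
        also have "(1/2) *\<^sub>R (z + h) + (1/2) *\<^sub>R (z - h) = z"
          by (simp add: scaleR_add_right scaleR_diff_right flip: scaleR_add_left)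
        finally show ?thesis .
      qed
      have pos: "0 \<le> 2 * s\<^sup>2 * \<Phi> z" using \<Phi>0 by simp
      show ?thesis
      proof (cases "z \<in> K1")
        case False
        have "\<psi> (z + h) = 0 \<and> \<psi> (z - h) = 0"
        proof (intro conjI \<psi>0 notI)
          have eq: "z = (1/2) *\<^sub>R (z + h) + (1/2) *\<^sub>R (z - h)" "z = (1/2) *\<^sub>R (z - h) + (1/2) *\<^sub>R (z + h)"
            by (simp_all add: scaleR_add_right scaleR_diff_right flip: scaleR_add_left)
          show False if "z + h \<in> K'"
          proof -
            have "z \<in> K1" unfolding K1_def using that zh closure_subset[of D]
              by (intro image_eqI[of _ _ "(z + h, z - h)"]) (use eq in auto)
            with False show False by simp
          qed
          show False if "z - h \<in> K'"
          proof -
            have "z \<in> K1" unfolding K1_def using that zh closure_subset[of D]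
              by (intro image_eqI[of _ _ "(z - h, z + h)"]) (use eq in auto)
            with False show False by simp
          qed
        qed
        then show ?thesis using second_difference_nonneg[OF zh] pos by simp
      next
        case z: True
        have N0: "0 \<le> N z h" by (rule N_nonneg[OF zD])
        show ?thesis
        proof (cases "norm h \<le> \<delta>")
          case True
          \<comment> \<open>The weight is fixed by
            \<open>s * c * (1 + \<theta>) = 1 - \<theta>\<close>: the quadratic term becomes the
            lower bound for the second difference, and the \<open>Q\<close> term becomes
            \<open>2 * s\<^sup>2 * \<Phi> z\<close>.\<close>
          define c where "c = 1 / (s * \<kappa>)"
          have c: "0 < c" using s \<kappa> by (simp add: c_def)
          have "\<psi> (z + h) - \<psi> (z - h) \<le> c * ((1 + \<theta>) * N z h) + (mollify \<rho> Q z + L * norm h * (LINT y|lborel. Q y)) / c"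
            unfolding \<psi>_def
          proof (rule mollify_difference_le[OF \<rho> g_int g Q c _ L(3)])
            show "0 \<le> (1 + \<theta>) * N z h" using N0 \<theta> by simp
            fix w :: 'a and r assume w: "norm w < \<rho>" and r: "r \<in> {-1..(1::real)}"
            have "norm (w + r *\<^sub>R h) \<le> norm w + \<bar>r\<bar> * norm h" using norm_triangle_ineq[of w "r *\<^sub>R h"] by simp
            also have "\<bar>r\<bar> * norm h \<le> 1 * \<delta>" using r True by (intro mult_mono) auto
            finally have "norm (w + r *\<^sub>R h) \<le> \<delta>0" using w \<rho>le \<delta> by simp
            then have x: "z + w + r *\<^sub>R h \<in> cball z \<delta>0"
              using norm_minus_commute[of z "z + (w + r *\<^sub>R h)"] by (simp add: dist_norm add.assoc)
            have xD: "z + w + r *\<^sub>R h \<in> D" using \<delta>0(2)[OF z] x by auto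
            let ?x = "z + w + r *\<^sub>R h"
            have lin: "g' ?x (c *\<^sub>R h) = c * g' ?x h"
              using linear_scale[OF has_derivative_linear[OF g[of ?x]], of c h] by simp
            \<comment> \<open>Testing the gradient bound with \<open>c *\<^sub>R h\<close> and
              dividing by \<open>c\<close> produces its weighted form, because \<open>N\<close> is
              quadratic.\<close>
            have "2 * g' ?x (c *\<^sub>R h) \<le> N ?x (c *\<^sub>R h) + Q ?x" by (rule gQ[OF xD])
            then have "c * (2 * g' ?x h) \<le> c * (c * N ?x h + Q ?x / c)"
              using N_scale[OF xD, of c h] c lin by (simp add: algebra_simps power2_eq_square)
            then have "2 * g' ?x h \<le> c * N ?x h + Q ?x / c" using c by simp
            also have "N ?x h \<le> (1 + \<theta>) * N z h" using \<delta>0(3)[OF z x, of h] by (simp add: abs_le_iff algebra_simps)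
            finally show "2 * g' ?x h \<le> c * ((1 + \<theta>) * N z h) + Q ?x / c" using c by (simp add: mult_left_mono)
          qed
          also have "\<dots> \<le> c * ((1 + \<theta>) * N z h) + (mollify \<rho> Q z + \<eta>) / c"
          proof -
            have "L * norm h * IQ \<le> L * \<delta> * IQ" using True L IQ by (intro mult_right_mono mult_left_mono) auto
            then show ?thesis using \<delta>(3) c by (simp add: IQ_def[symmetric] divide_right_mono)
          qed
          finally have "s * (\<psi> (z + h) - \<psi> (z - h)) \<le> s * (c * ((1 + \<theta>) * N z h) + (mollify \<rho> Q z + \<eta>) / c)"
            using s by (intro mult_left_mono) auto
          also have "s * (c * ((1 + \<theta>) * N z h) + (mollify \<rho> Q z + \<eta>) / c) = (1 - \<theta>) * N z h + 2 * s\<^sup>2 * \<Phi> z"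
          proof -
            have "s * c * (1 + \<theta>) = 1 - \<theta>" "s / c = s\<^sup>2 * \<kappa>"
              using s \<theta> \<kappa> by (simp_all add: c_def \<kappa>_def power2_eq_square)
            moreover have "s * (c * ((1 + \<theta>) * N z h) + (mollify \<rho> Q z + \<eta>) / c)
              = (s * c * (1 + \<theta>)) * N z h + s / c * (mollify \<rho> Q z + \<eta>)"
              unfolding distrib_left[of s] by (simp only: mult.assoc times_divide_eq_left times_divide_eq_right)
            ultimately show ?thesis by (simp only: \<Phi>_def)
          qed
          also have "(1 - \<theta>) * N z h \<le> U (z + h) + U (z - h) - 2 * U z"
            using True \<delta> \<delta>0 by (intro T z) auto
          finally show ?thesis by simp
        next
          case False
          define r where "r = \<delta> / norm h"
          have r: "0 \<le> r" "r \<le> 1" "norm (r *\<^sub>R h) = \<delta>" using False \<delta>(1) by (auto simp: r_def divide_le_eq_1)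
          have "\<psi> (z + h) - \<psi> (z - h) \<le> 2 * b + 1"
            using \<psi>b[of "z + h"] \<psi>b[of "z - h"] by linarith
          then have "s * (\<psi> (z + h) - \<psi> (z - h)) \<le> s * (2 * b + 1)" using s by (intro mult_left_mono) auto
          also have "\<dots> \<le> s0 * (2 * b + 1)" using s b by (intro mult_right_mono) auto
          also have "\<dots> = (1 - \<theta>) * (m * \<delta>\<^sup>2)" using b by (simp add: s0_def)
          also have "\<dots> \<le> (1 - \<theta>) * N z (r *\<^sub>R h)" using m(2)[OF z, of "r *\<^sub>R h"] \<theta> unfolding r(3) by (intro mult_left_mono) auto
          also have "\<dots> \<le> U (z + r *\<^sub>R h) + U (z - r *\<^sub>R h) - 2 * U z" using r \<delta> by (intro T z) auto
          also have "\<dots> \<le> U (z + h) + U (z - h) - 2 * U z" by (intro second_difference_mono zD zh r)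
          finally show ?thesis using pos by linarith
        qed
      qed
    qed
    define B where "B = max b (\<kappa> * (L * IQ + \<eta>) / 2)"
    have "expectation (\<lambda>x. (\<psi> x)\<^sup>2) - (expectation \<psi>)\<^sup>2 \<le> 2 * expectation \<Phi>"
    proof (rule variance_le_of_exp_moments[of \<psi> \<Phi> B s0])
      show "\<bar>\<psi> x\<bar> \<le> B" for x using \<psi>b[of x] by (simp add: B_def)
      show B\<Phi>: "\<bar>\<Phi> x\<bar> \<le> B" for x
      proof -
        have "\<Phi> x \<le> \<kappa> * (L * IQ + \<eta>) / 2" unfolding \<Phi>_def using QL[of x] \<kappa> by simp
        then show ?thesis using \<Phi>0[of x] by (simp add: B_def)
      qed
      fix s assume s: "0 < s" "s \<le> s0"
      show "expectation (\<lambda>x. exp (s * \<psi> x)) * expectation (\<lambda>x. exp (- s * \<psi> x)) \<le> (expectation (\<lambda>x. exp (s\<^sup>2 * \<Phi> x)))\<^sup>2"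
      proof (rule exp_moments_le[of _ _ B])
        show "\<bar>\<psi> x\<bar> \<le> B" for x using \<psi>b[of x] by (simp add: B_def)
      qed (use B\<Phi> main s in auto)
    qed (use s0 in auto)
    also have "2 * expectation \<Phi> = \<kappa> * (expectation (mollify \<rho> Q) + \<eta>)"
    proof -
      have "integrable \<mu> (mollify \<rho> Q)"
        by (rule integrable_const_bound[of _ "L * IQ"]) (use QL Q0 in auto)
      then show ?thesis unfolding \<Phi>_def using prob_space by (simp add: space_borel)
    qed
    finally show "expectation (\<lambda>x. (mollify \<rho> g x)\<^sup>2) - (expectation (mollify \<rho> g))\<^sup>2
      \<le> (1 + \<theta>) / (1 - \<theta>) * (expectation (mollify \<rho> Q) + \<eta>)" unfolding \<psi>_def \<kappa>_def .
  qed
qed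

text \<open>One \<open>e\<close> serves as \<theta>, as \<eta> and as tolerance in the uniform
  continuity of \<open>g\<close> and \<open>dens\<close>; the radius is chosen after it. Undoing the
  mollification of \<open>g\<close> costs \<open>2 * b * e\<close> for the second moment and the
  same for the squared mean. For \<open>Q\<close>, which is only integrable, it is undone through
  the continuity of the density.\<close>

lemma brascamp_lieb_compact_support:
  assumes K: "compact K" "K \<subseteq> D" and g: "\<And>x. (g has_derivative g' x) (at x)" and g0: "\<And>x. x \<notin> K \<Longrightarrow> g x = 0"
    and Q: "integrable lborel Q" "\<And>x. 0 \<le> Q x"
    and gQ: "\<And>x h. x \<in> D \<Longrightarrow> 2 * g' x h \<le> N x h + Q x"
  shows "expectation (\<lambda>x. (g x)\<^sup>2) - (expectation g)\<^sup>2 \<le> expectation Q"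
proof -
  have g_cont: "continuous_on UNIV g"
    by (intro continuous_at_imp_continuous_on ballI has_derivative_continuous[OF g])
  have g_int: "integrable lborel g" by (rule compact_support_integrable[OF g_cont K(1) g0])
  have [measurable]: "g \<in> borel_measurable borel" "Q \<in> borel_measurable borel"
    using g_int Q by (auto dest: borel_measurable_integrable)
  obtain b where b: "0 \<le> b" "\<And>x. \<bar>g x\<bar> \<le> b" using compact_support_bounded[OF g_cont K(1) g0] by blast
  have clD: "compact (closure D)" using bounded_D by (simp add: compact_closure)
  have dens0: "dens x = 0" if "x \<notin> closure D" for x
    using that closure_subset[of D] by (auto simp: dens_def)
  obtain B where B: "0 \<le> B" "\<And>x. \<bar>dens x\<bar> \<le> B" using compact_support_bounded[OF dens_continuous clD dens0] by blast
  define IQ where "IQ = (LINT y|lborel. Q y)"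
  have IQ: "0 \<le> IQ" unfolding IQ_def using Q by (intro Bochner_Integration.integral_nonneg) auto
  define Var where "Var = expectation (\<lambda>x. (g x)\<^sup>2) - (expectation g)\<^sup>2"
  have key: "Var \<le> (1 + e) / (1 - e) * (expectation Q + e * IQ + e) + 4 * b * e" if e: "0 < e" "e < 1" for e
  proof -
    obtain \<rho>0 where \<rho>0: "0 < \<rho>0" "\<And>\<rho>. 0 < \<rho> \<Longrightarrow> \<rho> \<le> \<rho>0 \<Longrightarrow>
       expectation (\<lambda>x. (mollify \<rho> g x)\<^sup>2) - (expectation (mollify \<rho> g))\<^sup>2
        \<le> (1 + e) / (1 - e) * (expectation (mollify \<rho> Q) + e)"
      using brascamp_lieb_mollified[OF K g g0 Q gQ e e(1)] by blast
    obtain d1 where d1: "0 < d1" "\<And>x w. norm w < d1 \<Longrightarrow> \<bar>g (x + w) - g x\<bar> \<le> e"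
      using compact_support_equicontinuous[OF g_cont K(1) g0 e(1)] by blast
    obtain d2 where d2: "0 < d2" "\<And>x w. norm w < d2 \<Longrightarrow> \<bar>dens (x + w) - dens x\<bar> \<le> e"
      using compact_support_equicontinuous[OF dens_continuous clD dens0 e(1)] by blast
    define \<rho> where "\<rho> = min \<rho>0 (min d1 d2)"
    have \<rho>: "0 < \<rho>" "\<rho> \<le> \<rho>0" "\<rho> \<le> d1" "\<rho> \<le> d2" using \<rho>0 d1 d2 by (auto simp: \<rho>_def)
    note [measurable] = mollify_measurable[OF \<rho>(1) g_int] mollify_measurable[OF \<rho>(1) Q(1)]
    let ?\<psi> = "mollify \<rho> g"
    have \<psi>b: "\<bar>?\<psi> x\<bar> \<le> b" for x using mollify_near[OF \<rho>(1) g_int, of x 0 b] b by simp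
    have near: "\<bar>?\<psi> x - g x\<bar> \<le> e" for x
      using mollify_near[OF \<rho>(1) g_int, of x "g x" e] d1(2) \<rho> by simp
    have int: "integrable \<mu> ?\<psi>" "integrable \<mu> g" "integrable \<mu> (\<lambda>x. (?\<psi> x)\<^sup>2)" "integrable \<mu> (\<lambda>x. (g x)\<^sup>2)"
      by (rule integrable_const_bound[of _ b] integrable_const_bound[of _ "b\<^sup>2"];
          use \<psi>b b in \<open>auto simp: abs_le_square_iff[symmetric]\<close>)+
    have absE: "\<bar>expectation f\<bar> \<le> c" if "integrable \<mu> f" "\<And>x. \<bar>f x\<bar> \<le> c" for f :: "'a \<Rightarrow> real" and c
    proof -
      have "\<bar>expectation f\<bar> \<le> expectation (\<lambda>x. \<bar>f x\<bar>)" by (rule integral_abs_bound)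
      also have "\<dots> \<le> c" using that by (intro integral_le_const integrable_abs) auto
      finally show ?thesis .
    qed
    have diff_sq: "\<bar>s\<^sup>2 - t\<^sup>2\<bar> \<le> 2 * b * e" if "\<bar>s\<bar> \<le> b" "\<bar>t\<bar> \<le> b" "\<bar>s - t\<bar> \<le> e" for s t :: real
    proof -
      have "\<bar>s\<^sup>2 - t\<^sup>2\<bar> = \<bar>s + t\<bar> * \<bar>s - t\<bar>" by (simp add: abs_mult[symmetric] power2_eq_square algebra_simps)
      also have "\<dots> \<le> (2 * b) * e" using that by (intro mult_mono) auto
      finally show ?thesis .
    qed
    have "\<bar>expectation (\<lambda>x. (?\<psi> x)\<^sup>2 - (g x)\<^sup>2)\<bar> \<le> 2 * b * e"
      using int by (intro absE diff_sq \<psi>b b near) auto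
    then have 1: "\<bar>expectation (\<lambda>x. (?\<psi> x)\<^sup>2) - expectation (\<lambda>x. (g x)\<^sup>2)\<bar> \<le> 2 * b * e" using int by simp
    have "\<bar>expectation (\<lambda>x. ?\<psi> x - g x)\<bar> \<le> e"
      using int by (intro absE near) auto
    then have "\<bar>expectation ?\<psi> - expectation g\<bar> \<le> e" using int by simp
    then have 2: "\<bar>(expectation ?\<psi>)\<^sup>2 - (expectation g)\<^sup>2\<bar> \<le> 2 * b * e"
      using int by (intro diff_sq absE \<psi>b b) auto
    have 3: "expectation (mollify \<rho> Q) \<le> expectation Q + e * IQ"
    proof -
      have "expectation (mollify \<rho> Q) = (LINT x|lborel. dens x * mollify \<rho> Q x)" by (rule expectation_dens) measurable
      also have "\<dots> = enn2real (\<integral>\<^sup>+ x. ennreal (dens x * mollify \<rho> Q x) \<partial>lborel)"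
        using dens_nonneg mollify_nonneg[OF \<rho>(1) Q] by (intro integral_eq_nn_integral) auto
      also have "\<dots> \<le> (LINT x|lborel. dens x * Q x) + e * IQ"
      proof (rule enn2real_leI)
        show "0 \<le> (LINT x|lborel. dens x * Q x) + e * IQ"
          using IQ e dens_nonneg Q by (intro add_nonneg_nonneg Bochner_Integration.integral_nonneg) auto
        show "(\<integral>\<^sup>+ x. ennreal (dens x * mollify \<rho> Q x) \<partial>lborel) \<le> ennreal ((LINT x|lborel. dens x * Q x) + e * IQ)"
          unfolding IQ_def
        proof (rule integral_mult_mollify_le[OF \<rho>(1) Q _ dens_nonneg])
          show "dens x \<le> B" for x using B(2)[of x] by (simp add: abs_le_iff)
          show "dens (x - w) \<le> dens x + e" if "norm w < \<rho>" for x w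
            using d2(2)[of "- w" x] that \<rho> by (simp add: abs_le_iff)
        qed (use e in auto)
      qed
      also have "(LINT x|lborel. dens x * Q x) = expectation Q" by (rule expectation_dens[symmetric]) measurable
      finally show ?thesis .
    qed
    have "Var \<le> expectation (\<lambda>x. (?\<psi> x)\<^sup>2) - (expectation ?\<psi>)\<^sup>2 + 4 * b * e"
      unfolding Var_def using 1 2 by linarith
    also have "expectation (\<lambda>x. (?\<psi> x)\<^sup>2) - (expectation ?\<psi>)\<^sup>2
        \<le> (1 + e) / (1 - e) * (expectation (mollify \<rho> Q) + e)" by (rule \<rho>0(2)[OF \<rho>(1,2)])
    also have "\<dots> \<le> (1 + e) / (1 - e) * (expectation Q + e * IQ + e)"
      using 3 e by (intro mult_left_mono) auto
    finally show ?thesis by simp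
  qed
  have "Var \<le> (1 + 0) / (1 - 0) * (expectation Q + 0 * IQ + 0) + 4 * b * 0"
  proof (rule tendsto_le[of "at_right 0"])
    show "((\<lambda>e. (1 + e) / (1 - e) * (expectation Q + e * IQ + e) + 4 * b * e) \<longlongrightarrow>
      (1 + 0) / (1 - 0) * (expectation Q + 0 * IQ + 0) + 4 * b * 0) (at_right 0)"
      by (intro tendsto_intros) auto
    have "\<forall>\<^sub>F e in at_right 0. 0 < e \<and> e < (1::real)"
      by (auto simp: eventually_at_right_field intro!: exI[of _ 1])
    then show "\<forall>\<^sub>F e in at_right 0. Var \<le> (1 + e) / (1 - e) * (expectation Q + e * IQ + e) + 4 * b * e"
      by eventually_elim (rule key, auto)
  qed auto
  then show ?thesis by (simp add: Var_def)
qed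

lemma integrable_dens_iff:
  fixes f :: "'a \<Rightarrow> real"
  shows "f \<in> borel_measurable borel \<Longrightarrow> integrable \<mu> f \<longleftrightarrow> integrable lborel (\<lambda>x. dens x * f x)"
  by (subst integrable_density) (auto simp: dens_nonneg)

lemma U_continuous: "continuous_on D U"
  using convex_U open_D by (intro convex_on_continuous)

lemma AE_in_D: "AE x in \<mu>. x \<in> D"
proof -
  have "AE x in lborel. 0 < ennreal (dens x) \<longrightarrow> x \<in> D" by (simp add: dens_def)
  then show ?thesis by (simp add: AE_density)
qed

text \<open>\<open>W\<close> has compact sublevel sets, and its derivative is bounded by the square
  root of \<open>\<nu> * N\<close>, so cutting off at height \<open>Suc k\<close> adds a gradient
  term of order \<open>1 / Suc k\<close>. \<open>R k\<close> is the resulting bound on the squared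
  dual norm; dominated convergence leads back to \<open>Q\<close>.\<close>

theorem brascamp_lieb:
  fixes W g Q :: "'a \<Rightarrow> real"
  assumes W: "\<And>x. x \<in> D \<Longrightarrow> (W has_derivative W' x) (at x)" "\<And>x. x \<in> D \<Longrightarrow> 0 \<le> W x"
    and W_compact: "\<And>k. compact {x \<in> D. W x \<le> k}"
    and W_N: "\<And>x h. x \<in> D \<Longrightarrow> (W' x h)\<^sup>2 \<le> \<nu> * N x h" and \<nu>: "0 \<le> \<nu>"
    and g: "\<And>x. x \<in> D \<Longrightarrow> (g has_derivative g' x) (at x)"
    and gQ: "\<And>x h. x \<in> D \<Longrightarrow> (g' x h)\<^sup>2 \<le> Q x * N x h"
    and Q0: "\<And>x. 0 \<le> Q x"
    and [measurable]: "g \<in> borel_measurable borel" "Q \<in> borel_measurable borel"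
    and int: "integrable \<mu> (\<lambda>x. (g x)\<^sup>2)" "integrable \<mu> Q"
  shows "expectation (\<lambda>x. (g x)\<^sup>2) - (expectation g)\<^sup>2 \<le> expectation Q"
proof -
  \<comment> \<open>Squaring makes the cut-off differentiable where it reaches zero.\<close>
  define G where "G k x = (if x \<in> D then g x * (max 0 (1 - W x / real (Suc k)))\<^sup>2 else 0)" for k x
  define R where "R k x = (sqrt (Q x) + 2 / real (Suc k) * (sqrt \<nu> * \<bar>g x\<bar>))\<^sup>2" for k x
  have [measurable]: "D \<in> sets borel" using open_D by simp
  have intg: "integrable \<mu> g"
    by (rule square_integrable_imp_integrable[OF _ int(1)]) measurable
  have intW: "W x / real (Suc k) \<ge> 0" if "x \<in> D" for x k using W(2)[OF that] by simp
  have Wc: "continuous_on D W"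
    using W(1) by (intro continuous_at_imp_continuous_on ballI) (auto intro: has_derivative_continuous)
  have [measurable]: "G k \<in> borel_measurable borel" for k
  proof -
    have "(\<lambda>x. if x \<in> D then W x else 0) \<in> borel_measurable borel"
      using Wc by (intro borel_measurable_continuous_on_if) auto
    then have "(\<lambda>x. if x \<in> D then g x * (max 0 (1 - (if x \<in> D then W x else 0) / real (Suc k)))\<^sup>2 else 0) \<in> borel_measurable borel"
      by measurable
    also have "(\<lambda>x. if x \<in> D then g x * (max 0 (1 - (if x \<in> D then W x else 0) / real (Suc k)))\<^sup>2 else 0) = G k"
      by (auto simp: G_def fun_eq_iff)
    finally show ?thesis .
  qed
  have [measurable]: "R k \<in> borel_measurable borel" for k unfolding R_def by measurable
  have G_le: "\<bar>G k x\<bar> \<le> \<bar>g x\<bar>" for k x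
  proof (cases "x \<in> D")
    case True
    have "(max 0 (1 - W x / real (Suc k)))\<^sup>2 \<le> 1\<^sup>2" using intW[OF True, of k] by (intro power_mono) auto
    then show ?thesis using True by (simp add: G_def abs_mult mult_left_le)
  qed (simp add: G_def)
  have R_le: "R k x \<le> 2 * Q x + 8 * \<nu> * (g x)\<^sup>2" for k x
  proof -
    have "R k x \<le> (sqrt (Q x) + 2 * (sqrt \<nu> * \<bar>g x\<bar>))\<^sup>2"
      unfolding R_def using \<nu> Q0 by (intro power_mono add_left_mono mult_right_mono) (auto simp: divide_le_eq)
    also have "\<dots> \<le> 2 * (sqrt (Q x))\<^sup>2 + 2 * (2 * (sqrt \<nu> * \<bar>g x\<bar>))\<^sup>2"
      using sum_squares_bound[of "sqrt (Q x)" "2 * (sqrt \<nu> * \<bar>g x\<bar>)"] by (simp add: power2_sum)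
    finally show ?thesis using \<nu> Q0 by (simp add: power_mult_distrib)
  qed
  have R0: "0 \<le> R k x" for k x by (simp add: R_def)
  have intR: "integrable \<mu> (R k)" for k
    by (rule Bochner_Integration.integrable_bound[of _ "\<lambda>x. 2 * Q x + 8 * \<nu> * (g x)\<^sup>2"])
      (use int R_le R0 Q0 \<nu> in auto)
  have step: "expectation (\<lambda>x. (G k x)\<^sup>2) - (expectation (G k))\<^sup>2 \<le> expectation (R k)" for k
  proof -
    define K where "K = {x \<in> D. W x \<le> real (Suc k)}"
    have K: "compact K" "K \<subseteq> D" unfolding K_def using W_compact by auto
    define m where "m x = max 0 (1 - W x / real (Suc k))" for x
    define \<chi>' where "\<chi>' x h = - (2 / real (Suc k)) * m x * W' x h" for x h
    define G' where "G' x h = (if x \<in> K then g' x h * (m x)\<^sup>2 + g x * \<chi>' x h else 0)" for x h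
    \<comment> \<open>The compactly supported case asks for integrability against Lebesgue measure.
      On \<open>K\<close> the density is bounded below, so there it follows from integrability under
      \<open>\<mu>\<close>.\<close>
    define Q' where "Q' x = (if x \<in> K then R k x else 0)" for x
    have m: "0 \<le> m x" "x \<in> D \<Longrightarrow> m x \<le> 1" for x using intW[of x k] by (auto simp: m_def)
    have G: "G k x = (if x \<in> D then g x * (m x)\<^sup>2 else 0)" for x by (simp add: G_def m_def)
    have mK: "m x = 0" if "x \<in> D" "x \<notin> K" for x
      using that by (auto simp: m_def K_def field_simps max_def)
    have G0: "G k x = 0" if "x \<notin> K" for x using that mK by (simp add: G)
    have sq_deriv: "((\<lambda>t. (max 0 (t::real))\<^sup>2) has_real_derivative 2 * max 0 t) (at t)" for t
    proof (cases t "0 :: real" rule: linorder_cases)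
      case less
      show ?thesis
        by (rule has_field_derivative_transform_within_open[of "\<lambda>_. 0" _ _ "{..<0}"]) (use less in auto)
    next
      case greater
      show ?thesis
        by (rule has_field_derivative_transform_within_open[of "\<lambda>t. t\<^sup>2" _ _ "{0<..}"])
          (use greater in \<open>auto intro!: derivative_eq_intros\<close>)
    next
      case equal
      have "((\<lambda>h::real. ((max 0 (0 + h))\<^sup>2 - (max 0 0)\<^sup>2) / h) \<longlongrightarrow> 0) (at 0)"
      proof (rule Lim_null_comparison)
        have "norm (((max 0 (0 + h))\<^sup>2 - (max 0 0)\<^sup>2) / h) \<le> \<bar>h\<bar>" for h :: real
          by (cases "h = 0") (auto simp: max_def power2_eq_square)
        then show "\<forall>\<^sub>F h in at 0. norm (((max 0 (0 + h))\<^sup>2 - (max 0 0)\<^sup>2) / h) \<le> \<bar>h::real\<bar>" by simp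
        show "(abs \<longlongrightarrow> (0::real)) (at 0)" by (rule tendsto_eq_intros refl | simp)+
      qed
      then show ?thesis using equal by (simp add: DERIV_def)
    qed
    have "expectation (\<lambda>x. (G k x)\<^sup>2) - (expectation (G k))\<^sup>2 \<le> expectation Q'"
    proof (rule brascamp_lieb_compact_support[OF K _ G0])
      show "(G k has_derivative G' x) (at x)" for x
      proof (cases "x \<in> D")
        case True
        have "((\<lambda>y. (max 0 (1 - W y / real (Suc k)))\<^sup>2) has_derivative (\<lambda>h. 2 * m x * (- (W' x h / real (Suc k))))) (at x)"
          unfolding m_def
          by (rule has_derivative_compose[OF _ sq_deriv[unfolded has_field_derivative_def]])
            (auto intro!: derivative_eq_intros W(1) True)
        then have "((\<lambda>y. g y * (m y)\<^sup>2) has_derivative (\<lambda>h. g x * (2 * m x * (- (W' x h / real (Suc k)))) + g' x h * (m x)\<^sup>2)) (at x)"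
          unfolding m_def by (rule has_derivative_mult[OF g[OF True]])
        then have "((\<lambda>y. g y * (m y)\<^sup>2) has_derivative G' x) (at x)"
        proof (rule back_subst[of "\<lambda>F. (_ has_derivative F) _"])
          show "(\<lambda>h. g x * (2 * m x * (- (W' x h / real (Suc k)))) + g' x h * (m x)\<^sup>2) = G' x"
            using mK[OF True] by (auto simp: G'_def \<chi>'_def fun_eq_iff)
        qed
        then show ?thesis
          by (rule has_derivative_transform_within_open[OF _ open_D True]) (simp add: G)
      next
        case False
        have "open (- K)" using K by (simp add: open_Compl compact_imp_closed)
        have "((\<lambda>_. 0) has_derivative G' x) (at x)"
        proof -
          have "G' x = (\<lambda>_. 0)" using False K by (auto simp: G'_def fun_eq_iff)
          then show ?thesis by simp
        qed
        then show ?thesis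
          by (rule has_derivative_transform_within_open[OF _ \<open>open (- K)\<close>]) (use False K G0 in auto)
      qed
      show "0 \<le> Q' x" for x by (simp add: Q'_def R0)
      show "2 * G' x h \<le> N x h + Q' x" if x: "x \<in> D" for x h
      proof (cases "x \<in> K")
        case True
        have N0: "0 \<le> N x h" by (rule N_nonneg[OF x])
        have 1: "\<bar>g' x h\<bar> \<le> sqrt (Q x) * sqrt (N x h)"
          using gQ[OF x, of h] by (metis real_sqrt_abs real_sqrt_le_mono real_sqrt_mult)
        have 2: "\<bar>W' x h\<bar> \<le> sqrt \<nu> * sqrt (N x h)"
          using W_N[OF x, of h] by (metis real_sqrt_abs real_sqrt_le_mono real_sqrt_mult)
        have "(m x)\<^sup>2 \<le> 1\<^sup>2" using m x by (intro power_mono) auto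
        then have "\<bar>g' x h * (m x)\<^sup>2\<bar> \<le> \<bar>g' x h\<bar>" by (simp add: abs_mult mult_left_le)
        moreover have "\<bar>g x * \<chi>' x h\<bar> \<le> \<bar>g x\<bar> * (2 / real (Suc k) * 1 * \<bar>W' x h\<bar>)"
          unfolding \<chi>'_def abs_mult using m x by (intro mult_left_mono mult_mono) auto
        moreover have "\<bar>g x\<bar> * (2 / real (Suc k) * 1 * \<bar>W' x h\<bar>) \<le> \<bar>g x\<bar> * (2 / real (Suc k) * 1 * (sqrt \<nu> * sqrt (N x h)))"
          using 2 by (intro mult_left_mono) auto
        ultimately have "g' x h * (m x)\<^sup>2 + g x * \<chi>' x h \<le> sqrt (Q x) * sqrt (N x h) + \<bar>g x\<bar> * (2 / real (Suc k) * 1 * (sqrt \<nu> * sqrt (N x h)))"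
          using 1 abs_ge_self[of "g' x h * (m x)\<^sup>2"] abs_ge_self[of "g x * \<chi>' x h"] by linarith
        then have "G' x h \<le> sqrt (Q x) * sqrt (N x h) + \<bar>g x\<bar> * (2 / real (Suc k) * 1 * (sqrt \<nu> * sqrt (N x h)))"
          using True by (simp only: G'_def if_True)
        also have "\<dots> = sqrt (R k x) * sqrt (N x h)"
          unfolding R_def using Q0 \<nu> by (simp add: algebra_simps add_nonneg_nonneg)
        finally have "2 * G' x h \<le> 2 * (sqrt (R k x) * sqrt (N x h))" by simp
        also have "\<dots> \<le> R k x + N x h"
          using sum_squares_bound[of "sqrt (R k x)" "sqrt (N x h)"] R0 N0 by simp
        finally show ?thesis using True by (simp add: Q'_def)
      qed (use N_nonneg[OF x] in \<open>simp add: G'_def Q'_def\<close>)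
      have [measurable]: "K \<in> sets borel" using K by (simp add: compact_imp_closed borel_closed)
      show "integrable lborel Q'"
      proof (cases "K = {}")
        case False
        have "continuous_on K U" by (rule continuous_on_subset[OF U_continuous K(2)])
        then obtain x0 where x0: "x0 \<in> K" "\<And>x. x \<in> K \<Longrightarrow> U x \<le> U x0"
          using continuous_attains_sup[OF K(1) False] by blast
        define c where "c = exp (- U x0)"
        have c: "0 < c" "\<And>x. x \<in> K \<Longrightarrow> c \<le> dens x" using x0 K by (auto simp: c_def dens_def)
        have "integrable lborel (\<lambda>x. dens x * R k x)" using intR[of k] by (subst (asm) integrable_dens_iff) auto
        then have "integrable lborel (\<lambda>x. 1 / c * (dens x * R k x))" by simp
        then show ?thesis
        proof (rule Bochner_Integration.integrable_bound)
          show "Q' \<in> borel_measurable lborel" unfolding Q'_def by measurable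
          have "Q' x \<le> 1 / c * (dens x * R k x)" for x
          proof (cases "x \<in> K")
            case True
            have "c * R k x \<le> dens x * R k x" using c True R0 by (intro mult_right_mono) auto
            then show ?thesis using True c by (simp add: Q'_def field_simps)
          qed (use c R0 dens_nonneg in \<open>auto simp: Q'_def\<close>)
          then show "AE x in lborel. norm (Q' x) \<le> norm (1 / c * (dens x * R k x))"
            using R0 c dens_nonneg by (auto simp: Q'_def abs_mult)
        qed
      next
        case True
        then have "Q' = (\<lambda>_. 0)" by (simp add: Q'_def fun_eq_iff)
        then show ?thesis by simp
      qed
    qed
    also have "expectation Q' \<le> expectation (R k)"
    proof (rule integral_mono_AE')
      show "integrable \<mu> (R k)" by (rule intR)
    qed (auto simp: Q'_def R0)
    finally show ?thesis .
  qed
  have lim0: "(\<lambda>k. c / real (Suc k)) \<longlonglongrightarrow> 0" for c :: real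
    using LIMSEQ_Suc[OF lim_const_over_n[of c]] by simp
  have Glim: "(\<lambda>k. G k x) \<longlonglongrightarrow> g x" if "x \<in> D" for x
  proof -
    have "(\<lambda>k. g x * (max 0 (1 - W x / real (Suc k)))\<^sup>2) \<longlonglongrightarrow> g x * (max 0 (1 - 0))\<^sup>2"
      by (intro tendsto_intros lim0)
    then show ?thesis using that by (simp add: G_def)
  qed
  have Rlim: "(\<lambda>k. R k x) \<longlonglongrightarrow> Q x" for x
  proof -
    have "(\<lambda>k. (sqrt (Q x) + 2 / real (Suc k) * (sqrt \<nu> * \<bar>g x\<bar>))\<^sup>2) \<longlonglongrightarrow> (sqrt (Q x) + 0 * (sqrt \<nu> * \<bar>g x\<bar>))\<^sup>2"
      by (intro tendsto_intros lim0)
    then show ?thesis using Q0 by (simp add: R_def)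
  qed
  have "(\<lambda>k. expectation (\<lambda>x. (G k x)\<^sup>2)) \<longlonglongrightarrow> expectation (\<lambda>x. (g x)\<^sup>2)"
  proof (rule integral_dominated_convergence[where w = "\<lambda>x. (g x)\<^sup>2"])
    show "AE x in \<mu>. (\<lambda>k. (G k x)\<^sup>2) \<longlonglongrightarrow> (g x)\<^sup>2"
      using AE_in_D by eventually_elim (intro tendsto_intros Glim)
    show "AE x in \<mu>. norm ((G k x)\<^sup>2) \<le> (g x)\<^sup>2" for k
      using G_le by (auto simp: abs_le_square_iff[symmetric])
  qed (use int in auto)
  moreover have "(\<lambda>k. expectation (G k)) \<longlonglongrightarrow> expectation g"
  proof (rule integral_dominated_convergence[where w = "\<lambda>x. \<bar>g x\<bar>"])
    show "AE x in \<mu>. (\<lambda>k. G k x) \<longlonglongrightarrow> g x"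
      using AE_in_D by eventually_elim (rule Glim)
  qed (use intg G_le in auto)
  moreover have "(\<lambda>k. expectation (R k)) \<longlonglongrightarrow> expectation Q"
  proof (rule integral_dominated_convergence[where w = "\<lambda>x. 2 * Q x + 8 * \<nu> * (g x)\<^sup>2"])
    show "AE x in \<mu>. norm (R k x) \<le> 2 * Q x + 8 * \<nu> * (g x)\<^sup>2" for k
      using R_le R0 by auto
  qed (use int Rlim in auto)
  ultimately show ?thesis
    by (intro LIMSEQ_le[of "\<lambda>k. expectation (\<lambda>x. (G k x)\<^sup>2) - (expectation (G k))\<^sup>2" _ "\<lambda>k. expectation (R k)"])
      (auto intro!: tendsto_intros step)
qed

end

section \<open>Total variation from the Hellinger affinity and from the second moment of the density
  ratio\<close>

section \<open>Total variation bounds\<close>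

lemma Cauchy_Schwarz_integral:
  fixes f g :: "'a \<Rightarrow> real"
  assumes [measurable]: "f \<in> borel_measurable M" "g \<in> borel_measurable M"
    and int: "integrable M (\<lambda>x. (f x)\<^sup>2)" "integrable M (\<lambda>x. (g x)\<^sup>2)"
  shows "(LINT x|M. \<bar>f x * g x\<bar>)\<^sup>2 \<le> (LINT x|M. (f x)\<^sup>2) * (LINT x|M. (g x)\<^sup>2)"
proof -
  have i: "integrable M (\<lambda>x. \<bar>f x * g x\<bar>)"
  proof (rule Bochner_Integration.integrable_bound)
    show "integrable M (\<lambda>x. (f x)\<^sup>2 + (g x)\<^sup>2)" using int by auto
    have "\<bar>f x * g x\<bar> \<le> (f x)\<^sup>2 + (g x)\<^sup>2" for x
    proof -
      have "2 * \<bar>f x * g x\<bar> \<le> (f x)\<^sup>2 + (g x)\<^sup>2"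
        using sum_squares_bound[of "\<bar>f x\<bar>" "\<bar>g x\<bar>"] by (simp add: abs_mult mult.assoc)
      then show ?thesis using abs_ge_zero[of "f x * g x"] by linarith
    qed
    then show "AE x in M. norm \<bar>f x * g x\<bar> \<le> norm ((f x)\<^sup>2 + (g x)\<^sup>2)" by auto
  qed measurable
  have "ennreal ((LINT x|M. \<bar>f x * g x\<bar>)\<^sup>2) = (\<integral>\<^sup>+ x. ennreal \<bar>f x * g x\<bar> \<partial>M)\<^sup>2"
    using i by (subst nn_integral_eq_integral) (auto simp: ennreal_power)
  also have "\<dots> = (\<integral>\<^sup>+ x. ennreal \<bar>f x\<bar> * ennreal \<bar>g x\<bar> \<partial>M)\<^sup>2"
    by (simp add: abs_mult ennreal_mult)
  also have "\<dots> \<le> (\<integral>\<^sup>+ x. (ennreal \<bar>f x\<bar>)\<^sup>2 \<partial>M) * (\<integral>\<^sup>+ x. (ennreal \<bar>g x\<bar>)\<^sup>2 \<partial>M)"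
    by (rule Cauchy_Schwarz_nn_integral) measurable
  also have "\<dots> = ennreal (LINT x|M. (f x)\<^sup>2) * ennreal (LINT x|M. (g x)\<^sup>2)"
    using int by (simp add: ennreal_power nn_integral_eq_integral)
  also have "\<dots> = ennreal ((LINT x|M. (f x)\<^sup>2) * (LINT x|M. (g x)\<^sup>2))" by (simp add: ennreal_mult)
  finally show ?thesis by (subst (asm) ennreal_le_iff) auto
qed

lemma measure_density_integral:
  fixes p :: "'a \<Rightarrow> real"
  assumes [measurable]: "integrable M p" and "\<And>x. 0 \<le> p x" and [measurable]: "A \<in> sets M"
  shows "measure (density M (\<lambda>x. ennreal (p x))) A = (LINT x|M. indicator A x * p x)"
proof -
  have "emeasure (density M (\<lambda>x. ennreal (p x))) A = (\<integral>\<^sup>+ x. ennreal (p x) * indicator A x \<partial>M)"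
    by (rule emeasure_density) auto
  also have "\<dots> = (\<integral>\<^sup>+ x. ennreal (indicator A x * p x) \<partial>M)"
    by (intro nn_integral_cong) (auto simp: indicator_def)
  also have "\<dots> = ennreal (LINT x|M. indicator A x * p x)"
    using assms integrable_real_mult_indicator[OF assms(3,1)]
    by (intro nn_integral_eq_integral) (auto simp: mult.commute)
  finally show ?thesis using assms by (simp add: measure_def)
qed

text \<open>Equal masses make the integrals of \<open>p - q\<close> over \<open>A\<close> and over
  its complement opposite numbers, so each carries at most half of the L1 distance.\<close>

lemma abs_measure_density_diff_le:
  fixes p q :: "'a \<Rightarrow> real"
  assumes p: "integrable M p" "\<And>x. 0 \<le> p x" and q: "integrable M q" "\<And>x. 0 \<le> q x"
    and eq: "(LINT x|M. p x) = (LINT x|M. q x)" and A [measurable]: "A \<in> sets M"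
  shows "2 * \<bar>measure (density M (\<lambda>x. ennreal (p x))) A - measure (density M (\<lambda>x. ennreal (q x))) A\<bar>
    \<le> (LINT x|M. \<bar>p x - q x\<bar>)"
proof -
  let ?I = "LINT x|M. indicator A x * (p x - q x)" and ?J = "LINT x|M. indicator (space M - A) x * (p x - q x)"
  have ind: "integrable M (\<lambda>x. indicator B x * f x)" if "B \<in> sets M" "integrable M f" for B and f :: "'a \<Rightarrow> real"
    using integrable_real_mult_indicator[OF that] by (simp add: mult.commute)
  have i: "integrable M (\<lambda>x. p x - q x)" using p q by auto
  have "?I + ?J = (LINT x|M. indicator A x * (p x - q x) + indicator (space M - A) x * (p x - q x))"
    using i by (intro Bochner_Integration.integral_add[symmetric] ind) auto
  also have "\<dots> = (LINT x|M. p x - q x)"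
    by (intro Bochner_Integration.integral_cong) (auto simp: indicator_def)
  also have "\<dots> = 0" using p q eq by simp
  finally have "2 * \<bar>?I\<bar> = \<bar>?I\<bar> + \<bar>?J\<bar>" by linarith
  also have "\<dots> \<le> (LINT x|M. \<bar>indicator A x * (p x - q x)\<bar>) + (LINT x|M. \<bar>indicator (space M - A) x * (p x - q x)\<bar>)"
    by (intro add_mono integral_abs_bound)
  also have "\<dots> = (LINT x|M. \<bar>indicator A x * (p x - q x)\<bar> + \<bar>indicator (space M - A) x * (p x - q x)\<bar>)"
    using i by (intro Bochner_Integration.integral_add[symmetric] integrable_abs ind) auto
  also have "\<dots> = (LINT x|M. \<bar>p x - q x\<bar>)"
    by (intro Bochner_Integration.integral_cong) (auto simp: indicator_def)
  finally have "2 * \<bar>?I\<bar> \<le> (LINT x|M. \<bar>p x - q x\<bar>)" .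
  moreover have "?I = (LINT x|M. indicator A x * p x) - (LINT x|M. indicator A x * q x)"
    using ind[OF A p(1)] ind[OF A q(1)] by (simp add: right_diff_distrib)
  ultimately show ?thesis by (simp add: measure_density_integral[OF p A] measure_density_integral[OF q A])
qed

text \<open>Cauchy-Schwarz on the product of the difference and the sum of the square roots: for
  affinity \<open>B\<close> their squared norms are \<open>2 - 2 * B\<close> and
  \<open>2 + 2 * B\<close>. Keeping the second factor yields \<open>1 - B\<^sup>2\<close>, which
  fits Prekopa-Leindler, a bound on the square of the affinity.\<close>

lemma integral_abs_diff_le_hellinger:
  fixes p q :: "'a \<Rightarrow> real"
  assumes p: "integrable M p" "\<And>x. 0 \<le> p x" "(LINT x|M. p x) = 1"
    and q: "integrable M q" "\<And>x. 0 \<le> q x" "(LINT x|M. q x) = 1"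
  shows "(LINT x|M. \<bar>p x - q x\<bar>)\<^sup>2 \<le> 4 * (1 - (LINT x|M. sqrt (p x) * sqrt (q x))\<^sup>2)"
proof -
  have [measurable]: "p \<in> borel_measurable M" "q \<in> borel_measurable M" using p q by auto
  have i: "integrable M (\<lambda>x. sqrt (p x) * sqrt (q x))"
  proof (rule Bochner_Integration.integrable_bound)
    show "integrable M (\<lambda>x. p x + q x)" using p q by auto
    have "sqrt (p x) * sqrt (q x) \<le> p x + q x" for x
      using sum_squares_bound[of "sqrt (p x)" "sqrt (q x)"] p(2)[of x] q(2)[of x]
      by simp
    then show "AE x in M. norm (sqrt (p x) * sqrt (q x)) \<le> norm (p x + q x)"
      using p q by (auto simp: abs_mult)
  qed measurable
  let ?B = "LINT x|M. sqrt (p x) * sqrt (q x)"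
  have sq: "(sqrt (p x) - sqrt (q x))\<^sup>2 = p x + q x - 2 * (sqrt (p x) * sqrt (q x))"
    "(sqrt (p x) + sqrt (q x))\<^sup>2 = p x + q x + 2 * (sqrt (p x) * sqrt (q x))" for x
    using p q by (simp_all add: power2_sum power2_diff)
  have "\<bar>p x - q x\<bar> = \<bar>(sqrt (p x) - sqrt (q x)) * (sqrt (p x) + sqrt (q x))\<bar>" for x
    using p(2)[of x] q(2)[of x] by (simp add: algebra_simps)
  then have "(LINT x|M. \<bar>p x - q x\<bar>)\<^sup>2 = (LINT x|M. \<bar>(sqrt (p x) - sqrt (q x)) * (sqrt (p x) + sqrt (q x))\<bar>)\<^sup>2"
    by simp
  also have "\<dots> \<le> (LINT x|M. (sqrt (p x) - sqrt (q x))\<^sup>2) * (LINT x|M. (sqrt (p x) + sqrt (q x))\<^sup>2)"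
    using p q i by (intro Cauchy_Schwarz_integral) (auto simp: sq)
  also have "\<dots> = (2 - 2 * ?B) * (2 + 2 * ?B)" using p q i by (simp add: sq)
  finally show ?thesis by (simp add: algebra_simps power2_eq_square)
qed

context smooth_log_concave_prob
begin

lemma hellinger_affinity_uniform:
  assumes a: "0 \<le> a" and mid: "\<And>x y. x \<in> D \<Longrightarrow> y \<in> D \<Longrightarrow> U ((1/2) *\<^sub>R (x + y)) \<le> U y + a * ln 2"
  shows "exp (- (a * ln 2)) * measure lborel D \<le> (LINT x|lborel. sqrt (dens x))\<^sup>2"
proof -
  have fin: "emeasure lborel D < \<infinity>" using bounded_D by (rule emeasure_bounded_finite)
  have [measurable]: "D \<in> sets borel" using open_D by simp
  \<comment> \<open>\<open>c\<^sup>2\<close> is 2 to the power \<open>a\<close>, the factor lost in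
    \<open>mid\<close>; the square in the Prekopa-Leindler condition turns
    \<open>sqrt (dens ?z)\<close> back into the density.\<close>
  define c where "c = exp (a * ln 2 / 2)"
  have c2: "c\<^sup>2 = exp (a * ln 2)" unfolding c_def exp_double[symmetric] by simp
  have sq: "integrable lborel (\<lambda>x. sqrt (dens x))"
  proof (rule Bochner_Integration.integrable_bound)
    show "integrable lborel (\<lambda>x. indicator D x + dens x)"
      using fin dens_integrable by (intro Bochner_Integration.integrable_add integrable_real_indicator) auto
    have "sqrt t \<le> 1 + t" if "0 \<le> t" for t :: real
      using that by (intro real_le_lsqrt) (auto simp: power2_eq_square algebra_simps)
    then have "sqrt (dens x) \<le> indicator D x + dens x" for x
      using dens_nonneg[of x] by (auto simp: indicator_def dens_def)
    then show "AE x in lborel. norm (sqrt (dens x)) \<le> norm (indicator D x + dens x)"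
      using dens_nonneg by (auto simp: indicator_def)
  qed measurable
  have "(\<integral>\<^sup>+ x. indicator D x \<partial>lborel) * (\<integral>\<^sup>+ x. ennreal (dens x) \<partial>lborel) \<le> (\<integral>\<^sup>+ x. ennreal (c * sqrt (dens x)) \<partial>lborel)\<^sup>2"
  proof (rule prekopa_leindler)
    fix x y :: 'a
    let ?z = "(1/2) *\<^sub>R (x + y)"
    show "indicator D x * ennreal (dens y) \<le> (ennreal (c * sqrt (dens ?z)))\<^sup>2"
    proof (cases "x \<in> D \<and> y \<in> D")
      case True
      then have z: "?z \<in> D" using convexD[OF convex_D, of x y "1/2" "1/2"] by (simp add: scaleR_add_right)
      have "exp (- U y) \<le> exp (a * ln 2 + - U ?z)" using mid[of x y] True by simp
      also have "\<dots> = (c * sqrt (dens ?z))\<^sup>2"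
        unfolding power_mult_distrib c2 using z dens_nonneg[of ?z] by (simp add: dens_def exp_add[symmetric])
      finally show ?thesis using True dens_nonneg
        by (simp add: dens_def ennreal_power c_def ennreal_leI)
    qed (auto simp: dens_def)
  qed measurable
  also have "(\<integral>\<^sup>+ x. ennreal (c * sqrt (dens x)) \<partial>lborel) = ennreal (c * (LINT x|lborel. sqrt (dens x)))"
    using sq dens_nonneg by (subst nn_integral_eq_integral) (auto simp: c_def)
  also have "(\<integral>\<^sup>+ x. ennreal (dens x) \<partial>lborel) = 1"
    using dens_integral dens_nonneg dens_integrable by (subst nn_integral_eq_integral) auto
  also have "(\<integral>\<^sup>+ x. indicator D x \<partial>lborel) = ennreal (measure lborel D)"
    using fin by (simp add: emeasure_eq_ennreal_measure less_top)
  finally have "ennreal (measure lborel D) \<le> ennreal ((c * (LINT x|lborel. sqrt (dens x)))\<^sup>2)"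
    using dens_nonneg by (subst (asm) ennreal_power) (auto simp: c_def intro!: mult_nonneg_nonneg Bochner_Integration.integral_nonneg)
  then have "measure lborel D \<le> (c * (LINT x|lborel. sqrt (dens x)))\<^sup>2" by (subst (asm) ennreal_le_iff) auto
  also have "\<dots> = exp (a * ln 2) * (LINT x|lborel. sqrt (dens x))\<^sup>2"
    by (simp add: c_def power_mult_distrib exp_double[symmetric])
  finally show ?thesis by (simp add: exp_minus field_simps)
qed

lemma measure_D_pos: "0 < measure lborel D"
proof -
  have fin: "emeasure lborel D < \<infinity>" using bounded_D by (rule emeasure_bounded_finite)
  have "D \<noteq> {}" using dens_integral by (auto simp: dens_def)
  then obtain x e where xe: "0 < e" "ball x e \<subseteq> D" using open_D by (meson openE ex_in_conv)
  have "0 < measure lborel (ball x e)" using xe by (simp add: content_ball_pos)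
  also have "\<dots> \<le> measure lborel D"
    using xe fin open_D by (intro measure_mono_fmeasurable) (auto simp: fmeasurable_def)
  finally show ?thesis .
qed

text \<open>Off \<open>D\<close> the quotient divides by 0 and has value 0, which is consistent
  because \<open>p\<close> vanishes there almost everywhere.\<close>

lemma expectation_ratio:
  assumes p: "integrable lborel p" and p0: "AE x in lborel. x \<notin> D \<longrightarrow> p x = 0"
  shows "expectation (\<lambda>x. p x / dens x) = (LINT x|lborel. p x)" "integrable \<mu> (\<lambda>x. p x / dens x)"
proof -
  have [measurable]: "p \<in> borel_measurable borel" using p by (auto dest: borel_measurable_integrable)
  have pd: "AE x in lborel. p x = dens x * (p x / dens x)"
    using p0 by eventually_elim (auto simp: dens_def)
  have "integrable lborel (\<lambda>x. dens x * (p x / dens x))" using p pd by (subst integrable_cong_AE[symmetric]) auto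
  then show "integrable \<mu> (\<lambda>x. p x / dens x)" by (subst integrable_dens_iff) auto
  have "(LINT x|lborel. dens x * (p x / dens x)) = (LINT x|lborel. p x)" using pd by (intro integral_cong_AE) auto
  then show "expectation (\<lambda>x. p x / dens x) = (LINT x|lborel. p x)" by (subst expectation_dens) auto
qed

lemma tv_uniform_le:
  assumes a: "0 \<le> a" and mid: "\<And>x y. x \<in> D \<Longrightarrow> y \<in> D \<Longrightarrow> U ((1/2) *\<^sub>R (x + y)) \<le> U y + a * ln 2"
    and A: "A \<in> sets borel"
  shows "\<bar>measure \<mu> A - measure (density lborel (\<lambda>x. ennreal (indicator D x / measure lborel D))) A\<bar> \<le> sqrt (a * ln 2)"
proof -
  let ?u = "\<lambda>x. indicator D x / measure lborel D" and ?B = "LINT x|lborel. sqrt (dens x) * sqrt (indicator D x / measure lborel D)"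
  have fin: "emeasure lborel D < \<infinity>" using bounded_D by (rule emeasure_bounded_finite)
  have [measurable]: "D \<in> sets borel" using open_D by simp
  note pos = measure_D_pos
  have u: "integrable lborel ?u" "(LINT x|lborel. ?u x) = 1"
  proof -
    have "integrable lborel (indicator D :: 'a \<Rightarrow> real)" using fin by (intro integrable_real_indicator) auto
    then show "integrable lborel ?u" "(LINT x|lborel. ?u x) = 1" using pos by (auto simp: less_imp_neq[symmetric])
  qed
  have "sqrt (dens x) * sqrt (?u x) = sqrt (dens x) / sqrt (measure lborel D)" for x
    by (auto simp: dens_def indicator_def real_sqrt_divide)
  then have eq: "?B\<^sup>2 = (LINT x|lborel. sqrt (dens x))\<^sup>2 / measure lborel D" using pos by (simp add: power_divide)
  have "exp (- (a * ln 2)) \<le> ?B\<^sup>2"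
    unfolding eq using hellinger_affinity_uniform[OF a mid] pos by (simp add: pos_le_divide_eq)
  \<comment> \<open>The tangent of the exponential at 0 makes the bound on the squared affinity
    linear in \<open>a\<close>.\<close>
  moreover have "1 + - (a * ln 2) \<le> exp (- (a * ln 2))" by (rule exp_ge_add_one_self)
  ultimately have B: "1 - ?B\<^sup>2 \<le> a * ln 2" by linarith
  have "(2 * \<bar>measure \<mu> A - measure (density lborel (\<lambda>x. ennreal (?u x))) A\<bar>)\<^sup>2 \<le> (LINT x|lborel. \<bar>dens x - ?u x\<bar>)\<^sup>2"
    using u dens_integral dens_integrable dens_nonneg A
    by (intro power_mono abs_measure_density_diff_le) auto
  also have "\<dots> \<le> 4 * (1 - ?B\<^sup>2)"
    using u dens_integral dens_integrable dens_nonneg by (intro integral_abs_diff_le_hellinger) auto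
  also have "\<dots> \<le> 4 * (a * ln 2)" using B by simp
  finally have "\<bar>measure \<mu> A - measure (density lborel (\<lambda>x. ennreal (?u x))) A\<bar>\<^sup>2 \<le> a * ln 2" by (simp add: power_mult_distrib)
  then show ?thesis by (rule real_le_rsqrt)
qed

text \<open>The ratio has mean 1, so its second moment minus 1 is its variance, which controls the
  L1 distance by Cauchy-Schwarz against the constant 1.\<close>

lemma tv_chi2_le:
  assumes p: "integrable lborel p" "\<And>x. 0 \<le> p x" "(LINT x|lborel. p x) = 1"
    and p0: "AE x in lborel. x \<notin> D \<longrightarrow> p x = 0"
    and int: "integrable \<mu> (\<lambda>x. (p x / dens x)\<^sup>2)" and A: "A \<in> sets borel"
  shows "\<bar>measure (density lborel (\<lambda>x. ennreal (p x))) A - measure \<mu> A\<bar>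
      \<le> sqrt (expectation (\<lambda>x. (p x / dens x)\<^sup>2) - 1) / 2"
proof -
  have [measurable]: "p \<in> borel_measurable borel" using p by (auto dest: borel_measurable_integrable)
  let ?r = "\<lambda>x. p x / dens x"
  have r1: "expectation ?r = 1" "integrable \<mu> ?r"
    using expectation_ratio[OF p(1) p0] p(3) by auto
  have intd: "integrable \<mu> (\<lambda>x. (?r x - 1)\<^sup>2)" 
  proof -
    have "(?r x - 1)\<^sup>2 = (?r x)\<^sup>2 - 2 * ?r x + 1" for x by (simp add: power2_diff)
    then show ?thesis using int r1(2) by (simp only:) (intro Bochner_Integration.integrable_add Bochner_Integration.integrable_diff integrable_mult_right integrable_const)
  qed
  have "(LINT x|lborel. \<bar>p x - dens x\<bar>) = (LINT x|lborel. dens x * \<bar>(?r x - 1) * 1\<bar>)"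
  proof (intro integral_cong_AE)
    show "AE x in lborel. \<bar>p x - dens x\<bar> = dens x * \<bar>(?r x - 1) * 1\<bar>"
      using p0 by eventually_elim (auto simp: dens_def right_diff_distrib abs_mult[symmetric] abs_if field_simps)
  qed measurable
  also have "\<dots> = expectation (\<lambda>x. \<bar>(?r x - 1) * 1\<bar>)" by (rule expectation_dens[symmetric]) measurable
  finally have "(LINT x|lborel. \<bar>p x - dens x\<bar>)\<^sup>2 = (expectation (\<lambda>x. \<bar>(?r x - 1) * 1\<bar>))\<^sup>2" by simp
  also have "\<dots> \<le> expectation (\<lambda>x. (?r x - 1)\<^sup>2) * expectation (\<lambda>x. 1\<^sup>2 :: real)"
    using intd by (intro Cauchy_Schwarz_integral) auto
  also have "expectation (\<lambda>x. 1\<^sup>2 :: real) = 1" using prob_space by simp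
  also have "expectation (\<lambda>x. (?r x - 1)\<^sup>2) = expectation (\<lambda>x. (?r x)\<^sup>2) - 1"
  proof -
    have "expectation (\<lambda>x. (?r x - 1)\<^sup>2) = expectation (\<lambda>x. (?r x)\<^sup>2 - 2 * ?r x + 1)"
      by (simp add: power2_diff algebra_simps)
    also have "\<dots> = expectation (\<lambda>x. (?r x)\<^sup>2) - expectation (\<lambda>x. 2 * ?r x) + expectation (\<lambda>_. 1)"
      by (simp only: Bochner_Integration.integral_add[OF Bochner_Integration.integrable_diff[OF int integrable_mult_right[OF r1(2)]] integrable_const]
        Bochner_Integration.integral_diff[OF int integrable_mult_right[OF r1(2)]])
    also have "expectation (\<lambda>x. 2 * ?r x) = 2 * expectation ?r" by (rule integral_mult_right_zero)
    finally show ?thesis using r1(1) prob_space by simp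
  qed
  finally have 1: "(LINT x|lborel. \<bar>p x - dens x\<bar>)\<^sup>2 \<le> expectation (\<lambda>x. (?r x)\<^sup>2) - 1" by simp
  have "2 * \<bar>measure (density lborel (\<lambda>x. ennreal (p x))) A - measure \<mu> A\<bar> \<le> (LINT x|lborel. \<bar>p x - dens x\<bar>)"
    using p A dens_integral dens_integrable dens_nonneg by (intro abs_measure_density_diff_le) auto
  also have "\<dots> \<le> sqrt (expectation (\<lambda>x. (?r x)\<^sup>2) - 1)" using 1 by (rule real_le_rsqrt)
  finally show ?thesis by simp
qed

end

section \<open>Symmetry of the Hessian, Cauchy-Schwarz for its quadratic form, and convexity along
  lines\<close>

section \<open>Gradients and Hessians\<close>

lemma has_derivative_grad:
  fixes f :: "real^'n \<Rightarrow> real"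
  assumes "f differentiable (at x)"
  shows "(f has_derivative (\<lambda>h. grad f x \<bullet> h)) (at x)"
proof -
  let ?f' = "frechet_derivative f (at x)"
  have d: "(f has_derivative ?f') (at x)" using assms by (simp add: frechet_derivative_works)
  then have lin: "linear ?f'" by (rule has_derivative_linear)
  have "?f' h = grad f x \<bullet> h" for h
  proof -
    have "h = (\<Sum>i\<in>UNIV. h $ i *\<^sub>R axis i 1)"
      using basis_expansion[of h] by (simp add: scalar_mult_eq_scaleR)
    then have "?f' h = ?f' (\<Sum>i\<in>UNIV. h $ i *\<^sub>R axis i 1)" by simp
    also have "\<dots> = (\<Sum>i\<in>UNIV. h $ i *\<^sub>R ?f' (axis i 1))"
      using lin by (simp add: linear_sum linear_scale)
    finally show ?thesis by (simp add: grad_def inner_vec_def mult.commute)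
  qed
  then show ?thesis using d by (metis (no_types, lifting) ext)
qed

lemma grad_eqI:
  fixes f :: "real^'n \<Rightarrow> real"
  assumes "(f has_derivative (\<lambda>h. a \<bullet> h)) (at x)"
  shows "grad f x = a"
proof -
  have "f differentiable (at x)" using assms by (auto simp: differentiable_def)
  then have "(\<lambda>h. grad f x \<bullet> h) = (\<lambda>h. a \<bullet> h)"
    using has_derivative_grad assms has_derivative_unique by blast
  then show ?thesis by (metis vector_eq_rdot)
qed

lemma has_derivative_hess:
  "grad f differentiable (at x) \<Longrightarrow> (grad f has_derivative (\<lambda>h. hess f x *v h)) (at x)"
  unfolding hess_def by (simp add: jacobian_works)

lemma hess_eqI:
  assumes "(grad f has_derivative (\<lambda>h. A *v h)) (at x)"
  shows "hess f x = A"
proof -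
  have "frechet_derivative (grad f) (at x) = (*v) A" using frechet_derivative_at[OF assms] ..
  then show ?thesis by (simp add: hess_def jacobian_def)
qed

lemma deriv_line_grad:
  fixes f :: "real^'n \<Rightarrow> real"
  assumes "f differentiable (at (y + t *\<^sub>R u))"
  shows "((\<lambda>t. f (y + t *\<^sub>R u)) has_real_derivative grad f (y + t *\<^sub>R u) \<bullet> u) (at t)"
proof -
  have "((\<lambda>t. y + t *\<^sub>R u) has_derivative (\<lambda>s. s *\<^sub>R u)) (at t)" by (auto intro!: derivative_eq_intros)
  from has_derivative_compose[OF this has_derivative_grad[OF assms]]
  show ?thesis by (simp add: has_field_derivative_def mult_commute_abs)
qed

lemma deriv_line_hess:
  fixes f :: "real^'n \<Rightarrow> real"
  assumes "grad f differentiable (at (y + t *\<^sub>R u))"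
  shows "((\<lambda>t. grad f (y + t *\<^sub>R u) \<bullet> w) has_real_derivative (hess f (y + t *\<^sub>R u) *v u) \<bullet> w) (at t)"
proof -
  have "((\<lambda>t. y + t *\<^sub>R u) has_derivative (\<lambda>s. s *\<^sub>R u)) (at t)" by (auto intro!: derivative_eq_intros)
  from has_derivative_inner_left[OF has_derivative_compose[OF this has_derivative_hess[OF assms]]]
  show ?thesis by (simp add: has_field_derivative_def mult_commute_abs matrix_vector_mult_scaleR)
qed

text \<open>\<open>hess\<close> is the Jacobian of the gradient, so symmetry is Schwarz's theorem.
  The mixed difference over a small parallelogram is symmetric in the two directions; two mean value
  steps, taken in either order, express it by the Hessian at nearby points, and continuity
  concludes.\<close>

lemma hess_symmetric:
  fixes f :: "real^'n \<Rightarrow> real"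
  assumes S: "open S" and f: "C2_on S f" and x: "x \<in> S"
  shows "(hess f x *v u) \<bullet> w = (hess f x *v w) \<bullet> u"
proof -
  obtain e0 where e0: "0 < e0" "ball x e0 \<subseteq> S" using S x by (meson openE)
  have mixed: "\<exists>y. dist y x < d \<and> f (x + s *\<^sub>R u + s *\<^sub>R w) - f (x + s *\<^sub>R u) - f (x + s *\<^sub>R w) + f x
      = s * (s * ((hess f y *v w) \<bullet> u))"
    \<comment> \<open>The directions are bound again here so that the statement can be used with
      \<open>u\<close> and \<open>w\<close> exchanged.\<close>
    if d: "d \<le> e0" and s: "0 < s" "s * (norm u + norm w) < d" for d s u w
  proof -
    have near: "dist (x + r *\<^sub>R u + t *\<^sub>R w) x < d" if "0 \<le> r" "r \<le> s" "0 \<le> t" "t \<le> s" for r t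
    proof -
      have "norm (r *\<^sub>R u + t *\<^sub>R w) \<le> r * norm u + t * norm w"
        using that norm_triangle_ineq[of "r *\<^sub>R u" "t *\<^sub>R w"] by simp
      also have "\<dots> \<le> s * norm u + s * norm w" using that by (intro add_mono mult_right_mono) auto
      finally show ?thesis using s by (simp add: dist_norm algebra_simps)
    qed
    have inS: "x + r *\<^sub>R u + t *\<^sub>R w \<in> S" if "0 \<le> r" "r \<le> s" "0 \<le> t" "t \<le> s" for r t
      using near[OF that] d e0 by (auto simp: dist_commute)
    have df: "y \<in> S \<Longrightarrow> f differentiable (at y)" "y \<in> S \<Longrightarrow> grad f differentiable (at y)" for y
      using f by (auto simp: C2_on_def)
    define \<phi> where "\<phi> r = f (x + s *\<^sub>R w + r *\<^sub>R u) - f (x + r *\<^sub>R u)" for r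
    have "\<exists>r>0. r < s \<and> \<phi> s - \<phi> 0 = (s - 0) * (grad f (x + s *\<^sub>R w + r *\<^sub>R u) \<bullet> u - grad f (x + r *\<^sub>R u) \<bullet> u)"
    proof (rule MVT2)
      fix r assume r: "0 \<le> r" "r \<le> s"
      have "x + s *\<^sub>R w + r *\<^sub>R u \<in> S" "x + r *\<^sub>R u \<in> S"
        using inS[of r s] inS[of r 0] r s by (auto simp: algebra_simps)
      then show "(\<phi> has_real_derivative grad f (x + s *\<^sub>R w + r *\<^sub>R u) \<bullet> u - grad f (x + r *\<^sub>R u) \<bullet> u) (at r)"
        unfolding \<phi>_def by (intro DERIV_diff deriv_line_grad df)
    qed (use s in auto)
    then obtain r where r: "0 < r" "r < s"
      "\<phi> s - \<phi> 0 = s * (grad f (x + s *\<^sub>R w + r *\<^sub>R u) \<bullet> u - grad f (x + r *\<^sub>R u) \<bullet> u)" by auto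
    have "\<exists>t>0. t < s \<and> grad f (x + r *\<^sub>R u + s *\<^sub>R w) \<bullet> u - grad f (x + r *\<^sub>R u + 0 *\<^sub>R w) \<bullet> u
        = (s - 0) * ((hess f (x + r *\<^sub>R u + t *\<^sub>R w) *v w) \<bullet> u)"
      by (rule MVT2) (use s r in \<open>auto intro!: deriv_line_hess df inS\<close>)
    then obtain t where t: "0 < t" "t < s"
      "grad f (x + r *\<^sub>R u + s *\<^sub>R w) \<bullet> u - grad f (x + r *\<^sub>R u) \<bullet> u = s * ((hess f (x + r *\<^sub>R u + t *\<^sub>R w) *v w) \<bullet> u)"
      by auto
    have "\<phi> s - \<phi> 0 = s * (s * ((hess f (x + r *\<^sub>R u + t *\<^sub>R w) *v w) \<bullet> u))"
      unfolding r(3) t(3)[symmetric] by (simp add: algebra_simps)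
    then show ?thesis using near[of r t] r t
      by (intro exI[of _ "x + r *\<^sub>R u + t *\<^sub>R w"]) (auto simp: \<phi>_def algebra_simps)
  qed
  have cont: "continuous_on S (\<lambda>y. (hess f y *v a) \<bullet> b)" for a b
  proof -
    have "continuous_on S (hess f)" using f by (simp add: C2_on_def)
    then show ?thesis unfolding matrix_vector_mult_def inner_vec_def
      by (auto intro!: continuous_intros)
  qed
  have "\<bar>(hess f x *v u) \<bullet> w - (hess f x *v w) \<bullet> u\<bar> \<le> e" if e: "0 < e" for e
  proof -
    obtain d1 where d1: "0 < d1" "\<And>y. y \<in> S \<Longrightarrow> dist y x < d1 \<Longrightarrow> \<bar>(hess f y *v w) \<bullet> u - (hess f x *v w) \<bullet> u\<bar> < e / 2"
      using cont[of w u] x e unfolding continuous_on_iff dist_real_def by (metis half_gt_zero)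
    obtain d2 where d2: "0 < d2" "\<And>y. y \<in> S \<Longrightarrow> dist y x < d2 \<Longrightarrow> \<bar>(hess f y *v u) \<bullet> w - (hess f x *v u) \<bullet> w\<bar> < e / 2"
      using cont[of u w] x e unfolding continuous_on_iff dist_real_def by (metis half_gt_zero)
    define d where "d = min e0 (min d1 d2)"
    have d: "0 < d" "d \<le> e0" "d \<le> d1" "d \<le> d2" using e0 d1 d2 by (auto simp: d_def)
    \<comment> \<open>The parallelogram spanned by \<open>s *\<^sub>R u\<close> and
      \<open>s *\<^sub>R w\<close> at \<open>x\<close> then stays within distance \<open>d\<close>;
      the added 1 covers zero directions.\<close>
    define s where "s = d / (norm u + norm w + 1)"
    have nuw: "0 < norm u + norm w + 1" by (smt (verit) norm_ge_zero)
    have s: "0 < s" "s * (norm u + norm w) < d" "s * (norm w + norm u) < d"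
      using d(1) nuw by (auto simp: s_def field_simps)
    obtain y1 where y1: "dist y1 x < d" "f (x + s *\<^sub>R u + s *\<^sub>R w) - f (x + s *\<^sub>R u) - f (x + s *\<^sub>R w) + f x
      = s * (s * ((hess f y1 *v w) \<bullet> u))" using mixed[OF d(2) s(1,2)] by blast
    obtain y2 where y2: "dist y2 x < d" "f (x + s *\<^sub>R w + s *\<^sub>R u) - f (x + s *\<^sub>R w) - f (x + s *\<^sub>R u) + f x
      = s * (s * ((hess f y2 *v u) \<bullet> w))" using mixed[OF d(2) s(1,3)] by blast
    have "s * (s * ((hess f y1 *v w) \<bullet> u)) = s * (s * ((hess f y2 *v u) \<bullet> w))"
      unfolding y1(2)[symmetric] y2(2)[symmetric] by (simp add: algebra_simps)
    then have "(hess f y1 *v w) \<bullet> u = (hess f y2 *v u) \<bullet> w" using s(1) by simp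
    moreover have "y1 \<in> S" "y2 \<in> S" using y1 y2 d e0 by (auto simp: dist_commute)
    ultimately show ?thesis using d1(2)[of y1] d2(2)[of y2] y1(1) y2(1) d by linarith
  qed
  then show ?thesis by (metis abs_le_zero_iff eq_iff_diff_eq_0 field_le_epsilon add_0)
qed

text \<open>Nonnegativity of a quadratic polynomial in \<open>t\<close>. Semidefiniteness is the
  right hypothesis because \<open>hess_U_pos\<close> deduces definiteness from this inequality; the
  price is a separate degenerate case.\<close>

lemma symmetric_psd_Cauchy_Schwarz:
  fixes A :: "real^'n^'n"
  assumes sym: "\<And>u w. (A *v u) \<bullet> w = (A *v w) \<bullet> u" and psd: "\<And>u. 0 \<le> u \<bullet> (A *v u)"
  shows "(u \<bullet> (A *v w))\<^sup>2 \<le> (u \<bullet> (A *v u)) * (w \<bullet> (A *v w))"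
proof -
  have q: "0 \<le> u \<bullet> (A *v u) + 2 * t * (u \<bullet> (A *v w)) + t\<^sup>2 * (w \<bullet> (A *v w))" for t
  proof -
    have "0 \<le> (u + t *\<^sub>R w) \<bullet> (A *v (u + t *\<^sub>R w))" by (rule psd)
    also have "\<dots> = u \<bullet> (A *v u) + 2 * t * (u \<bullet> (A *v w)) + t\<^sup>2 * (w \<bullet> (A *v w))"
      using sym[of u w] by (simp add: matrix_vector_right_distrib matrix_vector_mult_scaleR inner_add
        power2_eq_square algebra_simps inner_commute)
    finally show ?thesis .
  qed
  show ?thesis
  proof (cases "w \<bullet> (A *v w) = 0")
    case True
    have "u \<bullet> (A *v w) = 0"
    proof (rule ccontr)
      assume ne: "u \<bullet> (A *v w) \<noteq> 0"
      \<comment> \<open>Without its quadratic term the polynomial is affine, and this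
        \<open>t\<close> gives it the value -1.\<close>
      define t where "t = - (u \<bullet> (A *v u) + 1) / (2 * (u \<bullet> (A *v w)))"
      have "2 * t * (u \<bullet> (A *v w)) = - (u \<bullet> (A *v u) + 1)" using ne by (simp add: t_def)
      then show False using q[of t] True by simp
    qed
    then show ?thesis using True by simp
  next
    case False
    then have pos: "0 < w \<bullet> (A *v w)" using psd[of w] by simp
    have "0 \<le> u \<bullet> (A *v u) - (u \<bullet> (A *v w))\<^sup>2 / (w \<bullet> (A *v w))"
      using q[of "- (u \<bullet> (A *v w)) / (w \<bullet> (A *v w))"] pos by (simp add: power2_eq_square field_simps)
    then show ?thesis using pos by (simp add: field_simps)
  qed
qed

text \<open>Adding the tangent inequalities at 0 and at \<open>t\<close> gives
  \<open>\<phi>' 0 \<le> \<phi>' t\<close> for positive \<open>t\<close>, so the right difference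
  quotients of \<open>\<phi>'\<close> at 0 are nonnegative, and \<open>c\<close> is their
  limit.\<close>

lemma convex_second_derivative_nonneg:
  fixes \<phi> :: "real \<Rightarrow> real"
  assumes T: "open T" "0 \<in> T" and conv: "convex_on T \<phi>"
    and d1: "\<And>t. t \<in> T \<Longrightarrow> (\<phi> has_real_derivative \<phi>' t) (at t)" and d2: "(\<phi>' has_real_derivative c) (at 0)"
  shows "0 \<le> c"
proof -
  have "connected T" using conv by (auto simp: convex_on_def convex_connected)
  have tangent: "\<phi> y - \<phi> x \<ge> \<phi>' x * (y - x)" if "x \<in> T" "y \<in> T" for x y
    using convex_on_imp_above_tangent[OF conv \<open>connected T\<close>, of x y "\<phi>' x"] that T d1[of x]
    by (auto simp: interior_open intro: has_field_derivative_at_within)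
  have "((\<lambda>t. (\<phi>' (0 + t) - \<phi>' 0) / t) \<longlongrightarrow> c) (at_right 0)"
    using d2 unfolding DERIV_def by (rule tendsto_within_subset) auto
  moreover have "\<forall>\<^sub>F t in at_right 0. 0 \<le> (\<phi>' (0 + t) - \<phi>' 0) / t"
  proof -
    have "\<forall>\<^sub>F t in at_right 0. t \<in> T"
      using eventually_nhds_in_open[OF T] by (auto simp: eventually_at_filter elim!: eventually_mono)
    moreover have "\<forall>\<^sub>F t in at_right (0::real). 0 < t" by (rule eventually_at_right_less)
    ultimately show ?thesis
    proof eventually_elim
      case (elim t)
      have "\<phi>' 0 * (t - 0) + \<phi>' t * (0 - t) \<le> 0"
        using tangent[of 0 t] tangent[of t 0] elim T by linarith
      then have "0 \<le> t * (\<phi>' t - \<phi>' 0)" by (simp add: algebra_simps)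
      then show ?case using elim by (simp add: zero_le_mult_iff)
    qed
  qed
  ultimately show ?thesis by (rule tendsto_lowerbound) simp
qed

lemma convex_on_line:
  fixes f :: "'a::real_vector \<Rightarrow> real"
  assumes "convex_on D f"
  shows "convex_on {t. x + t *\<^sub>R h \<in> D} (\<lambda>t. f (x + t *\<^sub>R h))"
proof -
  have eq: "x + ((1 - t) * a + t * b) *\<^sub>R h = (1 - t) *\<^sub>R (x + a *\<^sub>R h) + t *\<^sub>R (x + b *\<^sub>R h)" for t a b :: real
    by (simp add: algebra_simps)
  show ?thesis
  proof (rule convex_onI)
    show "f (x + ((1 - t) *\<^sub>R a + t *\<^sub>R b) *\<^sub>R h) \<le> (1 - t) * f (x + a *\<^sub>R h) + t * f (x + b *\<^sub>R h)"
      if "0 < t" "t < 1" "a \<in> {t. x + t *\<^sub>R h \<in> D}" "b \<in> {t. x + t *\<^sub>R h \<in> D}" for t a b :: real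
      using that by (simp add: eq) (intro convex_onD[OF assms], auto)
    have "convex D" using assms by (simp add: convex_on_def)
    show "convex {t. x + t *\<^sub>R h \<in> D}"
      unfolding convex_alt using convexD_alt[OF \<open>convex D\<close>] by (auto simp: eq)
  qed
qed

section \<open>The Gibbs density of a barrier and its Poincare inequality in the Hessian
  metric\<close>

section \<open>Exp-concave barriers\<close>

lemma matrix_inv_mult:
  fixes A :: "real^'n^'n"
  assumes "invertible A"
  shows "A ** matrix_inv A = mat 1" "matrix_inv A ** A = mat 1"
  using someI_ex[OF assms[unfolded invertible_def]] by (auto simp: matrix_inv_def)

lemma convex_on_eq:
  fixes f g :: "'a::real_vector \<Rightarrow> real"
  assumes f: "convex_on S f" and eq: "\<And>x. x \<in> S \<Longrightarrow> f x = g x"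
  shows "convex_on S g"
proof (rule convex_onI)
  have S: "convex S" using f by (simp add: convex_on_def)
  then show "convex S" .
  show "g ((1 - t) *\<^sub>R x + t *\<^sub>R y) \<le> (1 - t) * g x + t * g y"
    if "0 < t" "t < 1" "x \<in> S" "y \<in> S" for t x y
    using convex_onD[OF f, of t x y] convexD_alt[OF S, of x y t] that by (simp add: eq)
qed

locale exp_concave_barrier =
  fixes C :: "(real^'n) set" and V :: "real^'n \<Rightarrow> ereal" and \<nu> \<beta> :: real
  assumes \<nu>: "0 < \<nu>" and \<beta>: "0 < \<beta>"
    and body: "convex_body C" and bar: "barrier C V"
    and C2: "C2_on (interior C) (\<lambda>x. real_of_ereal (V x))"
    and expc: "exp_concave_on C (1 / \<nu>) V"
    and inv: "\<And>x. x \<in> interior C \<Longrightarrow> invertible (hess (\<lambda>z. real_of_ereal (gibbs_potential \<beta> V z)) x)"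
begin

abbreviation D :: "(real^'n) set" where "D \<equiv> interior C"

definition v :: "real^'n \<Rightarrow> real" where "v x = real_of_ereal (V x)"

definition Z :: real where "Z = (LINT y|lborel. exp_neg (ereal \<beta> * V y))"

definition U :: "real^'n \<Rightarrow> real" where "U x = real_of_ereal (gibbs_potential \<beta> V x)"

lemma C_body: "convex C" "compact C" "D \<noteq> {}" "closed C" "convex D" "open D" "bounded D"
  using body by (auto simp: convex_body_def compact_imp_closed convex_interior bounded_interior compact_imp_bounded)

lemma V_lim: "z \<in> frontier C \<Longrightarrow> (V \<longlongrightarrow> \<infinity>) (at z within D)"
  using bar by (auto simp: barrier_def)

lemma frontier_C: "x \<in> C \<Longrightarrow> x \<notin> D \<Longrightarrow> x \<in> frontier C"
  using C_body(4) by (simp add: frontier_def closure_closed)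

lemma closure_D: "closure D = C"
  using C_body by (simp add: convex_closure_interior closure_closed)

lemma V_not_MInf: "V x \<noteq> - \<infinity>"
  using bar by (auto simp: barrier_def)

(* A finite value at a boundary point z would, by convexity, bound V along the segment from
   an interior point to z, contradicting the blow-up of V at z. *)
lemma edom_V: "edom V = D"
proof
  show "D \<subseteq> edom V" using bar by (auto simp: barrier_def)
  show "edom V \<subseteq> D"
  proof
    fix z assume z: "z \<in> edom V"
    show "z \<in> D"
    proof (rule ccontr)
      assume "z \<notin> D"
      have "z \<in> C" using z bar by (auto simp: barrier_def)
      then have zf: "z \<in> frontier C" using \<open>z \<notin> D\<close> by (rule frontier_C)
      obtain x where x: "x \<in> D" using C_body by auto
      have xe: "x \<in> edom V" using x bar by (auto simp: barrier_def)
      define K where "K = \<bar>v x\<bar> + \<bar>v z\<bar> + 1"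
      have Vx: "V x = ereal (v x)" "V z = ereal (v z)"
        using xe z V_not_MInf by (auto simp: v_def edom_def ereal_real)
      define y where "y t = (1 - t) *\<^sub>R x + t *\<^sub>R z" for t
      have yD: "y t \<in> D" if "0 < t" "t < 1" for t
      proof -
        have "z - (1 - t) *\<^sub>R (z - x) \<in> interior C"
          using that x \<open>z \<in> C\<close> C_body by (intro mem_interior_closure_convex_shrink) (auto simp: closure_closed)
        also have "z - (1 - t) *\<^sub>R (z - x) = y t" by (simp add: y_def algebra_simps)
        finally show ?thesis .
      qed
      have le: "V (y t) \<le> ereal K" if t: "0 < t" "t < 1" for t
      proof -
        have "x \<noteq> z" using x \<open>z \<notin> D\<close> by auto
        then have "V (y t) < ereal (1 - t) * V x + ereal t * V z"
          using bar xe z t unfolding barrier_def strictly_convex_def y_def by blast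
        also have "\<dots> = ereal ((1 - t) * v x + t * v z)" by (simp add: Vx)
        also have "\<dots> \<le> ereal K"
        proof -
          have ab: "r * a \<le> \<bar>a\<bar>" if "0 \<le> r" "r \<le> 1" for r a :: real
            using mult_left_mono[OF abs_ge_self[of a] that(1)] mult_right_mono[OF that(2) abs_ge_zero[of a]] by linarith
          have "(1 - t) * v x \<le> \<bar>v x\<bar>" "t * v z \<le> \<bar>v z\<bar>" using t by (auto intro!: ab)
          then show ?thesis by (simp add: K_def)
        qed
        finally show ?thesis by simp
      qed
      have "(y \<longlongrightarrow> z) (at_left 1)"
      proof -
        have "(y \<longlongrightarrow> (1 - 1) *\<^sub>R x + 1 *\<^sub>R z) (at_left 1)" unfolding y_def by (intro tendsto_intros)
        then show ?thesis by simp
      qed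
      moreover have ev: "\<forall>\<^sub>F t in at_left 1. 0 < t \<and> t < (1::real)"
        by (auto simp: eventually_at_left_field intro!: exI[of _ 0])
      then have "\<forall>\<^sub>F t in at_left 1. y t \<in> D \<and> y t \<noteq> z"
        by eventually_elim (use yD \<open>z \<notin> D\<close> in metis)
      ultimately have "filterlim y (at z within D) (at_left 1)" by (auto simp: filterlim_at)
      then have "((\<lambda>t. V (y t)) \<longlongrightarrow> \<infinity>) (at_left 1)" by (rule filterlim_compose[OF V_lim[OF zf]])
      then have "\<forall>\<^sub>F t in at_left 1. ereal K < V (y t)" by (rule order_tendstoD) simp
      with ev have "\<forall>\<^sub>F t in at_left (1::real). False"
        by eventually_elim (use le in \<open>meson not_le\<close>)
      then show False by (simp add: trivial_limit_at_left_real)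
    qed
  qed
qed

lemma V_in: "x \<in> D \<Longrightarrow> V x = ereal (v x)"
  using edom_V V_not_MInf[of x] by (auto simp: v_def edom_def ereal_real set_eq_iff)

lemma V_out: "x \<notin> D \<Longrightarrow> V x = \<infinity>"
  using edom_V by (auto simp: edom_def set_eq_iff)

lemma convex_v: "convex_on D v"
proof (rule convex_onI)
  fix t x y assume t: "0 < t" "t < (1::real)" and xy: "x \<in> D" "y \<in> D"
  show "v ((1 - t) *\<^sub>R x + t *\<^sub>R y) \<le> (1 - t) * v x + t * v y"
  proof (cases "x = y")
    case True then show ?thesis by (simp add: algebra_simps)
  next
    case False
    have "V ((1 - t) *\<^sub>R x + t *\<^sub>R y) < ereal (1 - t) * V x + ereal t * V y"
      using bar edom_V xy t False unfolding barrier_def strictly_convex_def by blast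
    moreover have "(1 - t) *\<^sub>R x + t *\<^sub>R y \<in> D" using C_body(5) xy t by (simp add: convexD_alt)
    ultimately show ?thesis using xy by (simp add: V_in)
  qed
qed (rule C_body(5))

definition E :: "real^'n \<Rightarrow> real" where "E x = (if x \<in> D then exp (- \<beta> * v x) else 0)"

lemma E_alt: "exp_neg (ereal \<beta> * V x) = E x"
  using \<beta> by (cases "x \<in> D") (simp_all add: E_def V_in V_out exp_neg_def)

lemma v_continuous: "continuous_on D v"
  using convex_v C_body by (intro convex_on_continuous)

text \<open>The blow-up of the barrier makes \<open>E\<close> tend to 0 at the frontier, so
  extension by zero is continuous. Continuity on the whole space later controls the mollification
  error and makes the sublevel sets of \<open>v\<close> compact.\<close>

lemma E_continuous: "continuous_on UNIV E"
proof (intro continuous_at_imp_continuous_on ballI)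
  fix z :: "real^'n"
  consider "z \<in> D" | "z \<in> - C" | "z \<in> frontier C" using frontier_C by blast
  then show "isCont E z"
  proof cases
    case 1
    have "continuous_on D (\<lambda>x. exp (- \<beta> * v x))" by (intro continuous_intros v_continuous)
    then have "continuous_on D E" by (rule continuous_on_eq) (simp add: E_def)
    then show ?thesis using C_body 1 by (simp add: continuous_on_eq_continuous_at)
  next
    case 2
    have "open (- C)" using C_body by auto
    moreover have "continuous_on (- C) E"
      by (rule continuous_on_eq[of _ "\<lambda>_. 0"]) (use interior_subset in \<open>auto simp: E_def\<close>)
    ultimately show ?thesis using 2 by (simp add: continuous_on_eq_continuous_at)
  next
    case 3
    then have Ez: "E z = 0" by (auto simp: E_def frontier_def)
    have "(E \<longlongrightarrow> 0) (at z)"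
    proof (rule tendstoI)
      fix e :: real assume e: "0 < e"
      have "\<forall>\<^sub>F x in at z within D. ereal (- ln e / \<beta>) < V x"
        using V_lim[OF 3] by (rule order_tendstoD) simp
      then have "\<forall>\<^sub>F x in at z. x \<in> D \<longrightarrow> ereal (- ln e / \<beta>) < V x"
        by (auto simp: eventually_at_filter elim!: eventually_mono)
      then show "\<forall>\<^sub>F x in at z. dist (E x) 0 < e"
      proof eventually_elim
        case (elim x)
        show ?case
        proof (cases "x \<in> D")
          case True
          then have "- ln e / \<beta> < v x" using elim by (simp add: V_in)
          then have "- \<beta> * v x < ln e" using \<beta> by (simp add: field_simps)
          then have "exp (- \<beta> * v x) < exp (ln e)" by (rule exp_less_mono)
          then show ?thesis using True e by (simp add: E_def)
        qed (use e in \<open>simp add: E_def\<close>)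
      qed
    qed
    then show ?thesis by (simp add: isCont_def Ez)
  qed
qed

lemma E_integrable: "integrable lborel E"
  using interior_subset by (intro compact_support_integrable[OF E_continuous C_body(2)]) (auto simp: E_def)

lemma E_nonneg: "0 \<le> E x"
  by (simp add: E_def)

lemma Z_pos: "0 < Z"
proof -
  have "0 \<le> Z" unfolding Z_def E_alt using E_nonneg by (intro Bochner_Integration.integral_nonneg) auto
  moreover have "Z \<noteq> 0"
  proof
    assume "Z = 0"
    then have "AE x in lborel. E x = 0"
      unfolding Z_def E_alt using integral_nonneg_eq_0_iff_AE[OF E_integrable] E_nonneg by auto
    then have "AE x in lborel. x \<notin> D" by eventually_elim (auto simp: E_def split: if_splits)
    then have "D \<in> null_sets lborel" using C_body by (subst (asm) AE_iff_null_sets[symmetric]) auto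
    then have "negligible D" by (simp add: null_sets_completionI negligible_iff_null_sets)
    then show False using C_body open_not_negligible by blast
  qed
  ultimately show ?thesis by simp
qed

lemma U_in: "x \<in> D \<Longrightarrow> U x = \<beta> * v x + ln Z"
  by (simp add: U_def gibbs_potential_def V_in Z_def[symmetric])

lemma gibbs_potential_in: "x \<in> D \<Longrightarrow> gibbs_potential \<beta> V x = ereal (U x)"
  by (simp add: U_in) (simp add: gibbs_potential_def V_in Z_def[symmetric])

lemma gibbs_potential_out: "x \<notin> D \<Longrightarrow> gibbs_potential \<beta> V x = \<infinity>"
  using \<beta> by (simp add: gibbs_potential_def V_out)

lemma edom_gibbs_potential: "edom (gibbs_potential \<beta> V) = D"
  using gibbs_potential_in gibbs_potential_out by (force simp: edom_def)

lemma v_differentiable: "x \<in> D \<Longrightarrow> v differentiable (at x)" "x \<in> D \<Longrightarrow> grad v differentiable (at x)"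
  using C2 by (auto simp: C2_on_def v_def[abs_def])

lemma grad_U: "x \<in> D \<Longrightarrow> (U has_derivative (\<lambda>h. \<beta> * (grad v x \<bullet> h))) (at x)" "x \<in> D \<Longrightarrow> grad U x = \<beta> *\<^sub>R grad v x"
proof -
  assume x: "x \<in> D"
  have "((\<lambda>x. \<beta> * v x + ln Z) has_derivative (\<lambda>h. \<beta> * (grad v x \<bullet> h))) (at x)"
    using has_derivative_grad[OF v_differentiable(1)[OF x]] by (auto intro!: derivative_eq_intros)
  then show 1: "(U has_derivative (\<lambda>h. \<beta> * (grad v x \<bullet> h))) (at x)"
    by (rule has_derivative_transform_within_open[OF _ C_body(6) x]) (simp add: U_in)
  then show "grad U x = \<beta> *\<^sub>R grad v x" by (intro grad_eqI) simp
qed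

lemma hess_U: "x \<in> D \<Longrightarrow> (grad U has_derivative (\<lambda>h. \<beta> *\<^sub>R (hess v x *v h))) (at x)" "x \<in> D \<Longrightarrow> hess U x = \<beta> *\<^sub>R hess v x"
proof -
  assume x: "x \<in> D"
  have "((\<lambda>x. \<beta> *\<^sub>R grad v x) has_derivative (\<lambda>h. \<beta> *\<^sub>R (hess v x *v h))) (at x)"
    by (intro has_derivative_scaleR_right has_derivative_hess v_differentiable x)
  then show 1: "(grad U has_derivative (\<lambda>h. \<beta> *\<^sub>R (hess v x *v h))) (at x)"
    by (rule has_derivative_transform_within_open[OF _ C_body(6) x]) (simp add: grad_U)
  then show "hess U x = \<beta> *\<^sub>R hess v x" by (intro hess_eqI) (simp add: scaleR_matrix_vector_assoc)
qed

lemma C2_U: "C2_on D U"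
  unfolding C2_on_def
proof (intro conjI ballI)
  show "U differentiable (at x)" "grad U differentiable (at x)" if "x \<in> D" for x
    using grad_U(1)[OF that] hess_U(1)[OF that] by (auto simp: differentiable_def)
  have "continuous_on D (\<lambda>x. \<beta> *\<^sub>R hess v x)"
    using C2 by (intro continuous_intros) (simp add: C2_on_def v_def[abs_def])
  then show "continuous_on D (hess U)" by (rule continuous_on_eq) (simp add: hess_U)
qed

lemma U_differentiable: "x \<in> D \<Longrightarrow> U differentiable (at x)" "x \<in> D \<Longrightarrow> grad U differentiable (at x)"
  using C2_U by (auto simp: C2_on_def)

lemma convex_U: "convex_on D U"
proof -
  have "convex_on D (\<lambda>x. \<beta> * v x + ln Z)"
    using \<beta> C_body(5) by (intro convex_on_add convex_on_cmul convex_v)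
      (auto simp: convex_on_def distrib_right[symmetric])
  then show ?thesis by (rule convex_on_eq) (simp add: U_in)
qed

lemma hess_U_sym: "x \<in> D \<Longrightarrow> (hess U x *v u) \<bullet> w = (hess U x *v w) \<bullet> u"
  by (rule hess_symmetric[OF C_body(6) C2_U])

lemma line_open: "open {t. x + t *\<^sub>R h \<in> D}"
  using C_body(6) by (intro open_vimage[unfolded vimage_def] continuous_intros)

lemma hess_U_psd:
  assumes x: "x \<in> D"
  shows "0 \<le> h \<bullet> (hess U x *v h)"
proof (rule convex_second_derivative_nonneg[OF line_open _ convex_on_line[OF convex_U]])
  show "0 \<in> {t. x + t *\<^sub>R h \<in> D}" using x by simp
  show "((\<lambda>t. U (x + t *\<^sub>R h)) has_real_derivative grad U (x + t *\<^sub>R h) \<bullet> h) (at t)"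
    if "t \<in> {t. x + t *\<^sub>R h \<in> D}" for t
    using that by (intro deriv_line_grad U_differentiable) auto
  show "((\<lambda>t. grad U (x + t *\<^sub>R h) \<bullet> h) has_real_derivative h \<bullet> (hess U x *v h)) (at 0)"
    using deriv_line_hess[of U x 0 h h] U_differentiable x by (simp add: inner_commute)
qed

text \<open>Convexity alone gives semidefiniteness. By Cauchy-Schwarz a direction on which the form
  vanishes lies in the kernel of the Hessian, and the assumed invertibility makes this kernel
  trivial.\<close>

lemma hess_U_pos:
  assumes x: "x \<in> D" and h: "h \<noteq> 0"
  shows "0 < h \<bullet> (hess U x *v h)"
proof (rule ccontr)
  assume "\<not> ?thesis"
  then have 0: "h \<bullet> (hess U x *v h) = 0" using hess_U_psd[OF x, of h] by simp
  have "((hess U x *v h) \<bullet> (hess U x *v h))\<^sup>2 \<le> 0"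
    using symmetric_psd_Cauchy_Schwarz[OF hess_U_sym[OF x] hess_U_psd[OF x], of "hess U x *v h" h] 0 by simp
  then have "hess U x *v h = 0" by simp
  moreover have "invertible (hess U x)" using inv[OF x] by (simp add: U_def[abs_def])
  then have "matrix_inv (hess U x) ** hess U x = mat 1" by (rule matrix_inv_mult)
  then have "h = matrix_inv (hess U x) *v (hess U x *v h)" by (simp add: matrix_vector_mul_assoc)
  ultimately show False using h by simp
qed

sublocale smooth_log_concave D U "\<lambda>x h. grad U x \<bullet> h" "\<lambda>x h. h \<bullet> (hess U x *v h)"
proof
  show "((\<lambda>r. U (x + r *\<^sub>R h)) has_real_derivative grad U (x + r *\<^sub>R h) \<bullet> h) (at r)"
    "((\<lambda>r. grad U (x + r *\<^sub>R h) \<bullet> h) has_real_derivative h \<bullet> (hess U (x + r *\<^sub>R h) *v h)) (at r)"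
    if "x + r *\<^sub>R h \<in> D" for x r h
    using deriv_line_grad[OF U_differentiable(1)[OF that]] deriv_line_hess[OF U_differentiable(2)[OF that], of h]
    by (simp_all add: inner_commute)
  have "continuous_on (D \<times> (UNIV :: (real^'n) set)) (\<lambda>z. hess U (fst z))"
  proof (rule continuous_on_compose2[of D "hess U" _ fst])
    show "continuous_on D (hess U)" using C2_U by (simp add: C2_on_def)
    show "continuous_on (D \<times> (UNIV :: (real^'n) set)) fst" by (rule continuous_on_fst[OF continuous_on_id])
  qed auto
  then show "continuous_on (D \<times> (UNIV :: (real^'n) set)) (\<lambda>(x, h). h \<bullet> (hess U x *v h))"
    unfolding split_beta matrix_vector_mult_def inner_vec_def by (auto intro!: continuous_intros)
  show "(c *\<^sub>R h) \<bullet> (hess U x *v (c *\<^sub>R h)) = c\<^sup>2 * (h \<bullet> (hess U x *v h))" for x c h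
    by (simp add: matrix_vector_mult_scaleR power2_eq_square)
qed (use C_body convex_U hess_U_pos in auto)

lemma dens_E: "dens x = E x / Z"
  using Z_pos by (simp add: dens_def E_def U_in exp_add exp_minus exp_diff divide_inverse)

lemma exp_neg_gibbs_potential: "exp_neg (gibbs_potential \<beta> V x) = dens x"
  by (cases "x \<in> D") (simp_all add: gibbs_potential_in gibbs_potential_out exp_neg_def dens_def)

sublocale smooth_log_concave_prob D U "\<lambda>x h. grad U x \<bullet> h" "\<lambda>x h. h \<bullet> (hess U x *v h)"
proof
  show "continuous_on UNIV dens" unfolding dens_E[abs_def] using Z_pos by (intro continuous_intros E_continuous) auto
  show "(LINT x|lborel. dens x) = 1" unfolding dens_E using Z_pos by (simp add: Z_def E_alt)
qed

lemma gibbs_eq: "gibbs \<beta> V = \<mu>"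
  by (simp add: gibbs_def exp_neg_gibbs_potential)

lemma concave_exp_v: "convex_on D (\<lambda>x. - exp (- v x / \<nu>))"
proof -
  have "convex_on C (\<lambda>x. - exp_neg (ereal (1 / \<nu>) * V x))"
    using expc by (simp add: exp_concave_on_def concave_on_def)
  then have "convex_on D (\<lambda>x. - exp_neg (ereal (1 / \<nu>) * V x))"
    by (rule convex_on_subset[OF _ interior_subset C_body(5)])
  then show ?thesis by (rule convex_on_eq) (simp add: V_in exp_neg_def)
qed

(* This is the nonpositivity of the second derivative of exp (- v / nu) along lines. *)
lemma grad_v_bound:
  assumes x: "x \<in> D"
  shows "(grad v x \<bullet> h)\<^sup>2 \<le> \<nu> * (h \<bullet> (hess v x *v h))"
proof -
  let ?\<phi>' = "\<lambda>t. exp (- v (x + t *\<^sub>R h) / \<nu>) * ((grad v (x + t *\<^sub>R h) \<bullet> h) / \<nu>)"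
  let ?a = "grad v x \<bullet> h" and ?b = "(hess v x *v h) \<bullet> h"
  have d1: "((\<lambda>t. v (x + t *\<^sub>R h)) has_real_derivative grad v (x + t *\<^sub>R h) \<bullet> h) (at t)" if "x + t *\<^sub>R h \<in> D" for t
    by (intro deriv_line_grad v_differentiable that)
  have "0 \<le> exp (- v x / \<nu>) * (?b / \<nu>) + exp (- v x / \<nu>) * (- ?a / \<nu>) * (?a / \<nu>)"
  proof (rule convex_second_derivative_nonneg[OF line_open _ convex_on_line[OF concave_exp_v]])
    show "0 \<in> {t. x + t *\<^sub>R h \<in> D}" using x by simp
    show "((\<lambda>t. - exp (- v (x + t *\<^sub>R h) / \<nu>)) has_real_derivative ?\<phi>' t) (at t)"
      if "t \<in> {t. x + t *\<^sub>R h \<in> D}" for t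
      using d1[of t] that \<nu> by (auto intro!: derivative_eq_intros)
    have d2: "((\<lambda>t. grad v (x + t *\<^sub>R h) \<bullet> h) has_real_derivative ?b) (at 0)"
      using deriv_line_hess[of v x 0 h h] v_differentiable x by simp
    have d1': "((\<lambda>t. v (x + t *\<^sub>R h)) has_real_derivative ?a) (at 0)" using d1[of 0] x by simp
    show "(?\<phi>' has_real_derivative exp (- v x / \<nu>) * (?b / \<nu>) + exp (- v x / \<nu>) * (- ?a / \<nu>) * (?a / \<nu>)) (at 0)"
      using \<nu> by (auto intro!: derivative_eq_intros d1' d2 simp: field_simps)
  qed
  then have "0 \<le> exp (- v x / \<nu>) * (?b / \<nu> - ?a * ?a / (\<nu> * \<nu>))" by (simp add: algebra_simps)
  then have "0 \<le> ?b / \<nu> - ?a * ?a / (\<nu> * \<nu>)" by (simp add: zero_le_mult_iff)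
  then show ?thesis using \<nu> by (simp add: field_simps power2_eq_square inner_commute)
qed

lemma U_midpoint:
  assumes xy: "x \<in> D" "y \<in> D"
  shows "U ((1/2) *\<^sub>R (x + y)) \<le> U y + \<beta> * \<nu> * ln 2"
proof -
  let ?z = "(1/2) *\<^sub>R (x + y)"
  have z: "?z \<in> D" using convexD[OF C_body(5) xy, of "1/2" "1/2"] by (simp add: scaleR_add_right)
  have eqz: "(1 - 1/2) *\<^sub>R x + (1/2) *\<^sub>R y = ?z" by (simp add: scaleR_add_right)
  have "- exp (- v ((1 - 1/2) *\<^sub>R x + (1/2) *\<^sub>R y) / \<nu>) \<le> (1 - 1/2) * (- exp (- v x / \<nu>)) + 1/2 * (- exp (- v y / \<nu>))"
    using convex_onD[OF concave_exp_v, of "1/2" x y] xy by simp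
  moreover have "1/2 * b \<le> c" if "- c \<le> (1 - 1/2) * (- a) + 1/2 * (- b)" "0 \<le> a" for a b c :: real
    using that by simp
  ultimately have "1/2 * exp (- v y / \<nu>) \<le> exp (- v ?z / \<nu>)"
    unfolding eqz using exp_ge_zero by blast
  moreover have "1/2 * exp (- v y / \<nu>) = exp (- v y / \<nu> - ln 2)" by (simp add: exp_diff)
  ultimately have "- v y / \<nu> - ln 2 \<le> - v ?z / \<nu>" by simp
  then have "\<nu> * (- v y / \<nu> - ln 2) \<le> \<nu> * (- v ?z / \<nu>)" using \<nu> by (intro mult_left_mono) auto
  then have "v ?z \<le> v y + \<nu> * ln 2" using \<nu> by (simp add: right_diff_distrib)
  then have "\<beta> * v ?z \<le> \<beta> * (v y + \<nu> * ln 2)" using \<beta> by (intro mult_left_mono) auto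
  then show ?thesis using xy z by (simp add: U_in algebra_simps)
qed

text \<open>With \<open>w\<close> the inverse Hessian applied to \<open>grad g x\<close>, one has
  \<open>grad g x \<bullet> h = w \<bullet> (hess U x *v h)\<close>, so the gradient condition of
  Brascamp-Lieb is Cauchy-Schwarz for the Hessian. The cut-off uses \<open>v\<close>, shifted to be
  nonnegative, with constant \<open>\<nu> / \<beta>\<close> since \<open>hess U\<close> is \<beta>
  times \<open>hess v\<close>.\<close>

theorem poincare:
  fixes g Q :: "real^'n \<Rightarrow> real"
  assumes g: "\<And>x. x \<in> D \<Longrightarrow> g differentiable (at x)"
    and Q: "\<And>x. x \<in> D \<Longrightarrow> Q x = grad g x \<bullet> (matrix_inv (hess U x) *v grad g x)" and Q0: "\<And>x. x \<notin> D \<Longrightarrow> Q x = 0"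
    and meas: "g \<in> borel_measurable borel" "Q \<in> borel_measurable borel"
    and int: "integrable \<mu> (\<lambda>x. (g x)\<^sup>2)" "integrable \<mu> Q"
  shows "expectation (\<lambda>x. (g x)\<^sup>2) - (expectation g)\<^sup>2 \<le> expectation Q"
proof -
  have Qw: "\<exists>w. hess U x *v w = grad g x \<and> Q x = w \<bullet> (hess U x *v w)" if x: "x \<in> D" for x
  proof -
    have "invertible (hess U x)" using inv[OF x] by (simp add: U_def[abs_def])
    then have "hess U x *v (matrix_inv (hess U x) *v grad g x) = grad g x"
      by (simp add: matrix_vector_mul_assoc matrix_inv_mult)
    then show ?thesis using Q[OF x] by (auto simp: inner_commute)
  qed
  have Qpos: "0 \<le> Q x" for x using Qw[of x] Q0[of x] hess_U_psd[of x] by (metis order_refl)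
  have clD: "compact (closure D)" using C_body closure_D by simp
  have dens0: "dens x = 0" if "x \<notin> closure D" for x
    using that closure_subset[of D] by (auto simp: dens_def)
  obtain B where B: "0 \<le> B" "\<And>x. \<bar>dens x\<bar> \<le> B" using compact_support_bounded[OF dens_continuous clD dens0] by blast
  \<comment> \<open>A lower bound for \<open>v\<close>, read off from an upper bound of the density;
    \<open>B + 1\<close> keeps the argument of the logarithm positive.\<close>
  define m where "m = (- ln (B + 1) - ln Z) / \<beta>"
  have m: "m \<le> v x" if "x \<in> D" for x
  proof -
    have "exp (- U x) \<le> B + 1" using B(2)[of x] that by (simp add: dens_def)
    then have "- U x \<le> ln (B + 1)" using B(1) by (simp add: ln_ge_iff)
    then show ?thesis using \<beta> that by (simp add: m_def U_in field_simps)
  qed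
  show ?thesis
  proof (rule brascamp_lieb[where W = "\<lambda>x. v x - m" and W' = "\<lambda>x h. grad v x \<bullet> h" and \<nu> = "\<nu> / \<beta>" and g' = "\<lambda>x h. grad g x \<bullet> h"])
    show "((\<lambda>x. v x - m) has_derivative (\<lambda>h. grad v x \<bullet> h)) (at x)" if "x \<in> D" for x
      using has_derivative_grad[OF v_differentiable(1)[OF that]] by (auto intro!: derivative_eq_intros)
    show "0 \<le> v x - m" if "x \<in> D" for x using m[OF that] by simp
    show "compact {x \<in> D. v x - m \<le> k}" for k
    proof -
      \<comment> \<open>Seen as a superlevel set of \<open>E\<close> at a positive level, the set is
        closed in the whole space: \<open>E\<close> is continuous and vanishes off
        \<open>D\<close>.\<close>
      have "{x \<in> D. v x - m \<le> k} = {x. exp (- \<beta> * (k + m)) \<le> E x}"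
      proof -
        have "(exp (- \<beta> * (k + m)) \<le> exp (- \<beta> * v x)) = (v x - m \<le> k)" for x
          using \<beta> by (simp add: mult_le_cancel_left_pos diff_le_eq)
        then show ?thesis by (auto simp: E_def simp del: exp_le_cancel_iff)
      qed
      moreover have "closed {x. exp (- \<beta> * (k + m)) \<le> E x}"
        by (intro closed_Collect_le continuous_intros E_continuous)
      moreover have "bounded {x \<in> D. v x - m \<le> k}" by (rule bounded_subset[OF C_body(7)]) auto
      ultimately show ?thesis by (simp add: compact_eq_bounded_closed)
    qed
    show "(grad v x \<bullet> h)\<^sup>2 \<le> \<nu> / \<beta> * (h \<bullet> (hess U x *v h))" if "x \<in> D" for x h
      using grad_v_bound[OF that, of h] \<beta> that by (simp add: hess_U scaleR_matrix_vector_assoc[symmetric])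
    show "(g has_derivative (\<lambda>h. grad g x \<bullet> h)) (at x)" if "x \<in> D" for x
      by (rule has_derivative_grad[OF g[OF that]])
    show "(grad g x \<bullet> h)\<^sup>2 \<le> Q x * (h \<bullet> (hess U x *v h))" if x: "x \<in> D" for x h
    proof -
      obtain w where w: "hess U x *v w = grad g x" "Q x = w \<bullet> (hess U x *v w)" using Qw[OF x] by blast
      have "grad g x \<bullet> h = w \<bullet> (hess U x *v h)"
        using hess_U_sym[OF x, of w h] w(1) by (simp add: inner_commute)
      then show ?thesis
        using symmetric_psd_Cauchy_Schwarz[OF hess_U_sym[OF x] hess_U_psd[OF x], of w h] w(2) by simp
    qed
  qed (use \<nu> \<beta> Qpos meas int in auto)
qed

end

section \<open>Exponential decay along the Fokker-Planck flow\<close>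

section \<open>Decay of the chi-squared divergence\<close>

context smooth_log_concave_prob
begin

lemma dens_pos: "x \<in> D \<Longrightarrow> 0 < dens x"
  by (simp add: dens_def)

lemma density_ratio:
  assumes p: "integrable lborel p" "\<And>x. 0 \<le> p x" and p0: "AE x in lborel. x \<notin> D \<longrightarrow> p x = 0"
  shows "density \<mu> (\<lambda>x. ennreal (p x / dens x)) = density lborel (\<lambda>x. ennreal (p x))"
proof -
  have [measurable]: "p \<in> borel_measurable borel" using p by (auto dest: borel_measurable_integrable)
  have "density \<mu> (\<lambda>x. ennreal (p x / dens x)) = density lborel (\<lambda>x. ennreal (dens x) * ennreal (p x / dens x))"
    by (subst density_density_eq) auto
  also have "\<dots> = density lborel (\<lambda>x. ennreal (p x))"
  proof (rule density_cong)
    show "AE x in lborel. ennreal (dens x) * ennreal (p x / dens x) = ennreal (p x)"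
      using p0 by eventually_elim (auto simp: dens_def ennreal_mult[symmetric] p)
  qed auto
  finally show ?thesis .
qed

text \<open>Almost-everywhere uniqueness identifies the abstract Radon-Nikodym derivative with
  \<open>p x / dens x\<close>; integrability of its square makes the extended value a real
  number.\<close>

lemma chi2_density:
  assumes p: "integrable lborel p" "\<And>x. 0 \<le> p x" and p0: "AE x in lborel. x \<notin> D \<longrightarrow> p x = 0"
    and int: "integrable \<mu> (\<lambda>x. (p x / dens x)\<^sup>2)"
  shows "chi2 (density lborel (\<lambda>x. ennreal (p x))) \<mu> = ereal (expectation (\<lambda>x. (p x / dens x)\<^sup>2) - 1)"
proof -
  have [measurable]: "p \<in> borel_measurable borel" using p by (auto dest: borel_measurable_integrable)
  let ?N = "density lborel (\<lambda>x. ennreal (p x))"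
  have ac: "absolutely_continuous \<mu> ?N"
    unfolding density_ratio[OF p p0, symmetric] by (rule absolutely_continuousI_density) measurable
  have "AE x in \<mu>. ennreal (p x / dens x) = RN_deriv \<mu> ?N x"
    by (rule RN_deriv_unique[OF _ density_ratio[OF p p0]]) measurable
  then have "AE x in \<mu>. (RN_deriv \<mu> ?N x)\<^sup>2 = ennreal ((p x / dens x)\<^sup>2)"
  proof eventually_elim
    case (elim x)
    show ?case unfolding elim[symmetric] by (rule ennreal_power) (simp add: p dens_nonneg)
  qed
  then have "(\<integral>\<^sup>+ x. (RN_deriv \<mu> ?N x)\<^sup>2 \<partial>\<mu>) = (\<integral>\<^sup>+ x. ennreal ((p x / dens x)\<^sup>2) \<partial>\<mu>)"
    by (rule nn_integral_cong_AE)
  also have "\<dots> = ennreal (expectation (\<lambda>x. (p x / dens x)\<^sup>2))"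
    using int by (intro nn_integral_eq_integral) auto
  finally show ?thesis using ac
    by (simp add: chi2_def enn2ereal_ennreal one_ereal_def)
qed

end

context exp_concave_barrier
begin

text \<open>The mean of the density ratio stays 1, so its variance is the divergence itself, and the
  dissipation identity closes to a differential inequality: \<open>F\<close> has derivative at most
  \<open>- 2 * (F t - 1)\<close>.\<close>

lemma chi2_decay:
  fixes p :: "real \<Rightarrow> real^'n \<Rightarrow> real"
  assumes p: "\<And>t. 0 \<le> t \<Longrightarrow> integrable lborel (p t)" "\<And>t. 0 \<le> t \<Longrightarrow> (LINT x|lborel. p t x) = 1"
    and p0: "\<And>t. 0 \<le> t \<Longrightarrow> AE x in lborel. x \<notin> D \<longrightarrow> p t x = 0"
    and fp: "fokker_planck (gibbs_potential \<beta> V) p" and reg: "chi2_regular (gibbs_potential \<beta> V) p"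
  shows "\<And>t. 0 \<le> t \<Longrightarrow> integrable \<mu> (\<lambda>x. (p t x / dens x)\<^sup>2)"
    and "\<And>t. 0 \<le> t \<Longrightarrow> expectation (\<lambda>x. (p t x / dens x)\<^sup>2) - 1
      \<le> exp (- 2 * t) * (expectation (\<lambda>x. (p 0 x / dens x)\<^sup>2) - 1)"
proof -
  let ?P = "gibbs_potential \<beta> V"
  define F where "F t = expectation (\<lambda>x. (p t x / dens x)\<^sup>2)" for t
  define r where "r t x = p t x / dens x" for t x
  have rel: "rel_density ?P (p t) = r t" for t
    by (simp add: fun_eq_iff rel_density_def r_def exp_neg_gibbs_potential)
  have int_D: "interior (edom ?P) = D" by (simp add: edom_gibbs_potential)
  have meas: "p t \<in> borel_measurable borel" if "0 \<le> t" for t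
    using p(1)[OF that] by (auto dest: borel_measurable_integrable)
  \<comment> \<open>Off \<open>D\<close> both sides are 0: the left by the indicator, the right
    because \<open>dens\<close> vanishes there.\<close>
  have sq: "indicator D x *\<^sub>R ((p t x)\<^sup>2 / dens x) = dens x * (p t x / dens x)\<^sup>2" for t x
    using dens_pos[of x] by (cases "x \<in> D") (auto simp: power_divide power2_eq_square dens_def)
  note R = reg[unfolded chi2_regular_def Let_def int_D exp_neg_gibbs_potential rel]
  have integ: "integrable \<mu> (\<lambda>x. (p t x / dens x)\<^sup>2)" if t: "0 \<le> t" for t
  proof -
    have "set_integrable lborel D (\<lambda>x. (p t x)\<^sup>2 / dens x)" using R t by blast
    then show ?thesis using meas[OF t] unfolding set_integrable_def sq by (subst integrable_dens_iff) auto
  qed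
  then show "\<And>t. 0 \<le> t \<Longrightarrow> integrable \<mu> (\<lambda>x. (p t x / dens x)\<^sup>2)" .
  have F: "(LINT x:D|lborel. (p t x)\<^sup>2 / dens x) = F t" if "0 \<le> t" for t
    unfolding set_lebesgue_integral_def sq F_def using meas[OF that] by (subst expectation_dens) auto
  have F_cont: "continuous_on {0..} F"
  proof (rule continuous_on_eq)
    show "continuous_on {0..} (\<lambda>t. LINT x:D|lborel. (p t x)\<^sup>2 / dens x)" using R by blast
  qed (simp add: F)
  have F_deriv: "\<exists>y. (F has_real_derivative y) (at t) \<and> y \<le> - 2 * (F t - 1)" if t: "0 < t" for t
  proof -
    note [measurable] = meas[of t] meas[OF less_imp_le[OF t]]
    define Q where "Q x = (if x \<in> D then grad (r t) x \<bullet> (matrix_inv (hess U x) *v grad (r t) x) else 0)" for x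
    have FP: "p t x > 0" "(\<lambda>z. ln (r t z)) differentiable (at x)"
      "((\<lambda>s. p s x) has_real_derivative divergence (fp_flux ?P (p t)) x) (at t)" if "x \<in> D" for x
      using fp t that unfolding fokker_planck_def int_D rel by auto
    have r_pos: "0 < r t x" if "x \<in> D" for x using FP(1)[OF that] dens_pos[OF that] by (simp add: r_def)
    \<comment> \<open>The equation provides differentiability of the logarithm of the ratio;
      exponentiating transfers it to the ratio and later removes the logarithm from the
      flux.\<close>
    have r_deriv: "(r t has_derivative (\<lambda>h. (r t x *\<^sub>R grad (\<lambda>z. ln (r t z)) x) \<bullet> h)) (at x)" if x: "x \<in> D" for x
    proof -
      have "((\<lambda>z. exp (ln (r t z))) has_derivative (\<lambda>h. (r t x *\<^sub>R grad (\<lambda>z. ln (r t z)) x) \<bullet> h)) (at x)"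
        using has_derivative_exp[OF has_derivative_grad[OF FP(2)[OF x]]] r_pos[OF x] by (simp add: mult.commute)
      then show ?thesis
        by (rule has_derivative_transform_within_open[OF _ C_body(6) x]) (simp add: r_pos)
    qed
    have grad_r: "grad (r t) x = r t x *\<^sub>R grad (\<lambda>z. ln (r t z)) x" if "x \<in> D" for x
      by (rule grad_eqI[OF r_deriv[OF that]])
    have grad_2r: "grad (\<lambda>z. 2 * r t z) x = 2 *\<^sub>R grad (r t) x" if "x \<in> D" for x
      using has_derivative_mult_right[OF r_deriv[OF that], of 2] grad_r[OF that]
      by (intro grad_eqI) (simp add: mult.assoc)
    have flux: "fp_flux ?P (p t) x = dens x *\<^sub>R (matrix_inv (hess U x) *v grad (r t) x)" if x: "x \<in> D" for x
    proof -
      have "p t x = dens x * r t x" using dens_pos[OF x] by (simp add: r_def)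
      then show ?thesis
        by (simp add: fp_flux_def rel grad_r[OF x] U_def[abs_def, symmetric] matrix_vector_mult_scaleR)
    qed
    have dQ: "indicator D x *\<^sub>R (grad (\<lambda>z. 2 * r t z) x \<bullet> fp_flux ?P (p t) x) = 2 * (dens x * Q x)" for x
      by (cases "x \<in> D") (simp_all add: grad_2r flux Q_def)
    have "set_integrable lborel D (\<lambda>x. grad (\<lambda>z. 2 * r t z) x \<bullet> fp_flux ?P (p t) x)" using R t by blast
    then have int2: "integrable lborel (\<lambda>x. 2 * (dens x * Q x))" unfolding set_integrable_def dQ .
    \<comment> \<open>Regularity supplies measurability only of the product with the density.
      Dividing by the density recovers \<open>Q\<close>: it is positive on \<open>D\<close>, and off
      \<open>D\<close> both \<open>Q\<close> and the quotient are 0.\<close>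
    have Q_meas [measurable]: "Q \<in> borel_measurable borel"
    proof -
      have [measurable]: "(\<lambda>x. 2 * (dens x * Q x)) \<in> borel_measurable borel"
        using int2 by (auto dest: borel_measurable_integrable)
      have "(\<lambda>x. 2 * (dens x * Q x) / (2 * dens x)) \<in> borel_measurable borel" by measurable
      also have "(\<lambda>x. 2 * (dens x * Q x) / (2 * dens x)) = Q"
        using dens_pos by (auto simp: fun_eq_iff Q_def dens_def)
      finally show ?thesis .
    qed
    have intQ: "integrable \<mu> Q"
      using int2 by (subst integrable_dens_iff) auto
    have deriv: "deriv (\<lambda>s. (p s x)\<^sup>2 / dens x) t = 2 * r t x * divergence (fp_flux ?P (p t)) x" if x: "x \<in> D" for x
    proof (rule DERIV_imp_deriv)
      show "((\<lambda>s. (p s x)\<^sup>2 / dens x) has_real_derivative 2 * r t x * divergence (fp_flux ?P (p t)) x) (at t)"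
        using FP(3)[OF x] dens_pos[OF x] by (auto intro!: derivative_eq_intros simp: r_def power2_eq_square)
    qed
    have "(LINT x:D|lborel. deriv (\<lambda>s. (p s x)\<^sup>2 / dens x) t)
        = (LINT x:D|lborel. 2 * r t x * divergence (fp_flux ?P (p t)) x)"
      unfolding set_lebesgue_integral_def
      by (intro Bochner_Integration.integral_cong refl) (auto simp: indicator_def deriv)
    also have "\<dots> = - (LINT x:D|lborel. grad (\<lambda>z. 2 * r t z) x \<bullet> fp_flux ?P (p t) x)" using R t by blast
    also have "\<dots> = - 2 * expectation Q"
      unfolding set_lebesgue_integral_def dQ by (simp add: expectation_dens)
    finally have eq: "(LINT x:D|lborel. deriv (\<lambda>s. (p s x)\<^sup>2 / dens x) t) = - 2 * expectation Q" .
    have "((\<lambda>s. LINT x:D|lborel. (p s x)\<^sup>2 / dens x) has_real_derivative - 2 * expectation Q) (at t)"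
      unfolding eq[symmetric] using R t by blast
    then have 1: "(F has_real_derivative - 2 * expectation Q) (at t)"
      by (rule has_field_derivative_transform_within_open[of _ _ _ "{0<..}"]) (use t F in auto)
    have "expectation (\<lambda>x. (r t x)\<^sup>2) - (expectation (r t))\<^sup>2 \<le> expectation Q"
    proof (rule poincare)
      show "r t differentiable (at x)" if "x \<in> D" for x using r_deriv[OF that] by (auto simp: differentiable_def)
      show "r t \<in> borel_measurable borel" unfolding r_def by measurable
      show "integrable \<mu> (\<lambda>x. (r t x)\<^sup>2)" unfolding r_def using integ t by simp
    qed (use intQ Q_meas in \<open>auto simp: Q_def\<close>)
    moreover have "expectation (r t) = 1"
      unfolding r_def using expectation_ratio(1)[OF p(1) p0] p(2) t by simp
    ultimately have "F t - 1 \<le> expectation Q" by (simp add: F_def r_def)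
    with 1 show ?thesis by (intro exI[of _ "- 2 * expectation Q"]) auto
  qed
  show "expectation (\<lambda>x. (p t x / dens x)\<^sup>2) - 1 \<le> exp (- 2 * t) * (expectation (\<lambda>x. (p 0 x / dens x)\<^sup>2) - 1)"
    if t: "0 \<le> t" for t
  proof -
    \<comment> \<open>An integrating factor. The derivative is known at positive times only, hence
      the combination of monotonicity on the open interval with continuity at 0.\<close>
    have "exp (2 * t) * (F t - 1) \<le> exp (2 * 0) * (F 0 - 1)"
    proof (rule DERIV_nonpos_imp_decreasing_open[OF t])
      fix s assume s: "0 < s" "s < t"
      obtain y where y: "(F has_real_derivative y) (at s)" "y \<le> - 2 * (F s - 1)" using F_deriv[OF s(1)] by blast
      have "((\<lambda>t. exp (2 * t) * (F t - 1)) has_real_derivative exp (2 * s) * (2 * (F s - 1) + y)) (at s)"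
        using y(1) by (auto intro!: derivative_eq_intros simp: algebra_simps)
      moreover have "exp (2 * s) * (2 * (F s - 1) + y) \<le> 0" using y(2) by (intro mult_nonneg_nonpos) auto
      ultimately show "\<exists>y. ((\<lambda>t. exp (2 * t) * (F t - 1)) has_real_derivative y) (at s) \<and> y \<le> 0" by blast
    next
      show "continuous_on {0..t} (\<lambda>t. exp (2 * t) * (F t - 1))"
        by (intro continuous_intros continuous_on_subset[OF F_cont]) auto
    qed
    then show ?thesis by (simp add: F_def exp_minus field_simps)
  qed
qed

text \<open>The frontier of a convex set is a null set, so the body and its interior carry the same
  uniform law; the estimates above are stated on the interior, where the potential is
  finite.\<close>

lemma measure_uniform:
  assumes A: "A \<in> sets borel"
  shows "measure (uniform_measure lborel C) A = measure (density lborel (\<lambda>x. ennreal (indicator D x / measure lborel D))) A"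
proof -
  have [measurable]: "C \<in> sets borel" "D \<in> sets borel" using C_body by (auto intro: borel_closed)
  have fin: "emeasure lborel D < \<infinity>" "emeasure lborel C < \<infinity>"
    using emeasure_bounded_finite[OF C_body(7)] emeasure_bounded_finite[OF compact_imp_bounded[OF C_body(2)]] by auto
  have "frontier C \<in> null_sets lborel"
  proof -
    have "frontier C \<in> null_sets lebesgue"
      using negligible_convex_frontier[OF C_body(1)] by (simp add: negligible_iff_null_sets)
    then show ?thesis by (subst (asm) null_sets_completion_iff) (auto intro: borel_closed)
  qed
  then have "AE x in lborel. x \<notin> frontier C" by (rule AE_not_in)
  then have AE: "AE x in lborel. x \<in> C \<longleftrightarrow> x \<in> D"
    by eventually_elim (use frontier_C interior_subset in blast)
  have m: "measure lborel (C \<inter> B) = measure lborel (D \<inter> B)" if [measurable]: "B \<in> sets borel" for B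
    using AE by (intro measure_eq_AE) (auto elim!: eventually_mono)
  have "emeasure lborel C \<noteq> 0"
    using m[of UNIV] measure_D_pos by (auto simp: measure_def)
  then have "measure (uniform_measure lborel C) A = measure lborel (C \<inter> A) / measure lborel C"
    using A fin by (intro measure_uniform_measure) auto
  also have "\<dots> = measure lborel (D \<inter> A) / measure lborel D" using m[OF A] m[of UNIV] by simp
  also have "\<dots> = (LINT x|lborel. indicator (D \<inter> A) x / measure lborel D)"
    using A fin by simp
  also have "\<dots> = (LINT x|lborel. indicator A x * (indicator D x / measure lborel D))"
    by (intro Bochner_Integration.integral_cong) (auto simp: indicator_def)
  also have "\<dots> = measure (density lborel (\<lambda>x. ennreal (indicator D x / measure lborel D))) A"
    using A fin by (intro measure_density_integral[symmetric]) auto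
  finally show ?thesis .
qed

end

section \<open>Passage from laws to densities, and the balance of constants\<close>

theorem corollary3:
  fixes C :: "(real^'n) set" and V :: "real^'n \<Rightarrow> ereal"
    and \<epsilon> \<nu> \<beta> :: real
    and M :: "'w measure" and F :: "real \<Rightarrow> 'w measure"
    and B X Y :: "real \<Rightarrow> 'w \<Rightarrow> real^'n"
    and p :: "real \<Rightarrow> real^'n \<Rightarrow> real"
  assumes "\<epsilon> > 0" and "\<nu> > 0"
    and "convex_body C"
    and "barrier C V"
    and "C2_on (interior C) (\<lambda>x. real_of_ereal (V x))"
    and "exp_concave_on C (1 / \<nu>) V"
    and "0 < \<beta>" and "\<beta> \<le> \<epsilon>\<^sup>2 / (2 * \<nu>)"
    and "newton_langevin M F B (gibbs_potential \<beta> V) X Y"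
    and "\<forall>x\<in>interior C. invertible (hess (\<lambda>z. real_of_ereal (gibbs_potential \<beta> V z)) x)"
    and "\<forall>t\<ge>0. (\<forall>x. 0 \<le> p t x) \<and> distributed M lborel (X t) (\<lambda>x. ennreal (p t x))"
    and "fokker_planck (gibbs_potential \<beta> V) p"
    and "chi2 (distr M borel (X 0)) (gibbs \<beta> V) < \<infinity> \<Longrightarrow> chi2_regular (gibbs_potential \<beta> V) p"
  shows "\<forall>t\<ge>0. ereal t \<ge> ereal (1/2) * eln (2 * chi2 (distr M borel (X 0)) (gibbs \<beta> V))
                         + ereal (ln (1 / \<epsilon>))
           \<longrightarrow> tv_dist (distr M borel (X t)) (uniform_measure lborel C) \<le> \<epsilon>"
proof (intro allI impI)
  interpret B: exp_concave_barrier C V \<nu> \<beta>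
    using assms by unfold_locales auto
  let ?P = "gibbs_potential \<beta> V"
  let ?\<chi> = "chi2 (distr M borel (X 0)) (gibbs \<beta> V)"
  fix t :: real assume t: "0 \<le> t"
    and le: "ereal t \<ge> ereal (1/2) * eln (2 * ?\<chi>) + ereal (ln (1 / \<epsilon>))"
  interpret M: prob_space M using assms(9) by (simp add: newton_langevin_def brownian_motion_def)
  have law: "distr M borel (X s) = density lborel (\<lambda>x. ennreal (p s x))" if "0 \<le> s" for s
  proof -
    have "distr M borel (X s) = distr M lborel (X s)" by (rule distr_cong) auto
    also have "\<dots> = density lborel (\<lambda>x. ennreal (p s x))"
      using assms(11) that distributed_distr_eq_density by blast
    finally show ?thesis .
  qed
  have Xm: "X s \<in> borel_measurable M" if "0 \<le> s" for s
    using assms(11) that distributed_measurable[of M lborel "X s"] by auto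
  have pn: "0 \<le> p s x" if "0 \<le> s" for s x using assms(11) that by blast
  have pm: "p s \<in> borel_measurable borel" if "0 \<le> s" for s
  proof -
    have "(\<lambda>x. ennreal (p s x)) \<in> borel_measurable lborel"
      using assms(11) that distributed_borel_measurable by blast
    then have "(\<lambda>x. enn2real (ennreal (p s x))) \<in> borel_measurable borel" by measurable
    then show ?thesis using pn[OF that] by simp
  qed
  have nn: "(\<integral>\<^sup>+ x. ennreal (p s x) \<partial>lborel) = 1" if s: "0 \<le> s" for s
  proof -
    interpret L: prob_space "distr M borel (X s)" by (rule M.prob_space_distr[OF Xm[OF s]])
    have "1 = emeasure (density lborel (\<lambda>x. ennreal (p s x))) UNIV"
      using L.emeasure_space_1 law[OF s] by simp
    also have "\<dots> = (\<integral>\<^sup>+ x. ennreal (p s x) \<partial>lborel)"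
      using pm[OF s] by (subst emeasure_density) auto
    finally show ?thesis ..
  qed
  have p_int: "integrable lborel (p s)" and p_one: "(LINT x|lborel. p s x) = 1" if s: "0 \<le> s" for s
  proof -
    show "integrable lborel (p s)" using nn[OF s] pm[OF s] pn[OF s] by (intro integrableI_nonneg) auto
    show "(LINT x|lborel. p s x) = 1" using nn[OF s] pm[OF s] pn[OF s] by (subst integral_eq_nn_integral) auto
  qed
  \<comment> \<open>The process stays in the interior at every sample point, so its law gives no
    mass to the complement.\<close>
  have p_out: "AE x in lborel. x \<notin> interior C \<longrightarrow> p s x = 0" if s: "0 \<le> s" for s
  proof -
    have "X s \<omega> \<in> interior (edom ?P)" if "\<omega> \<in> space M" for \<omega>
      using assms(9) s that unfolding newton_langevin_def by blast
    then have "X s \<omega> \<in> interior C" if "\<omega> \<in> space M" for \<omega>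
      using that by (simp add: B.edom_gibbs_potential)
    then have "X s -` (- interior C) \<inter> space M = {}" by auto
    then have "0 = emeasure (distr M borel (X s)) (- interior C)"
      using Xm[OF s] by (subst emeasure_distr) auto
    also have "\<dots> = (\<integral>\<^sup>+ x. ennreal (p s x) * indicator (- interior C) x \<partial>lborel)"
      unfolding law[OF s] using pm[OF s] by (subst emeasure_density) auto
    finally have "(\<integral>\<^sup>+ x. ennreal (p s x) * indicator (- interior C) x \<partial>lborel) = 0" by simp
    then have "AE x in lborel. ennreal (p s x) * indicator (- interior C) x = 0"
      using pm[OF s] by (subst (asm) nn_integral_0_iff_AE) auto
    then show ?thesis by eventually_elim (use pn[OF s] in \<open>auto simp: indicator_def ennreal_eq_0_iff intro: antisym\<close>)
  qed
  \<comment> \<open>An infinite divergence would make the required time infinite, which no real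
    \<open>t\<close> reaches; so the regularity of the flow may be invoked.\<close>
  have "?\<chi> < \<infinity>"
  proof (rule ccontr)
    assume "\<not> ?thesis"
    then have "?\<chi> = \<infinity>" by simp
    with le show False by (simp add: eln_def)
  qed
  then have reg: "chi2_regular ?P p" by (rule assms(13))
  have decay: "integrable B.\<mu> (\<lambda>x. (p s x / B.dens x)\<^sup>2)"
    "B.expectation (\<lambda>x. (p s x / B.dens x)\<^sup>2) - 1 \<le> exp (- 2 * s) * (B.expectation (\<lambda>x. (p 0 x / B.dens x)\<^sup>2) - 1)"
    if "0 \<le> s" for s
    using B.chi2_decay[OF p_int p_one p_out assms(12) reg that] by simp_all
  define F where "F s = B.expectation (\<lambda>x. (p s x / B.dens x)\<^sup>2) - 1" for s
  have chi: "?\<chi> = ereal (F 0)"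
    unfolding law[OF order_refl] B.gibbs_eq F_def
    using p_int[OF order_refl] pn[OF order_refl] p_out[OF order_refl] decay(1)[OF order_refl] by (rule B.chi2_density)
  \<comment> \<open>The prescribed time is the one at which \<open>exp (- 2 * t) * F 0\<close> has
    come down to \<open>\<epsilon>\<^sup>2 / 2\<close>.\<close>
  have Ft: "F t \<le> \<epsilon>\<^sup>2 / 2"
  proof (cases "0 < F 0")
    case True
    have eq: "2 * ?\<chi> = ereal (2 * F 0)" by (simp add: chi flip: times_ereal.simps)
    have "ereal t \<ge> ereal (1 / 2 * ln (2 * F 0) + ln (1 / \<epsilon>))"
      using le True unfolding eq by (simp add: eln_def)
    then have "ln (2 * F 0) + 2 * ln (1 / \<epsilon>) \<le> 2 * t" by simp
    then have "- 2 * t \<le> ln (\<epsilon>\<^sup>2 / (2 * F 0))"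
      using True \<open>0 < \<epsilon>\<close> by (simp add: ln_div ln_mult ln_realpow)
    then have "exp (- 2 * t) \<le> \<epsilon>\<^sup>2 / (2 * F 0)"
      using True \<open>0 < \<epsilon>\<close> by (metis divide_pos_pos exp_le_cancel_iff exp_ln mult_pos_pos zero_less_numeral zero_less_power)
    then have "exp (- 2 * t) * F 0 \<le> \<epsilon>\<^sup>2 / (2 * F 0) * F 0" using True by (intro mult_right_mono) auto
    then show ?thesis using decay(2)[OF t] True by (simp add: F_def[symmetric])
  next
    \<comment> \<open>Here \<open>eln\<close> is \<open>-\<infinity>\<close> and the time condition
      says nothing; the decay estimate by itself keeps \<open>F t\<close> nonpositive.\<close>
    case False
    have "F t \<le> exp (- 2 * t) * F 0" using decay(2)[OF t] by (simp add: F_def)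
    also have "\<dots> \<le> 0" using False by (intro mult_nonneg_nonpos) auto
    finally show ?thesis using zero_le_power2[of \<epsilon>] by linarith
  qed
  \<comment> \<open>0.72 squared is 0.5184, just above the 1/2 in \<open>Ft\<close>.\<close>
  have 1: "sqrt (F t) \<le> 72/100 * \<epsilon>"
  proof (rule real_le_lsqrt)
    have "(72/100 * \<epsilon>)\<^sup>2 = 5184/10000 * \<epsilon>\<^sup>2" by (simp add: power2_eq_square)
    then show "F t \<le> (72/100 * \<epsilon>)\<^sup>2" using Ft zero_le_power2[of \<epsilon>] by linarith
  qed (use \<open>0 < \<epsilon>\<close> in auto)
  have \<beta>\<nu>: "\<beta> * \<nu> \<le> \<epsilon>\<^sup>2 / 2" using assms(8) \<open>0 < \<nu>\<close> by (simp add: field_simps)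
  \<comment> \<open>With \<open>ln 2\<close> at most 25/36 the radicand is at most 25/72 of
    \<open>\<epsilon>\<^sup>2\<close>, and 25/72 is below 0.6 squared. Half of 0.72 and 0.6 add up
    to 0.96.\<close>
  have 2: "sqrt (\<beta> * \<nu> * ln 2) \<le> 6/10 * \<epsilon>"
  proof (rule real_le_lsqrt)
    have "\<beta> * \<nu> * ln 2 \<le> \<epsilon>\<^sup>2 / 2 * (25/36)" using \<beta>\<nu> ln2_le_25_over_36 by (intro mult_mono) auto
    also have "\<dots> \<le> 36/100 * \<epsilon>\<^sup>2" by simp
    also have "\<dots> = (6/10 * \<epsilon>)\<^sup>2" by (simp add: power2_eq_square)
    finally show "\<beta> * \<nu> * ln 2 \<le> (6/10 * \<epsilon>)\<^sup>2" .
  qed (use \<open>0 < \<epsilon>\<close> in auto)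
  show "tv_dist (distr M borel (X t)) (uniform_measure lborel C) \<le> \<epsilon>"
    unfolding tv_dist_def
  proof (rule cSUP_least)
    show "sets (uniform_measure lborel C) \<noteq> {}" by auto
    fix A assume "A \<in> sets (uniform_measure lborel C)"
    then have A: "A \<in> sets borel" by simp
    have "\<bar>measure (distr M borel (X t)) A - measure B.\<mu> A\<bar> \<le> sqrt (F t) / 2"
      unfolding law[OF t] F_def by (rule B.tv_chi2_le[OF p_int pn p_one p_out decay(1) A]) (rule t)+
    moreover have "\<bar>measure B.\<mu> A - measure (uniform_measure lborel C) A\<bar> \<le> sqrt (\<beta> * \<nu> * ln 2)"
      unfolding B.measure_uniform[OF A]
      using \<open>0 < \<beta>\<close> \<open>0 < \<nu>\<close> B.U_midpoint by (intro B.tv_uniform_le A) auto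
    ultimately show "\<bar>measure (distr M borel (X t)) A - measure (uniform_measure lborel C) A\<bar> \<le> \<epsilon>"
      using 1 2 \<open>0 < \<epsilon>\<close> by linarith
  qed
qed

end
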